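(* Let $D\in(0,1]$ and let $(l_n)_{n\in\mathbb{N}}$ be a non-decreasing sequence of positive integers with $l_n\to\infty$ as $n\to\infty$ and $l_n=\mathcal{O}\big(n^{(1+D)/2-\epsilon}\big)$ for some $\epsilon>0$. Let $(\xi_n)_{n\in\mathbb{N}}$ be a stationary Gaussian process, centered with $\operatorname{Var}(\xi_n)=1$, with covariance function $\gamma(k):=\operatorname{Cov}(\xi_1,\xi_{1+k})=k^{-D}L_\gamma(k)$ for $k\ge 1$, such that: (1) $L_\gamma$ is a slowly varying function (at infinity) and there is a constant $K<\infty$ such that for all $k\in\mathbb{N}$ and all integers $l'\in\{l_k,\ldots,k\}$, $$\max_{\tilde k\in\{k+1,\ldots,k+2l'-1\}}\left|L_\gamma(k)-L_\gamma(\tilde k)\right|\le K\,\frac{l'}{k}\,\min\{L_\gamma(k),1\};$$ (2) $(\xi_n)_{n\in\mathbb{N}}$ has a spectral density $f$ with $f(x)=|x|^{D-1}L_f(x)$, where $L_f$ is slowly varying (at the origin), bounded away from $0$ on $[0,\pi]$, and such that $\lim_{x\to0}L_f(x)\in(0,\infty]$ exists. Let $G:\mathbb{R}\to\mathbb{R}$ be a measurable function and $X_n:=G(\xi_n)$. Let $T_n=T_n(X_1,\ldots,X_n)$, $n\in\mathbb{N}$, be a sequence of real-valued statistics such that $T_n\Rightarrow T$ in distribution as $n\to\infty$ for a random variable $T$ with distribution function $F_T$. Write $F_{T_n}(t)=P(T_n\le t)$ and, with $l=l_n$, $$\hat F_{l,n}(t)=\frac{1}{n-l+1}\sum_{i=1}^{n-l+1}1_{\{T_l(X_i,\ldots,X_{i+l-1})\le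 t\}},\qquad t\in\mathbb{R}.$$ Then, as $n\to\infty$, $$F_{T_n}(t)-\hat F_{l,n}(t)\longrightarrow 0\quad\text{in probability}$$ for all points of continuity $t$ of $F_T$. If $F_T$ is continuous, then $$\sup_{t\in\mathbb{R}}\left|F_{T_n}(t)-\hat F_{l,n}(t)\right|\longrightarrow 0\quad\text{in probability}.$$
   Context: A statistic $T_n$ is a measurable function $T_n:\mathbb{R}^n\to\mathbb{R}$ evaluated at $(X_1,\ldots,X_n)$; $T_l(X_i,\ldots,X_{i+l-1})$ is the same function $T_l:\mathbb{R}^l\to\mathbb{R}$ evaluated on a block of $l$ consecutive observations. $\hat F_{l,n}$ is defined when $l_n\le n$, which holds for all large $n$. The set $\{l_k,\ldots,k\}$ is empty if $l_k>k$. Slowly varying functions are positive. The spectral density $f$ is the even function on $[-\pi,\pi]$ (so $L_f$ is even) with $\gamma(k)=\int_{-\pi}^{\pi}e^{ik\lambda}f(\lambda)\,d\lambda$. "Bounded away from $0$ on $[0,\pi]$" means $L_f\ge C$ there for some constant $C>0$. Since the process is Gaussian, stationarity means all finite-dimensional distributions are shift invariant. *)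

theory Defs
  imports "HOL-Probability.Probability" "HOL-Library.Landau_Symbols"
begin

definition covariance :: "'a measure \<Rightarrow> ('a \<Rightarrow> real) \<Rightarrow> ('a \<Rightarrow> real) \<Rightarrow> real" where
  "covariance M X Y =
     (\<integral>\<omega>. (X \<omega> - integral\<^sup>L M X) * (Y \<omega> - integral\<^sup>L M Y) \<partial>M)"

text \<open>The point masses are included as the normal distributions with standard deviation 0.\<close>

definition gaussian_rv :: "'a measure \<Rightarrow> ('a \<Rightarrow> real) \<Rightarrow> bool" where
  "gaussian_rv M X \<longleftrightarrow>
     X \<in> borel_measurable M \<and>
     (\<exists>\<mu> \<sigma>. (\<sigma> > 0 \<and> distr M borel X = density lborel (normal_density \<mu> \<sigma>)) \<or>
            (\<sigma> = 0 \<and> distr M borel X = return borel \<mu>))"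

definition gaussian_process :: "'a measure \<Rightarrow> 'i set \<Rightarrow> ('i \<Rightarrow> 'a \<Rightarrow> real) \<Rightarrow> bool" where
  "gaussian_process M I \<xi> \<longleftrightarrow>
     (\<forall>J c. finite J \<and> J \<subseteq> I \<longrightarrow> gaussian_rv M (\<lambda>\<omega>. \<Sum>j\<in>J. c j * \<xi> j \<omega>))"

text \<open>All processes are indexed by the positive integers; the value at index 0 is irrelevant.\<close>

definition stationary_process :: "'a measure \<Rightarrow> (nat \<Rightarrow> 'a \<Rightarrow> real) \<Rightarrow> bool" where
  "stationary_process M \<xi> \<longleftrightarrow>
     (\<forall>n\<ge>1. \<xi> n \<in> borel_measurable M) \<and>
     (\<forall>J h. finite J \<and> J \<subseteq> {1..} \<longrightarrow>
        distr M (\<Pi>\<^sub>M j\<in>J. borel) (\<lambda>\<omega>. \<lambda>j\<in>J. \<xi> (j + h) \<omega>) =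
        distr M (\<Pi>\<^sub>M j\<in>J. borel) (\<lambda>\<omega>. \<lambda>j\<in>J. \<xi> j \<omega>))"

definition autocovariance :: "'a measure \<Rightarrow> (nat \<Rightarrow> 'a \<Rightarrow> real) \<Rightarrow> nat \<Rightarrow> real" where
  "autocovariance M \<xi> k = covariance M (\<xi> 1) (\<xi> (1 + k))"

definition slowly_varying_at_infinity :: "(real \<Rightarrow> real) \<Rightarrow> bool" where
  "slowly_varying_at_infinity L \<longleftrightarrow>
     (\<forall>x>0. L x > 0) \<and> (\<forall>a>0. ((\<lambda>x. L (a * x) / L x) \<longlongrightarrow> 1) at_top)"

definition slowly_varying_at_origin :: "(real \<Rightarrow> real) \<Rightarrow> bool" where
  "slowly_varying_at_origin L \<longleftrightarrow>
     (\<forall>\<^sub>F x in at_right 0. L x > 0) \<and>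
     (\<forall>a>0. ((\<lambda>x. L (a * x) / L x) \<longlongrightarrow> 1) (at_right 0))"

text \<open>Since \<open>f\<close> is even, the Fourier representation for \<open>k \<ge> 0\<close> determines it for all integers.\<close>

definition spectral_density :: "(nat \<Rightarrow> real) \<Rightarrow> (real \<Rightarrow> real) \<Rightarrow> bool" where
  "spectral_density \<gamma> f \<longleftrightarrow>
     set_integrable lborel {-pi..pi} f \<and>
     (\<forall>x\<in>{-pi..pi}. f x \<ge> 0 \<and> f (- x) = f x) \<and>
     (\<forall>k. complex_of_real (\<gamma> k) =
        (CLBINT x:{-pi..pi}. exp (\<i> * of_nat k * of_real x) * of_real (f x)))"

text \<open>A statistic of sample size \<open>n\<close> is a function of vectors indexed by \<open>{1..n}\<close>.
  \<open>block X i m \<omega>\<close> is the vector \<open>(X i \<omega>, \<dots>, X (i + m - 1) \<omega>)\<close>, re-indexed by \<open>{1..m}\<close>.\<close>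

definition statistics :: "(nat \<Rightarrow> (nat \<Rightarrow> real) \<Rightarrow> real) \<Rightarrow> bool" where
  "statistics T \<longleftrightarrow> (\<forall>n\<ge>1. T n \<in> borel_measurable (\<Pi>\<^sub>M j\<in>{1..n}. borel))"

definition block :: "(nat \<Rightarrow> 'a \<Rightarrow> real) \<Rightarrow> nat \<Rightarrow> nat \<Rightarrow> 'a \<Rightarrow> nat \<Rightarrow> real" where
  "block X i m \<omega> = (\<lambda>j\<in>{1..m}. X (i + j - 1) \<omega>)"

text \<open>The number of blocks is written \<open>n + 1 - m\<close>, which is \<open>n - m + 1\<close> whenever \<open>m \<le> n\<close>.
  For \<open>m > n\<close> the subsampling estimator takes the junk value 0.\<close>

definition subsampling_cdf ::
  "(nat \<Rightarrow> (nat \<Rightarrow> real) \<Rightarrow> real) \<Rightarrow> (nat \<Rightarrow> 'a \<Rightarrow> real) \<Rightarrow> nat \<Rightarrow> nat \<Rightarrow> real \<Rightarrow> 'a \<Rightarrow> real" where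
  "subsampling_cdf T X m n t \<omega> =
     1 / real (n + 1 - m) * (\<Sum>i=1..n + 1 - m. indicator {..t} (T m (block X i m \<omega>)))"

text \<open>Measurability is part of the definition, since \<open>measure M A = 0\<close> for non-measurable \<open>A\<close>.\<close>

definition tendsto_in_probability ::
  "'a measure \<Rightarrow> (nat \<Rightarrow> 'a \<Rightarrow> real) \<Rightarrow> real \<Rightarrow> bool" where
  "tendsto_in_probability M Y c \<longleftrightarrow>
     (\<forall>\<^sub>F n in sequentially. Y n \<in> borel_measurable M) \<and>
     (\<forall>e>0. (\<lambda>n. measure M {\<omega> \<in> space M. \<bar>Y n \<omega> - c\<bar> > e}) \<longlonglongrightarrow> 0)"

end

theory Submission
  imports Defs
begin

text \<open>Split \<open>F_{T_n} - F^_{l,n}\<close> into \<open>F_{T_n} - F_{T_l}\<close>, which vanishes by weak convergence, and the centred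
  estimator, whose variance is an average of covariances of the events \<open>T_l(X_i, \<dots>, X_{i+l-1}) \<le> t\<close>.
  For blocks at distance \<open>k \<ge> \<delta> n\<close> these are bounded by the maximal correlation of the blocks. For
  Gaussian blocks it is attained by linear functions: for trigonometric polynomials in the \<open>\<xi>_j\<close>
  the covariance is a quadratic form in \<open>exp g - 1\<close>, \<open>g\<close> the covariance kernel, to which the Schur
  product theorem applies, and trigonometric polynomials are dense.

  To correlate \<open>\<Sum> a_p \<xi>_{i+p}\<close> with \<open>\<Sum> b_q \<xi>_{i+k+q}\<close>, replace every \<open>\<gamma> (k + q - p)\<close> by
  \<open>\<gamma> (k - l)\<close>; condition (1) bounds the error by \<open>O (l / k^(1+D))\<close> up to small powers. The spectral
  density is at least \<open>c x^(D-1)\<close>, so the variance dominates \<open>\<Sum> a_p^2\<close> and, by duality with the Dirichlet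
  kernel, also \<open>l^-(D+\<eta>) (\<Sum> a_p)^2\<close>. Hence the correlation is \<open>O ((l/k)^D + l^2 / k^(1+D))\<close> up to small powers,
  which tends to \<open>0\<close> because \<open>l = O (n^((1+D)/2-\<epsilon>))\<close>.\<close>

subsection \<open>Positive semidefinite kernels\<close>

text \<open>Nothing but measurability is known of \<open>G\<close> and \<open>T\<close>, so
  covariances must be bounded for all events of a block at once and uniformly in the growing
  dimension \<open>l\<close>, while the covariance function gives access to linear forms only. The
  link is that joint moments of Gaussian phases depend on \<open>exp g\<close>: if the Gram kernel
  \<open>g\<close> of two families stays positive semidefinite after its cross blocks are divided by
  \<rho>, so does \<open>exp g - 1\<close>, which up to coefficients is the kernel of covariances.
  The dimension never enters.

  For the constant part, the crude estimate \<open>(\<Sum> a_p)^2 \<le> l * \<Sum> a_p^2\<close>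
  would give a correlation of order \<open>l / k^D\<close> and force \<open>l\<close> below
  \<open>n^D\<close>, which is smaller than \<open>n^((1+D)/2)\<close> when \<open>D < 1\<close>.
  The duality bound replaces \<open>l\<close> by \<open>l^(D+\<eta>)\<close>; then the remainder
  \<open>l^2 / k^(1+D)\<close> is the critical term, and it produces the exponent
  \<open>(1+D)/2\<close>. Pairs of blocks at lag below \<open>\<delta> n\<close> are only bounded
  trivially; they form a fraction of order \<delta> of all pairs, and \<delta> is chosen from the
  required accuracy.\<close>

definition psd_on :: "'i set \<Rightarrow> ('i \<Rightarrow> 'i \<Rightarrow> real) \<Rightarrow> bool" where
  "psd_on I K \<longleftrightarrow> (\<forall>i\<in>I. \<forall>j\<in>I. K i j = K j i) \<and>
     (\<forall>c. 0 \<le> (\<Sum>i\<in>I. \<Sum>j\<in>I. c i * c j * K i j))"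

lemma psd_onI:
  assumes "\<And>i j. i \<in> I \<Longrightarrow> j \<in> I \<Longrightarrow> K i j = K j i"
    and "\<And>c. 0 \<le> (\<Sum>i\<in>I. \<Sum>j\<in>I. c i * c j * K i j)"
  shows "psd_on I K"
  using assms unfolding psd_on_def by blast

lemma psd_onD: "psd_on I K \<Longrightarrow> 0 \<le> (\<Sum>i\<in>I. \<Sum>j\<in>I. c i * c j * K i j)"
  unfolding psd_on_def by blast

lemma psd_on_sym: "psd_on I K \<Longrightarrow> i \<in> I \<Longrightarrow> j \<in> I \<Longrightarrow> K i j = K j i"
  unfolding psd_on_def by blast

lemma psd_on_cong:
  assumes "psd_on I K" "\<And>i j. i \<in> I \<Longrightarrow> j \<in> I \<Longrightarrow> K i j = K' i j"
  shows "psd_on I K'"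
proof (rule psd_onI)
  show "K' i j = K' j i" if "i \<in> I" "j \<in> I" for i j
    using assms(2)[of i j] assms(2)[of j i] psd_on_sym[OF assms(1)] that by simp
  show "0 \<le> (\<Sum>i\<in>I. \<Sum>j\<in>I. c i * c j * K' i j)" for c
    using psd_onD[OF assms(1), of c] assms(2) by simp
qed

lemma quadratic_form_insert:
  fixes K :: "'i \<Rightarrow> 'i \<Rightarrow> real"
  assumes "finite I" "a \<notin> I" "\<And>i. i \<in> I \<Longrightarrow> K i a = K a i"
  shows "(\<Sum>i\<in>insert a I. \<Sum>j\<in>insert a I. c i * c j * K i j) =
     c a ^ 2 * K a a + 2 * c a * (\<Sum>i\<in>I. c i * K a i) + (\<Sum>i\<in>I. \<Sum>j\<in>I. c i * c j * K i j)"
proof -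
  have "(\<Sum>i\<in>I. c i * c a * K i a) = c a * (\<Sum>i\<in>I. c i * K a i)"
    unfolding sum_distrib_left by (rule sum.cong) (use assms in \<open>auto simp: algebra_simps\<close>)
  moreover have "(\<Sum>i\<in>I. c a * c i * K a i) = c a * (\<Sum>i\<in>I. c i * K a i)"
    unfolding sum_distrib_left by (rule sum.cong) (auto simp: algebra_simps)
  ultimately show ?thesis
    using assms(1,2) by (simp add: sum.distrib power2_eq_square)
qed

text \<open>The induction step splits off one rank-one term and passes to the Schur complement.\<close>

lemma psd_on_decomposition:
  assumes "finite I" "psd_on I K"
  shows "\<exists>(R::nat) x. \<forall>i\<in>I. \<forall>j\<in>I. K i j = (\<Sum>r<R. x r i * x r j)"
  using assms
proof (induction I arbitrary: K)
  case empty
  then show ?case by simp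
next
  case (insert a I)
  have sym: "K i j = K j i" if "i \<in> insert a I" "j \<in> insert a I" for i j
    using psd_on_sym[OF insert.prems] that by blast
  have nonneg: "0 \<le> c a ^ 2 * K a a + 2 * c a * (\<Sum>i\<in>I. c i * K a i)
      + (\<Sum>i\<in>I. \<Sum>j\<in>I. c i * c j * K i j)" for c
    using psd_onD[OF insert.prems, of c] quadratic_form_insert[of I a K c] insert.hyps sym
    by simp
  have diag: "0 \<le> K a a"
  proof -
    define c where "c i = (if i = a then 1 else 0 :: real)" for i
    have c: "c i = 0" if "i \<in> I" for i
      using insert.hyps that by (auto simp: c_def)
    show ?thesis using nonneg[of c] by (simp add: c) (simp add: c_def)
  qed
  show ?case
  proof (cases "K a a = 0")
    case True
    have zero: "K a i = 0" if "i \<in> I" for i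
    proof (rule ccontr)
      assume ne: "K a i \<noteq> 0"
      \<comment> \<open>The vector with entry \<open>t\<close> at \<open>a\<close> and 1 at
        \<open>i\<close> has form value \<open>2 * t * K a i + K i i\<close>; this \<open>t\<close>
        makes it -1.\<close>
      define t where "t = - (K i i + 1) / (2 * K a i)"
      define c where "c = (\<lambda>j. if j = a then t else if j = i then 1 else 0)"
      have 1: "(\<Sum>j\<in>I. c j * K a j) = (\<Sum>j\<in>I. if j = i then K a i else 0)"
        by (rule sum.cong) (use insert.hyps in \<open>auto simp: c_def\<close>)
      have 2: "(\<Sum>p\<in>I. \<Sum>q\<in>I. c p * c q * K p q) =
          (\<Sum>p\<in>I. \<Sum>q\<in>I. if q = i then (if p = i then K i i else 0) else 0)"
        by (intro sum.cong refl) (use insert.hyps in \<open>auto simp: c_def\<close>)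
      have 3: "(\<Sum>p\<in>I. \<Sum>q\<in>I. c p * c q * K p q) = K i i"
        unfolding 2 using insert.hyps that by simp
      have "0 \<le> 2 * t * K a i + K i i"
        using nonneg[of c] 1 3 that insert.hyps True by (simp add: c_def)
      also have "2 * t * K a i = - (K i i + 1)"
        using ne by (simp add: t_def)
      finally show False by simp
    qed
    have "psd_on I K"
    proof (rule psd_onI)
      show "0 \<le> (\<Sum>i\<in>I. \<Sum>j\<in>I. c i * c j * K i j)" for c
        using nonneg[of c] True zero by simp
    qed (use sym in auto)
    then obtain R :: nat and x where x: "\<forall>i\<in>I. \<forall>j\<in>I. K i j = (\<Sum>r<R. x r i * x r j)"
      using insert.IH by blast
    have "K i j = (\<Sum>r<R. ((x r)(a := 0)) i * ((x r)(a := 0)) j)"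
      if "i \<in> insert a I" "j \<in> insert a I" for i j
    proof (cases "i = a \<or> j = a")
      case True
      then show ?thesis using \<open>K a a = 0\<close> zero sym[of i a] that by auto
    next
      case False
      then show ?thesis using x that by simp
    qed
    then show ?thesis by (intro exI[of _ R] exI[of _ "\<lambda>r. (x r)(a := 0)"]) blast
  next
    case False
    define d where "d = K a a"
    have d: "d > 0" using False diag by (simp add: d_def)
    have "psd_on I (\<lambda>i j. K i j - K a i * K a j / d)"
    proof (rule psd_onI)
      fix c
      define S where "S = (\<Sum>i\<in>I. c i * K a i)"
      \<comment> \<open>The minimiser of the quadratic form in the coordinate \<open>a\<close>; the
        minimum is the form of the Schur complement.\<close>
      define c' where "c' = c(a := - S / d)"
      have S': "(\<Sum>i\<in>I. c' i * K a i) = S"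
        unfolding S_def by (rule sum.cong) (use insert.hyps in \<open>auto simp: c'_def\<close>)
      have Q: "(\<Sum>i\<in>I. \<Sum>j\<in>I. c' i * c' j * K i j) = (\<Sum>i\<in>I. \<Sum>j\<in>I. c i * c j * K i j)"
        by (intro sum.cong refl) (use insert.hyps in \<open>auto simp: c'_def\<close>)
      have "0 \<le> (S / d)\<^sup>2 * d + 2 * (- S / d) * S + (\<Sum>i\<in>I. \<Sum>j\<in>I. c i * c j * K i j)"
        using nonneg[of c'] unfolding S' Q by (simp add: c'_def d_def)
      moreover have "(S / d)\<^sup>2 * d + 2 * (- S / d) * S = - (S * S / d)"
        using d by (simp add: field_simps power2_eq_square)
      moreover have "S * S / d = (\<Sum>i\<in>I. \<Sum>j\<in>I. c i * c j * (K a i * K a j / d))"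
        unfolding S_def sum_product sum_divide_distrib
        by (intro sum.cong refl) simp
      moreover have "(\<Sum>i\<in>I. \<Sum>j\<in>I. c i * c j * (K i j - K a i * K a j / d)) =
          (\<Sum>i\<in>I. \<Sum>j\<in>I. c i * c j * K i j) - (\<Sum>i\<in>I. \<Sum>j\<in>I. c i * c j * (K a i * K a j / d))"
        by (simp add: right_diff_distrib sum_subtractf)
      ultimately show "0 \<le> (\<Sum>i\<in>I. \<Sum>j\<in>I. c i * c j * (K i j - K a i * K a j / d))"
        by linarith
    qed (use sym in auto)
    then obtain R :: nat and x
      where x: "\<forall>i\<in>I. \<forall>j\<in>I. K i j - K a i * K a j / d = (\<Sum>r<R. x r i * x r j)"
      using insert.IH by blast
    \<comment> \<open>Slot \<open>R\<close> holds the split-off rank-one term; the vectors of the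
      Schur complement are extended by 0 to \<open>a\<close>.\<close>
    define y where "y r i = (if r = R then K a i / sqrt d else if i = a then 0 else x r i)" for r i
    have "K i j = (\<Sum>r<Suc R. y r i * y r j)" if "i \<in> insert a I" "j \<in> insert a I" for i j
    proof -
      have "(\<Sum>r<Suc R. y r i * y r j) =
          (\<Sum>r<R. if i = a \<or> j = a then 0 else x r i * x r j) + K a i * K a j / d"
        using d by (simp add: y_def) (auto intro: sum.cong)
      also have "\<dots> = K i j"
      proof (cases "i = a \<or> j = a")
        case True
        then show ?thesis using sym[of i a] sym[of j a] that d by (auto simp: d_def)
      next
        case False
        then have "K i j - K a i * K a j / d = (\<Sum>r<R. x r i * x r j)"
          using x that by blast
        then show ?thesis using False by simp
      qed
      finally show ?thesis by simp
    qed
    then show ?thesis by blast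
  qed
qed

text \<open>Schur product theorem. With \<open>A\<close> written as a sum of rank-one kernels, the
  form of the product is a sum of forms of \<open>B\<close> at the rescaled vectors
  \<open>c i * x r i\<close>.\<close>

lemma psd_on_mult:
  assumes "finite I" "psd_on I A" "psd_on I B"
  shows "psd_on I (\<lambda>i j. A i j * B i j)"
proof (rule psd_onI)
  fix c
  obtain R :: nat and x where x: "\<forall>i\<in>I. \<forall>j\<in>I. A i j = (\<Sum>r<R. x r i * x r j)"
    using psd_on_decomposition[OF assms(1,2)] by blast
  have "(\<Sum>i\<in>I. \<Sum>j\<in>I. c i * c j * (A i j * B i j)) =
      (\<Sum>i\<in>I. \<Sum>j\<in>I. \<Sum>r<R. (c i * x r i) * (c j * x r j) * B i j)"
    using x by (intro sum.cong refl) (simp add: sum_distrib_left sum_distrib_right algebra_simps)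
  also have "\<dots> = (\<Sum>r<R. \<Sum>i\<in>I. \<Sum>j\<in>I. (c i * x r i) * (c j * x r j) * B i j)"
    by (simp add: sum.swap[of _ "{..<R}"])
  also have "\<dots> \<ge> 0"
    by (intro sum_nonneg psd_onD[OF assms(3)])
  finally show "0 \<le> (\<Sum>i\<in>I. \<Sum>j\<in>I. c i * c j * (A i j * B i j))" .
qed (use assms psd_on_sym in metis)

lemma psd_on_power_Suc:
  assumes "finite I" "psd_on I K"
  shows "psd_on I (\<lambda>i j. K i j ^ Suc m)"
proof (induction m)
  case 0
  then show ?case using assms by simp
next
  case (Suc m)
  then show ?case using psd_on_mult[OF assms Suc] by simp
qed

text \<open>The kernel is \<open>r\<close> times the all-ones kernel plus \<open>1 - r\<close> times
  the two block indicators. It serves as a Schur multiplier that damps the cross blocks.\<close>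

lemma psd_on_two_blocks:
  fixes s :: "'i \<Rightarrow> bool"
  assumes "finite I" "0 \<le> r" "r \<le> (1::real)"
  shows "psd_on I (\<lambda>i j. if s i = s j then 1 else r)"
proof (rule psd_onI)
  fix c :: "_ \<Rightarrow> real"
  define S where "S b = (\<Sum>i\<in>I. if s i = b then c i else 0)" for b :: bool
  have tot: "(\<Sum>i\<in>I. c i) = S True + S False"
    unfolding S_def sum.distrib[symmetric] by (rule sum.cong) auto
  have "(\<Sum>i\<in>I. \<Sum>j\<in>I. c i * c j * (if s i = s j then 1 else r)) =
     (\<Sum>i\<in>I. \<Sum>j\<in>I. r * (c i * c j) +
        (1 - r) * ((if s i = True then c i else 0) * (if s j = True then c j else 0)
              + (if s i = False then c i else 0) * (if s j = False then c j else 0)))"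
    by (intro sum.cong refl) (auto simp: algebra_simps)
  also have "\<dots> = r * ((\<Sum>i\<in>I. c i) * (\<Sum>i\<in>I. c i)) + (1 - r) * (S True * S True + S False * S False)"
    unfolding S_def sum_product sum.distrib sum_distrib_left[symmetric] ..
  also have "\<dots> \<ge> 0"
    using assms by (intro add_nonneg_nonneg mult_nonneg_nonneg zero_le_square) auto
  finally show "0 \<le> (\<Sum>i\<in>I. \<Sum>j\<in>I. c i * c j * (if s i = s j then 1 else r))" .
qed auto

text \<open>Expand the exponential: the \<open>m\<close>-th power of the kernel would carry the factor \<open>\<rho> ^ m\<close>
  across the blocks, and \<open>\<rho> \<le> 1\<close> leaves room to keep only one factor \<open>\<rho>\<close>.\<close>

lemma psd_on_exp_minus_one:
  fixes g :: "'i \<Rightarrow> 'i \<Rightarrow> real" and s :: "'i \<Rightarrow> bool"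
  assumes I: "finite I" and \<rho>: "0 < \<rho>" "\<rho> \<le> 1"
    and psd: "psd_on I (\<lambda>i j. if s i = s j then g i j else g i j / \<rho>)"
  shows "psd_on I (\<lambda>i j. if s i = s j then exp (g i j) - 1 else (exp (g i j) - 1) / \<rho>)"
    (is "psd_on I ?B")
proof (rule psd_onI)
  have gsym: "g i j = g j i" if "i \<in> I" "j \<in> I" for i j
    using psd_on_sym[OF psd that] \<rho> by (auto split: if_splits)
  show "?B i j = ?B j i" if "i \<in> I" "j \<in> I" for i j
    using gsym[OF that] by auto
  fix c
  define B where "B m i j = (if s i = s j then g i j ^ Suc m else g i j ^ Suc m / \<rho>)" for m i j
  have psdB: "psd_on I (B m)" for m
  proof (rule psd_on_cong)
    \<comment> \<open>The power carries \<open>1 / \<rho> ^ (m + 1)\<close> across the blocks; the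
      multiplier \<open>\<rho> ^ m\<close> brings this back to \<open>1 / \<rho>\<close>.\<close>
    show "psd_on I (\<lambda>i j. (if s i = s j then g i j else g i j / \<rho>) ^ Suc m * (if s i = s j then 1 else \<rho> ^ m))"
      by (intro psd_on_mult psd_on_power_Suc psd_on_two_blocks I psd) (use \<rho> in \<open>auto simp: power_le_one\<close>)
    show "(if s i = s j then g i j else g i j / \<rho>) ^ Suc m * (if s i = s j then 1 else \<rho> ^ m) = B m i j" for i j
      using \<rho> by (auto simp: B_def power_divide)
  qed
  have exp1: "(\<lambda>m. x ^ Suc m / fact (Suc m)) sums (exp x - 1)" for x :: real
    using exp_converges[of x] by (subst sums_Suc_iff) (simp add: divide_inverse mult.commute)
  have "(\<lambda>m. B m i j / fact (Suc m)) sums ?B i j" for i j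
    using exp1[of "g i j"] sums_divide[OF exp1[of "g i j"], of \<rho>]
    by (auto simp: B_def divide_divide_eq_left mult.commute simp del: fact_Suc)
  then have sums: "(\<lambda>m. \<Sum>i\<in>I. \<Sum>j\<in>I. c i * c j * (B m i j / fact (Suc m))) sums
      (\<Sum>i\<in>I. \<Sum>j\<in>I. c i * c j * ?B i j)"
    by (intro sums_sum sums_mult)
  have "0 \<le> (\<Sum>i\<in>I. \<Sum>j\<in>I. c i * c j * (B m i j / fact (Suc m)))" for m
  proof -
    have "(\<Sum>i\<in>I. \<Sum>j\<in>I. c i * c j * (B m i j / fact (Suc m))) =
        (\<Sum>i\<in>I. \<Sum>j\<in>I. c i * c j * B m i j) / fact (Suc m)"
      unfolding sum_divide_distrib by (intro sum.cong refl) simp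
    then show ?thesis using psd_onD[OF psdB, of c m] by (simp del: fact_Suc)
  qed
  then show "0 \<le> (\<Sum>i\<in>I. \<Sum>j\<in>I. c i * c j * ?B i j)"
    by (rule sums_le[OF _ sums_zero sums])
qed

text \<open>For a real kernel the real part separates into the forms at \<open>Re z\<close> and at
  \<open>Im z\<close>; the mixed terms are purely imaginary.\<close>

lemma psd_on_complex:
  fixes z :: "'i \<Rightarrow> complex"
  assumes "psd_on I K"
  shows "0 \<le> Re (\<Sum>i\<in>I. \<Sum>j\<in>I. z i * cnj (z j) * of_real (K i j))"
proof -
  have "Re (\<Sum>i\<in>I. \<Sum>j\<in>I. z i * cnj (z j) * of_real (K i j)) =
     (\<Sum>i\<in>I. \<Sum>j\<in>I. Re (z i) * Re (z j) * K i j) + (\<Sum>i\<in>I. \<Sum>j\<in>I. Im (z i) * Im (z j) * K i j)"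
    by (simp add: sum.distrib[symmetric] algebra_simps)
  then show ?thesis
    using psd_onD[OF assms, of "\<lambda>i. Re (z i)"] psd_onD[OF assms, of "\<lambda>i. Im (z i)"] by simp
qed

subsection \<open>Square integrable functions\<close>

lemma measurable_cnj [measurable]: "cnj \<in> borel_measurable borel"
  by (intro borel_measurable_continuous_onI continuous_intros)

lemma sum_lessThan_add:
  fixes f :: "nat \<Rightarrow> 'b::comm_monoid_add"
  shows "(\<Sum>i<n + m. f i) = (\<Sum>i<n. f i) + (\<Sum>j<m. f (n + j))"
  by (induction m) (auto simp: add.assoc)

text \<open>Integrates \<open>\<bar>a * b\<bar> \<le> (t * a\<^sup>2 + b\<^sup>2 / t) / 2\<close>
  and then chooses \<open>t\<close>. The absolute value inside the integral is what the later
  domination arguments use.\<close>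

lemma Cauchy_Schwarz_integral:
  fixes f g :: "'a \<Rightarrow> real"
  assumes [measurable]: "f \<in> borel_measurable M" "g \<in> borel_measurable M"
    and f: "integrable M (\<lambda>x. (f x)\<^sup>2)" and g: "integrable M (\<lambda>x. (g x)\<^sup>2)"
  shows "integrable M (\<lambda>x. f x * g x)"
    and "(\<integral>x. \<bar>f x * g x\<bar> \<partial>M)\<^sup>2 \<le> (\<integral>x. (f x)\<^sup>2 \<partial>M) * (\<integral>x. (g x)\<^sup>2 \<partial>M)"
proof -
  have amgm: "\<bar>a * b\<bar> \<le> (t * a\<^sup>2 + b\<^sup>2 / t) / 2" if "t > 0" for a b t :: real
  proof -
    have "0 \<le> (t * \<bar>a\<bar> - \<bar>b\<bar>)\<^sup>2" by simp
    then have "t * (2 * \<bar>a * b\<bar>) \<le> t * (t * a\<^sup>2 + b\<^sup>2 / t)"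
      using that by (simp add: power2_eq_square abs_mult algebra_simps)
    then show ?thesis using that by (simp only: mult_le_cancel_left_pos) simp
  qed
  show int: "integrable M (\<lambda>x. f x * g x)"
  proof (rule Bochner_Integration.integrable_bound)
    show "integrable M (\<lambda>x. (f x)\<^sup>2 + (g x)\<^sup>2)" using f g by simp
    have "\<bar>f x * g x\<bar> \<le> (f x)\<^sup>2 + (g x)\<^sup>2" for x
      using amgm[of 1 "f x" "g x"] sum_power2_ge_zero[of "f x" "g x"] by simp
    then show "AE x in M. norm (f x * g x) \<le> norm ((f x)\<^sup>2 + (g x)\<^sup>2)" by simp
  qed auto
  define A B S where "A = (\<integral>x. (f x)\<^sup>2 \<partial>M)" and "B = (\<integral>x. (g x)\<^sup>2 \<partial>M)"
    and "S = (\<integral>x. \<bar>f x * g x\<bar> \<partial>M)"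
  have nonneg: "0 \<le> A" "0 \<le> B" "0 \<le> S" unfolding A_def B_def S_def by auto
  have le: "2 * S \<le> t * A + B / t" if "t > 0" for t
  proof -
    have "S \<le> (\<integral>x. (t * (f x)\<^sup>2 + (g x)\<^sup>2 / t) / 2 \<partial>M)"
      unfolding S_def using int f g amgm[OF that] by (intro integral_mono) auto
    also have "\<dots> = (t * A + B / t) / 2" unfolding A_def B_def using f g by simp
    finally show ?thesis by simp
  qed
  have "S\<^sup>2 \<le> A * B"
  proof (cases "S = 0")
    case True
    then show ?thesis using nonneg by simp
  next
    case False
    then have S: "S > 0" using nonneg by simp
    show ?thesis
    proof (cases "A = 0")
      case True
      \<comment> \<open>For \<open>A = 0\<close> a large weight must force \<open>S = 0\<close>;
        with \<open>t = (B + 1) / S\<close> the inequality already gives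
        \<open>2 * S \<le> S\<close>.\<close>
      have "2 * S \<le> S * (B / (B + 1))"
        using le[of "(B + 1) / S"] True nonneg S by (simp add: field_simps)
      also have "\<dots> \<le> S * 1"
        using nonneg by (intro mult_left_mono) auto
      finally show ?thesis using S by simp
    next
      case False
      \<comment> \<open>The weight \<open>t = S / A\<close> turns \<open>t * A\<close> into
        \<open>S\<close>, which is absorbed on the left.\<close>
      then have "S \<le> A * B / S"
        using le[of "S / A"] nonneg S by (simp add: field_simps)
      then show ?thesis using S by (simp add: field_simps power2_eq_square)
    qed
  qed
  then show "(\<integral>x. \<bar>f x * g x\<bar> \<partial>M)\<^sup>2 \<le> (\<integral>x. (f x)\<^sup>2 \<partial>M) * (\<integral>x. (g x)\<^sup>2 \<partial>M)"
    unfolding A_def B_def S_def .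
qed

lemma norm_add_square_le: "(cmod (x + y))\<^sup>2 \<le> 2 * (cmod x)\<^sup>2 + 2 * (cmod y)\<^sup>2"
proof -
  have "(cmod (x + y))\<^sup>2 \<le> (cmod x + cmod y)\<^sup>2" by (intro power_mono norm_triangle_ineq) simp
  also have "\<dots> \<le> 2 * (cmod x)\<^sup>2 + 2 * (cmod y)\<^sup>2"
    using sum_squares_bound[of "cmod x" "cmod y"] by (simp add: power2_sum)
  finally show ?thesis .
qed

text \<open>The chord of the concave sine between 0 and \<open>pi / 2\<close>. It serves both the
  approximation of indicators and the bound on the Dirichlet kernel.\<close>

lemma Jordan_sin_ge:
  assumes "0 \<le> y" "y \<le> pi / 2"
  shows "2 * y / pi \<le> sin y"
proof -
  have "convex_on {0..pi} (\<lambda>x::real. - sin x)"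
  proof (rule f''_ge0_imp_convex)
    show "((\<lambda>x. - sin x) has_real_derivative - cos x) (at x)" for x :: real
      by (auto intro!: derivative_eq_intros)
    show "((\<lambda>x. - cos x) has_real_derivative sin x) (at x)" for x :: real
      by (auto intro!: derivative_eq_intros)
  qed (auto intro: sin_ge_zero)
  from convex_onD[OF this, of "2 * y / pi" 0 "pi / 2"] assms pi_gt_zero show ?thesis
    by (simp add: field_simps)
qed

text \<open>Makes a half-line indicator a limit of bounded functions of a sine. The scale
  \<open>Suc n\<close> moves any fixed \<open>x\<close> into the range where the sine has the sign
  of its argument, and the squared factor pushes every positive value past the clamp.\<close>

lemma tendsto_clamped_sin:
  fixes x :: real
  shows "(\<lambda>n. min 1 (max 0 ((real (Suc n))\<^sup>2 * sin (x / real (Suc n))))) \<longlonglongrightarrow> (if 0 < x then 1 else 0)"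
proof (cases "0 < x")
  case True
  \<comment> \<open>From \<open>r \<ge> x\<close> the argument \<open>x / r\<close> lies below
    \<open>pi / 2\<close>; from \<open>r \<ge> pi / x\<close> the Jordan bound
    \<open>2 * r * x / pi\<close> exceeds 1.\<close>
  obtain N :: nat where N: "x + pi / x < real N" using reals_Archimedean2 by blast
  have "min 1 (max 0 ((real (Suc n))\<^sup>2 * sin (x / real (Suc n)))) = 1" if "n \<ge> N" for n
  proof -
    define r where "r = real (Suc n)"
    have r: "r > 0" "r \<ge> x + pi / x" using N that by (auto simp: r_def)
    have rx: "r \<ge> x" "r \<ge> pi / x" using r True pi_gt_zero by (auto simp: add_increasing add_increasing2 intro: order_trans[rotated])
    have "x / r \<le> pi / 2" using mult_mono[of 2 pi x r] rx r pi_ge_two True by (simp add: field_simps)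
    then have "2 * (x / r) / pi \<le> sin (x / r)" using True r by (intro Jordan_sin_ge) auto
    then have "r\<^sup>2 * (2 * (x / r) / pi) \<le> r\<^sup>2 * sin (x / r)" by (intro mult_left_mono) auto
    moreover have "r\<^sup>2 * (2 * (x / r) / pi) = 2 * (r * x / pi)" using r by (simp add: power2_eq_square)
    moreover have "1 \<le> r * x / pi" using rx True by (simp add: field_simps)
    ultimately have "1 \<le> r\<^sup>2 * sin (x / r)" by linarith
    then show ?thesis unfolding r_def[symmetric] by simp
  qed
  then show ?thesis using True by (intro tendsto_eventually) (auto simp: eventually_sequentially)
next
  case False
  obtain N :: nat where N: "- x < real N" using reals_Archimedean2 by blast
  have "min 1 (max 0 ((real (Suc n))\<^sup>2 * sin (x / real (Suc n)))) = 0" if "n \<ge> N" for n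
  proof -
    define r where "r = real (Suc n)"
    have r: "r > 0" "- x \<le> r" using N that by (auto simp: r_def)
    have "- (x / r) \<le> 1" using r by (simp add: field_simps)
    then have "0 \<le> sin (- (x / r))" using r False pi_ge_two
      by (intro sin_ge_zero) (auto simp: divide_nonpos_pos)
    then have "r\<^sup>2 * sin (x / r) \<le> 0" by (simp add: mult_nonneg_nonpos)
    then show ?thesis unfolding r_def[symmetric] by simp
  qed
  then show ?thesis using False by (intro tendsto_eventually) (auto simp: eventually_sequentially)
qed

subsection \<open>Maximal correlation of Gaussian spaces\<close>

definition rv_subspace :: "('a \<Rightarrow> real) set \<Rightarrow> bool" where
  "rv_subspace H \<longleftrightarrow> (\<lambda>_. 0) \<in> H \<and> (\<forall>u\<in>H. \<forall>v\<in>H. (\<lambda>x. u x + v x) \<in> H) \<and>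
     (\<forall>c. \<forall>u\<in>H. (\<lambda>x. c * u x) \<in> H)"

lemma rv_subspaceD:
  assumes "rv_subspace H"
  shows "(\<lambda>_. 0) \<in> H" "u \<in> H \<Longrightarrow> v \<in> H \<Longrightarrow> (\<lambda>x. u x + v x) \<in> H"
    "u \<in> H \<Longrightarrow> (\<lambda>x. c * u x) \<in> H"
  using assms unfolding rv_subspace_def by auto

lemma rv_subspace_sum:
  assumes H: "rv_subspace H" and u: "\<And>i. i \<in> I \<Longrightarrow> u i \<in> H"
  shows "(\<lambda>x. \<Sum>i\<in>I. c i * u i x) \<in> H"
  using u
proof (induction I rule: infinite_finite_induct)
  case (insert x F)
  then show ?case
    using rv_subspaceD(2)[OF H rv_subspaceD(3)[OF H, of "u x" "c x"]] by simp
qed (auto intro: rv_subspaceD[OF H])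

section \<open>Trigonometric polynomials with random phases\<close>

inductive_set trig_polys :: "('a \<Rightarrow> real) set \<Rightarrow> ('a \<Rightarrow> complex) set" for H where
  monomial: "u \<in> H \<Longrightarrow> (\<lambda>x. c * cis (u x)) \<in> trig_polys H"
| add: "P \<in> trig_polys H \<Longrightarrow> Q \<in> trig_polys H \<Longrightarrow> (\<lambda>x. P x + Q x) \<in> trig_polys H"

lemma trig_polys_mult:
  assumes H: "rv_subspace H" and P: "P \<in> trig_polys H" and Q: "Q \<in> trig_polys H"
  shows "(\<lambda>x. P x * Q x) \<in> trig_polys H"
  using P
proof (induction rule: trig_polys.induct)
  case (monomial u c)
  from Q show ?case
  proof (induction rule: trig_polys.induct)
    case (monomial v d)
    have "(\<lambda>x. (c * d) * cis (u x + v x)) \<in> trig_polys H"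
      using \<open>u \<in> H\<close> \<open>v \<in> H\<close> by (intro trig_polys.monomial rv_subspaceD[OF H])
    then show ?case by (simp add: cis_mult[symmetric] mult.assoc mult.left_commute)
  next
    case (add P Q)
    then show ?case using trig_polys.add[OF add.IH] by (simp add: distrib_left)
  qed
next
  case (add P P')
  then show ?case using trig_polys.add[OF add.IH] by (simp add: distrib_right)
qed

lemma trig_polys_const:
  assumes "rv_subspace H"
  shows "(\<lambda>_. c) \<in> trig_polys H"
  using trig_polys.monomial[OF rv_subspaceD(1)[OF assms], of c] by simp

lemma trig_polys_bounded: "P \<in> trig_polys H \<Longrightarrow> \<exists>B. \<forall>x. cmod (P x) \<le> B"
proof (induction rule: trig_polys.induct)
  case (monomial u c)
  then show ?case by (intro exI[of _ "cmod c"]) (simp add: norm_mult)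
next
  case (add P Q)
  then show ?case by (meson add_mono norm_triangle_ineq order_trans)
qed

lemma trig_polys_representation:
  assumes "P \<in> trig_polys H"
  shows "\<exists>(n::nat) c u. (\<forall>p<n. u p \<in> H) \<and> P = (\<lambda>x. \<Sum>p<n. c p * cis (u p x))"
  using assms
proof (induction rule: trig_polys.induct)
  case (monomial u c)
  then show ?case by (intro exI[of _ "1::nat"] exI[of _ "\<lambda>_. c"] exI[of _ "\<lambda>_. u"]) simp
next
  case (add P Q)
  obtain n :: nat and c u where P: "\<forall>p<n. u p \<in> H" "P = (\<lambda>x. \<Sum>p<n. c p * cis (u p x))"
    using add.IH(1) by blast
  obtain m :: nat and d v where Q: "\<forall>p<m. v p \<in> H" "Q = (\<lambda>x. \<Sum>p<m. d p * cis (v p x))"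
    using add.IH(2) by blast
  define c' where "c' p = (if p < n then c p else d (p - n))" for p
  define u' where "u' p = (if p < n then u p else v (p - n))" for p
  have "P x + Q x = (\<Sum>p<n + m. c' p * cis (u' p x))" for x
  proof -
    have "(\<Sum>p<n + m. c' p * cis (u' p x)) =
        (\<Sum>p<n. c' p * cis (u' p x)) + (\<Sum>p<m. c' (n + p) * cis (u' (n + p) x))"
      by (rule sum_lessThan_add)
    then show ?thesis by (simp add: P Q c'_def u'_def)
  qed
  moreover have "\<forall>p<n + m. u' p \<in> H" using P Q by (auto simp: u'_def)
  ultimately show ?case by (intro exI[of _ "n + m"] exI[of _ c'] exI[of _ u']) auto
qed

lemma trig_polys_mono:
  assumes "H\<^sub>1 \<subseteq> H\<^sub>2"
  shows "trig_polys H\<^sub>1 \<subseteq> trig_polys H\<^sub>2"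
proof
  fix P assume "P \<in> trig_polys H\<^sub>1"
  then show "P \<in> trig_polys H\<^sub>2"
    using assms by induction (auto intro: trig_polys.intros)
qed

text \<open>Since \<open>H\<close> is linear, the one-dimensional characteristic functions determine
  all finite joint laws (Cramer-Wold). The formula builds in mean 0 and covers degenerate variables
  of variance 0.\<close>

locale gaussian_space = prob_space M for M :: "'a measure" +
  fixes H :: "('a \<Rightarrow> real) set"
  assumes subspace: "rv_subspace H"
    and rv_measurable: "u \<in> H \<Longrightarrow> u \<in> borel_measurable M"
    and square_integrable: "u \<in> H \<Longrightarrow> integrable M (\<lambda>x. (u x)\<^sup>2)"
    and char_fun: "u \<in> H \<Longrightarrow> (\<integral>x. cis (u x) \<partial>M) = of_real (exp (- (\<integral>x. (u x)\<^sup>2 \<partial>M) / 2))"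
begin

section \<open>Covariances of trigonometric polynomials\<close>

abbreviation ip :: "('a \<Rightarrow> real) \<Rightarrow> ('a \<Rightarrow> real) \<Rightarrow> real" where
  "ip u v \<equiv> \<integral>x. u x * v x \<partial>M"

abbreviation cmoment :: "('a \<Rightarrow> complex) \<Rightarrow> ('a \<Rightarrow> complex) \<Rightarrow> complex" where
  "cmoment U V \<equiv> \<integral>x. U x * cnj (V x) \<partial>M"

abbreviation sqdist :: "('a \<Rightarrow> complex) \<Rightarrow> ('a \<Rightarrow> complex) \<Rightarrow> real" where
  "sqdist U V \<equiv> \<integral>x. (cmod (U x - V x))\<^sup>2 \<partial>M"

lemma integrable_ip:
  assumes "u \<in> H" "v \<in> H"
  shows "integrable M (\<lambda>x. u x * v x)"
  using assms by (intro Cauchy_Schwarz_integral(1) rv_measurable square_integrable)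

lemma ip_sum:
  assumes "\<And>i. i \<in> I \<Longrightarrow> u i \<in> H" "\<And>j. j \<in> J \<Longrightarrow> v j \<in> H"
  shows "ip (\<lambda>x. \<Sum>i\<in>I. c i * u i x) (\<lambda>x. \<Sum>j\<in>J. d j * v j x) =
    (\<Sum>i\<in>I. \<Sum>j\<in>J. c i * d j * ip (u i) (v j))"
proof -
  have "ip (\<lambda>x. \<Sum>i\<in>I. c i * u i x) (\<lambda>x. \<Sum>j\<in>J. d j * v j x) =
      (\<integral>x. (\<Sum>i\<in>I. \<Sum>j\<in>J. (c i * d j) * (u i x * v j x)) \<partial>M)"
    by (simp add: sum_product algebra_simps)
  also have "\<dots> = (\<Sum>i\<in>I. \<Sum>j\<in>J. c i * d j * ip (u i) (v j))"
    using assms integrable_ip by (simp add: Bochner_Integration.integral_sum)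
  finally show ?thesis .
qed

text \<open>Apply \<open>char_fun\<close> to \<open>u - v\<close>, which lies in \<open>H\<close>,
  and expand the square. The factorised form isolates \<open>exp (ip u v)\<close> as the only joint
  quantity.\<close>

lemma char_fun_diff:
  assumes "u \<in> H" "v \<in> H"
  shows "(\<integral>x. cis (u x) * cnj (cis (v x)) \<partial>M) =
    of_real (exp (- ip u u / 2) * exp (- ip v v / 2) * exp (ip u v))"
proof -
  have "(\<lambda>x. u x + (- 1) * v x) \<in> H"
    using assms by (intro rv_subspaceD[OF subspace])
  from char_fun[OF this] have "(\<integral>x. cis (u x - v x) \<partial>M) = of_real (exp (- (\<integral>x. (u x - v x)\<^sup>2 \<partial>M) / 2))"
    by simp
  moreover have "(\<integral>x. (u x - v x)\<^sup>2 \<partial>M) = (\<integral>x. u x * u x + v x * v x - 2 * (u x * v x) \<partial>M)"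
    by (simp add: power2_eq_square algebra_simps)
  moreover have "\<dots> = ip u u + ip v v - 2 * ip u v"
    using assms integrable_ip by simp
  moreover have "exp (- (ip u u + ip v v - 2 * ip u v) / 2) =
      exp (- ip u u / 2) * exp (- ip v v / 2) * exp (ip u v)"
    unfolding exp_add[symmetric] by (simp add: field_simps)
  moreover have "cis (u x) * cnj (cis (v x)) = cis (u x - v x)" for x
    by (simp add: cis_cnj cis_mult)
  ultimately show ?thesis by simp
qed

lemma trig_polys_measurable [measurable]:
  assumes "P \<in> trig_polys H"
  shows "P \<in> borel_measurable M"
  using assms
proof (induction rule: trig_polys.induct)
  case (monomial u c)
  then have [measurable]: "u \<in> borel_measurable M" by (rule rv_measurable)
  show ?case unfolding cis_conv_exp by measurable
qed auto

lemma trig_polys_integrable_mult: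
  assumes "P \<in> trig_polys H" "Q \<in> trig_polys H"
  shows "integrable M (\<lambda>x. P x * cnj (Q x))"
proof -
  obtain A B where "\<forall>x. cmod (P x) \<le> A" "\<forall>x. cmod (Q x) \<le> B"
    using assms trig_polys_bounded by metis
  then have "cmod (P x * cnj (Q x)) \<le> A * B" for x
    unfolding norm_mult complex_mod_cnj by (intro mult_mono) (auto intro: order_trans[OF norm_ge_zero])
  then show ?thesis
    using assms trig_polys_measurable by (intro integrable_const_bound[where B = "A * B"]) auto
qed

text \<open>The marginal exponentials are absorbed into the coefficients; subtracting the product of
  the means is then exactly the passage from \<open>exp\<close> to \<open>exp - 1\<close>.\<close>

lemma covariance_representation:
  assumes u: "\<And>p. p \<in> I \<Longrightarrow> u p \<in> H" and v: "\<And>q. q \<in> J \<Longrightarrow> v q \<in> H"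
    and fin: "finite I" "finite J"
    and P: "P = (\<lambda>x. \<Sum>p\<in>I. c p * cis (u p x))" and Q: "Q = (\<lambda>x. \<Sum>q\<in>J. d q * cis (v q x))"
  shows "(cmoment P Q) - (\<integral>x. P x \<partial>M) * cnj (\<integral>x. Q x \<partial>M) =
    (\<Sum>p\<in>I. \<Sum>q\<in>J. (c p * of_real (exp (- ip (u p) (u p) / 2))) *
        cnj (d q * of_real (exp (- ip (v q) (v q) / 2))) * of_real (exp (ip (u p) (v q)) - 1))"
proof -
  have cis_meas: "(\<lambda>x. cis (w x)) \<in> borel_measurable M" if "w \<in> H" for w
    using rv_measurable[OF that] unfolding cis_conv_exp by measurable
  have int: "integrable M (\<lambda>x. cis (w x))" if "w \<in> H" for w
    using cis_meas[OF that] by (intro integrable_const_bound[where B = 1]) auto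
  have int2: "integrable M (\<lambda>x. cis (w x) * cnj (cis (w' x)))" if "w \<in> H" "w' \<in> H" for w w'
    using cis_meas[OF that(1)] cis_meas[OF that(2)]
    by (intro integrable_const_bound[where B = 1]) (auto simp: norm_mult)
  have mean: "(\<integral>x. cis (w x) \<partial>M) = of_real (exp (- ip w w / 2))" if "w \<in> H" for w
    using char_fun[OF that] by (simp add: power2_eq_square)
  have EP: "(\<integral>x. P x \<partial>M) = (\<Sum>p\<in>I. c p * of_real (exp (- ip (u p) (u p) / 2)))"
    unfolding P using u int mean by (simp add: Bochner_Integration.integral_sum)
  have EQ: "(\<integral>x. Q x \<partial>M) = (\<Sum>q\<in>J. d q * of_real (exp (- ip (v q) (v q) / 2)))"
    unfolding Q using v int mean by (simp add: Bochner_Integration.integral_sum)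
  have "(cmoment P Q) =
      (\<integral>x. (\<Sum>p\<in>I. \<Sum>q\<in>J. (c p * cnj (d q)) * (cis (u p x) * cnj (cis (v q x)))) \<partial>M)"
    unfolding P Q by (simp add: sum_product algebra_simps)
  also have "\<dots> = (\<Sum>p\<in>I. \<Sum>q\<in>J. (c p * cnj (d q)) *
      of_real (exp (- ip (u p) (u p) / 2) * exp (- ip (v q) (v q) / 2) * exp (ip (u p) (v q))))"
    using u v int2 char_fun_diff by (simp add: Bochner_Integration.integral_sum del: of_real_mult)
  finally have EPQ: "(cmoment P Q) = \<dots>" .
  show ?thesis
    unfolding EP EQ EPQ cnj_sum sum_product sum_subtractf[symmetric]
    by (intro sum.cong refl) (simp add: algebra_simps)
qed

text \<open>With the phases of \<open>P\<close> and \<open>Q\<close> joined into one family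
  \<open>w\<close>, the hypothesis \<open>corr\<close> yields that the Gram kernel with cross blocks
  divided by \<rho> is positive semidefinite. \<open>psd_on_exp_minus_one\<close> transfers this to
  the covariance kernel. The arithmetic mean in place of a geometric one keeps both ends quadratic
  forms.\<close>

lemma trig_polys_covariance_le:
  assumes sub: "rv_subspace H\<^sub>1" "rv_subspace H\<^sub>2" "H\<^sub>1 \<subseteq> H" "H\<^sub>2 \<subseteq> H" and \<rho>: "0 < \<rho>" "\<rho> \<le> 1"
    and corr: "\<And>u v. u \<in> H\<^sub>1 \<Longrightarrow> v \<in> H\<^sub>2 \<Longrightarrow> \<bar>ip u v\<bar> \<le> \<rho> / 2 * (ip u u + ip v v)"
    and P: "P \<in> trig_polys H\<^sub>1" and Q: "Q \<in> trig_polys H\<^sub>2"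
  shows "Re ((cmoment P Q) - (\<integral>x. P x \<partial>M) * cnj (\<integral>x. Q x \<partial>M)) \<le>
    \<rho> / 2 * (Re (cmoment P P) + Re (cmoment Q Q))"
proof -
  obtain n :: nat and c u where u: "\<forall>p<n. u p \<in> H\<^sub>1" and Pr: "P = (\<lambda>x. \<Sum>p<n. c p * cis (u p x))"
    using trig_polys_representation[OF P] by blast
  obtain m :: nat and d v where v: "\<forall>p<m. v p \<in> H\<^sub>2" and Qr: "Q = (\<lambda>x. \<Sum>p<m. d p * cis (v p x))"
    using trig_polys_representation[OF Q] by blast
  define w where "w i = (if i < n then u i else v (i - n))" for i
  define s where "s i \<longleftrightarrow> i < n" for i
  define g where "g i j = ip (w i) (w j)" for i j
  have wH: "w i \<in> H" if "i < n + m" for i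
    using u v sub that by (auto simp: w_def)
  have [simp]: "w (n + q) = v q" "\<And>q. s (n + q) = False" for q by (auto simp: w_def s_def)
  have [simp]: "w p = u p" "s p" if "p < n" for p using that by (auto simp: w_def s_def)
  have split: "(\<Sum>i<n + m. \<Sum>j<n + m. F i j) = (\<Sum>i<n. \<Sum>j<n. F i j) + (\<Sum>i<n. \<Sum>j<m. F i (n + j))
      + (\<Sum>i<m. \<Sum>j<n. F (n + i) j) + (\<Sum>i<m. \<Sum>j<m. F (n + i) (n + j))"
    for F :: "nat \<Rightarrow> nat \<Rightarrow> 'c::comm_monoid_add"
    unfolding sum_lessThan_add sum.distrib by (simp add: add.assoc add.left_commute)
  have psd: "psd_on {..<n + m} (\<lambda>i j. if s i = s j then g i j else g i j / \<rho>)"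
  proof (rule psd_onI)
    fix a
    define U where "U = (\<lambda>x. \<Sum>p<n. a p * u p x)"
    define V where "V = (\<lambda>x. \<Sum>p<m. a (n + p) * v p x)"
    have UH: "U \<in> H\<^sub>1" unfolding U_def using u by (intro rv_subspace_sum sub) auto
    have VH: "V \<in> H\<^sub>2" unfolding V_def using v by (intro rv_subspace_sum sub) auto
    have "(\<Sum>i<n + m. \<Sum>j<n + m. a i * a j * (if s i = s j then g i j else g i j / \<rho>)) =
        ip U U + ip U V / \<rho> + ip V U / \<rho> + ip V V"
      unfolding U_def V_def split sum_divide_distrib
      using u v sub by (subst (1 2 3 4) ip_sum) (auto simp: g_def sum_divide_distrib)
    also have "ip V U = ip U V" by (simp add: mult.commute)
    finally have eq: "(\<Sum>i<n + m. \<Sum>j<n + m. a i * a j * (if s i = s j then g i j else g i j / \<rho>)) =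
        ip U U + ip V V + 2 * ip U V / \<rho>" by simp
    have "- (2 * ip U V / \<rho>) \<le> ip U U + ip V V"
      using corr[OF UH VH] \<rho> by (simp add: field_simps)
    then show "0 \<le> (\<Sum>i<n + m. \<Sum>j<n + m. a i * a j * (if s i = s j then g i j else g i j / \<rho>))"
      unfolding eq by linarith
  qed (auto simp: g_def mult.commute)
  define B where "B i j = (if s i = s j then exp (g i j) - 1 else (exp (g i j) - 1) / \<rho>)" for i j
  have psdB: "psd_on {..<n + m} B"
    unfolding B_def by (rule psd_on_exp_minus_one[OF _ \<rho> psd]) simp
  \<comment> \<open>The sign on the \<open>Q\<close> part makes the cross terms enter as
    \<open>- C P Q\<close>, so that positivity becomes an upper bound.\<close>
  define z where "z i = (if i < n then c i * of_real (exp (- ip (u i) (u i) / 2))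
      else - (d (i - n) * of_real (exp (- ip (v (i - n)) (v (i - n)) / 2))))" for i
  define C where "C P Q = (cmoment P Q) - (\<integral>x. P x \<partial>M) * cnj (\<integral>x. Q x \<partial>M)" for P Q
  have PP: "C P P = (\<Sum>i<n. \<Sum>j<n. z i * cnj (z j) * of_real (B i j))"
    unfolding C_def by (subst covariance_representation[OF _ _ _ _ Pr Pr])
      (use u sub in \<open>auto simp: z_def B_def g_def\<close>)
  have QQ: "C Q Q = (\<Sum>i<m. \<Sum>j<m. z (n + i) * cnj (z (n + j)) * of_real (B (n + i) (n + j)))"
    unfolding C_def by (subst covariance_representation[OF _ _ _ _ Qr Qr])
      (use v sub in \<open>auto simp: z_def B_def g_def\<close>)
  have PQ: "- C P Q / of_real \<rho> = (\<Sum>i<n. \<Sum>j<m. z i * cnj (z (n + j)) * of_real (B i (n + j)))"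
    unfolding C_def by (subst covariance_representation[OF _ _ _ _ Pr Qr])
      (use u v sub in \<open>auto simp: z_def B_def g_def sum_divide_distrib sum_negf[symmetric]\<close>)
  have QP: "- C Q P / of_real \<rho> = (\<Sum>i<m. \<Sum>j<n. z (n + i) * cnj (z j) * of_real (B (n + i) j))"
    unfolding C_def by (subst covariance_representation[OF _ _ _ _ Qr Pr])
      (use u v sub in \<open>auto simp: z_def B_def g_def sum_divide_distrib sum_negf[symmetric]\<close>)
  have "(cmoment Q P) = (\<integral>x. cnj (P x * cnj (Q x)) \<partial>M)"
    by (simp add: mult.commute)
  then have "C Q P = cnj (C P Q)"
    unfolding C_def Bochner_Integration.integral_cnj by (simp add: mult.commute)
  then have sym: "Re (C Q P) = Re (C P Q)" by simp
  have "0 \<le> Re (C P P - C P Q / of_real \<rho> - C Q P / of_real \<rho> + C Q Q)"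
    using psd_on_complex[OF psdB, of z] unfolding split PP[symmetric] QQ[symmetric] PQ[symmetric] QP[symmetric]
    by simp
  then have "2 * Re (C P Q) / \<rho> \<le> Re (C P P) + Re (C Q Q)"
    by (simp add: sym)
  then have "Re (C P Q) \<le> \<rho> / 2 * (Re (C P P) + Re (C Q Q))"
    using \<rho> by (simp add: field_simps)
  \<comment> \<open>Variances are enlarged to second moments by dropping the squared means.\<close>
  also have "\<dots> \<le> \<rho> / 2 * (Re (cmoment P P) + Re (cmoment Q Q))"
    using \<rho> unfolding C_def complex_mult_cnj by (intro mult_left_mono add_mono) (auto simp: sum_power2_ge_zero)
  finally show ?thesis unfolding C_def .
qed

section \<open>Bounded limits of trigonometric polynomials in mean square\<close>

definition approximable :: "('a \<Rightarrow> real) set \<Rightarrow> ('a \<Rightarrow> complex) \<Rightarrow> bool" where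
  "approximable K U \<longleftrightarrow> U \<in> borel_measurable M \<and> (\<exists>B. \<forall>x. cmod (U x) \<le> B) \<and>
     (\<forall>e>0. \<exists>P\<in>trig_polys K. sqdist U P < e)"

lemma integrable_bounded_norm_square:
  assumes [measurable]: "U \<in> borel_measurable M" and B: "\<And>x. cmod (U x) \<le> B"
  shows "integrable M (\<lambda>x. (cmod (U x))\<^sup>2)"
proof (rule integrable_const_bound)
  show "AE x in M. norm ((cmod (U x))\<^sup>2) \<le> B\<^sup>2" using B by (auto intro!: power_mono)
qed simp

lemma integrable_bounded_complex:
  assumes [measurable]: "U \<in> borel_measurable M" and B: "\<And>x. cmod (U x) \<le> B"
  shows "integrable M U"
  using B by (intro integrable_const_bound[where B = B]) auto

lemma approximableE:
  assumes "approximable K U" "K \<subseteq> H"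
  obtains B where "U \<in> borel_measurable M" "\<And>x. cmod (U x) \<le> B" "B > 0"
    "\<And>e. e > 0 \<Longrightarrow> \<exists>P\<in>trig_polys K. sqdist U P < e"
proof -
  obtain B where B: "\<And>x. cmod (U x) \<le> B" using assms(1) unfolding approximable_def by blast
  then have "\<And>x. cmod (U x) \<le> max B 1" by (simp add: le_max_iff_disj)
  with that[of "max B 1"] assms(1) show ?thesis unfolding approximable_def by auto
qed

lemma trig_polys_diff_square_integrable:
  assumes "U \<in> borel_measurable M" "\<And>x. cmod (U x) \<le> B" "P \<in> trig_polys K" "K \<subseteq> H"
  shows "integrable M (\<lambda>x. (cmod (U x - P x))\<^sup>2)"
proof -
  obtain C where C: "\<And>x. cmod (P x) \<le> C" using trig_polys_bounded[OF assms(3)] by blast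
  have [measurable]: "P \<in> borel_measurable M"
    using assms trig_polys_mono trig_polys_measurable by blast
  have "cmod (U x - P x) \<le> B + C" for x
    using norm_triangle_ineq4[of "U x" "P x"] assms(2)[of x] C[of x] by linarith
  then show ?thesis using assms(1) by (intro integrable_bounded_norm_square) auto
qed

lemma approximable_trig_polys:
  assumes "P \<in> trig_polys K" "K \<subseteq> H"
  shows "approximable K P"
  unfolding approximable_def
proof (intro conjI allI impI)
  show "P \<in> borel_measurable M"
    using assms trig_polys_mono trig_polys_measurable by blast
  show "\<exists>B. \<forall>x. cmod (P x) \<le> B" by (rule trig_polys_bounded[OF assms(1)])
  show "\<exists>Q\<in>trig_polys K. sqdist P Q < e" if "e > 0" for e
    using assms that by (intro bexI[of _ P]) auto
qed

lemma approximable_add: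
  assumes K: "K \<subseteq> H" and U: "approximable K U" and V: "approximable K V"
  shows "approximable K (\<lambda>x. U x + V x)"
proof -
  obtain B where U: "U \<in> borel_measurable M" "\<And>x. cmod (U x) \<le> B"
    "\<And>e. e > 0 \<Longrightarrow> \<exists>P\<in>trig_polys K. sqdist U P < e"
    by (rule approximableE[OF U K]) blast
  obtain C where V: "V \<in> borel_measurable M" "\<And>x. cmod (V x) \<le> C"
    "\<And>e. e > 0 \<Longrightarrow> \<exists>P\<in>trig_polys K. sqdist V P < e"
    by (rule approximableE[OF V K]) blast
  have "cmod (U x + V x) \<le> B + C" for x
    using norm_triangle_ineq[of "U x" "V x"] U(2)[of x] V(2)[of x] by linarith
  moreover have "\<exists>P\<in>trig_polys K. (\<integral>x. (cmod (U x + V x - P x))\<^sup>2 \<partial>M) < e" if e: "e > 0" for e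
  proof -
    obtain P where P: "P \<in> trig_polys K" "sqdist U P < e / 4"
      using U(3)[of "e / 4"] e by (meson divide_pos_pos zero_less_numeral)
    obtain Q where Q: "Q \<in> trig_polys K" "sqdist V Q < e / 4"
      using V(3)[of "e / 4"] e by (meson divide_pos_pos zero_less_numeral)
    have PQ: "(\<lambda>x. P x + Q x) \<in> trig_polys K" using P Q by (intro trig_polys.add)
    have pt: "(cmod (U x + V x - (P x + Q x)))\<^sup>2 \<le> 2 * (cmod (U x - P x))\<^sup>2 + 2 * (cmod (V x - Q x))\<^sup>2" for x
      using norm_add_square_le[of "U x - P x" "V x - Q x"] by (simp add: algebra_simps)
    have iU: "integrable M (\<lambda>x. (cmod (U x - P x))\<^sup>2)"
      using U P K by (intro trig_polys_diff_square_integrable) auto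
    have iV: "integrable M (\<lambda>x. (cmod (V x - Q x))\<^sup>2)"
      using V Q K by (intro trig_polys_diff_square_integrable) auto
    have "(\<integral>x. (cmod (U x + V x - (P x + Q x)))\<^sup>2 \<partial>M) \<le>
        (\<integral>x. 2 * (cmod (U x - P x))\<^sup>2 + 2 * (cmod (V x - Q x))\<^sup>2 \<partial>M)"
      using U V \<open>\<And>x. cmod (U x + V x) \<le> B + C\<close> PQ K iU iV pt
      by (intro integral_mono trig_polys_diff_square_integrable) auto
    also have "\<dots> = 2 * sqdist U P + 2 * sqdist V Q"
      using iU iV by simp
    also have "\<dots> < e" using P Q by linarith
    finally show ?thesis using PQ by (intro bexI[of _ "\<lambda>x. P x + Q x"])
  qed
  ultimately show ?thesis
    unfolding approximable_def using U V by auto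
qed

text \<open>Uses \<open>U V - P Q = V (U - P) + P (V - Q)\<close>, which is why boundedness belongs
  to the notion. The accuracy of \<open>Q\<close> is fixed only after \<open>P\<close>, because the
  supremum of \<open>P\<close> is not controlled by that of \<open>U\<close>.\<close>

lemma approximable_mult:
  assumes K: "rv_subspace K" "K \<subseteq> H" and U: "approximable K U" and V: "approximable K V"
  shows "approximable K (\<lambda>x. U x * V x)"
proof -
  obtain B where U: "U \<in> borel_measurable M" "\<And>x. cmod (U x) \<le> B"
    "\<And>e. e > 0 \<Longrightarrow> \<exists>P\<in>trig_polys K. sqdist U P < e"
    by (rule approximableE[OF U K(2)]) blast
  obtain C where V: "V \<in> borel_measurable M" "\<And>x. cmod (V x) \<le> C" "C > 0"
    "\<And>e. e > 0 \<Longrightarrow> \<exists>P\<in>trig_polys K. sqdist V P < e"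
    by (rule approximableE[OF V K(2)]) blast
  have bd: "cmod (U x * V x) \<le> B * C" for x
    unfolding norm_mult using U(2)[of x] V(2)[of x]
    by (intro mult_mono) (auto intro: order_trans[OF norm_ge_zero])
  have "\<exists>P\<in>trig_polys K. (\<integral>x. (cmod (U x * V x - P x))\<^sup>2 \<partial>M) < e" if e: "e > 0" for e
  proof -
    have "e / (4 * C\<^sup>2) > 0" using e V(3) by simp
    from U(3)[OF this] obtain P
      where P: "P \<in> trig_polys K" "sqdist U P < e / (4 * C\<^sup>2)" by blast
    obtain A' where A': "\<And>x. cmod (P x) \<le> A'" using trig_polys_bounded[OF P(1)] by blast
    define A where "A = max A' 1"
    have A: "A > 0" "\<And>x. cmod (P x) \<le> A" using A' by (auto simp: A_def le_max_iff_disj)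
    have "e / (4 * A\<^sup>2) > 0" using e A by simp
    from V(4)[OF this] obtain Q
      where Q: "Q \<in> trig_polys K" "sqdist V Q < e / (4 * A\<^sup>2)" by blast
    have PQ: "(\<lambda>x. P x * Q x) \<in> trig_polys K" using P Q K by (intro trig_polys_mult)
    have pt: "(cmod (U x * V x - P x * Q x))\<^sup>2 \<le>
        2 * C\<^sup>2 * (cmod (U x - P x))\<^sup>2 + 2 * A\<^sup>2 * (cmod (V x - Q x))\<^sup>2" for x
    proof -
      have "(cmod (U x * V x - P x * Q x))\<^sup>2 \<le>
          2 * ((cmod (V x))\<^sup>2 * (cmod (U x - P x))\<^sup>2) + 2 * ((cmod (P x))\<^sup>2 * (cmod (V x - Q x))\<^sup>2)"
        using norm_add_square_le[of "V x * (U x - P x)" "P x * (V x - Q x)"]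
        unfolding norm_mult power_mult_distrib by (simp add: algebra_simps)
      also have "\<dots> \<le> 2 * (C\<^sup>2 * (cmod (U x - P x))\<^sup>2) + 2 * (A\<^sup>2 * (cmod (V x - Q x))\<^sup>2)"
        using V(2)[of x] A(2)[of x] by (intro add_mono mult_left_mono mult_right_mono power_mono) auto
      finally show ?thesis by simp
    qed
    have iU: "integrable M (\<lambda>x. (cmod (U x - P x))\<^sup>2)"
      using U P K by (intro trig_polys_diff_square_integrable) auto
    have iV: "integrable M (\<lambda>x. (cmod (V x - Q x))\<^sup>2)"
      using V Q K by (intro trig_polys_diff_square_integrable) auto
    have "(\<integral>x. (cmod (U x * V x - P x * Q x))\<^sup>2 \<partial>M) \<le>
        (\<integral>x. 2 * C\<^sup>2 * (cmod (U x - P x))\<^sup>2 + 2 * A\<^sup>2 * (cmod (V x - Q x))\<^sup>2 \<partial>M)"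
      using U V bd PQ K iU iV pt by (intro integral_mono trig_polys_diff_square_integrable) auto
    also have "\<dots> = 2 * C\<^sup>2 * sqdist U P + 2 * A\<^sup>2 * sqdist V Q"
      using iU iV by simp
    also have "\<dots> < e"
    proof -
      have "2 * C\<^sup>2 * sqdist U P < e / 2"
        using P(2) V(3) by (simp add: field_simps)
      moreover have "2 * A\<^sup>2 * sqdist V Q < e / 2"
        using Q(2) A(1) by (simp add: field_simps)
      ultimately show ?thesis by linarith
    qed
    finally show ?thesis using PQ by (intro bexI[of _ "\<lambda>x. P x * Q x"])
  qed
  then show ?thesis
    unfolding approximable_def using U V bd by auto
qed

text \<open>Under a common bound, dominated convergence upgrades pointwise to mean square
  convergence, so an approximant of a late \<open>U k\<close> also serves for the limit.\<close>

lemma approximable_limit: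
  assumes K: "K \<subseteq> H" and U: "\<And>k::nat. approximable K (U k)"
    and B: "\<And>k x. cmod (U k x) \<le> B" and lim: "\<And>x. (\<lambda>k. U k x) \<longlonglongrightarrow> V x"
  shows "approximable K V"
proof -
  have [measurable]: "U k \<in> borel_measurable M" for k
    using U unfolding approximable_def by blast
  have [measurable]: "V \<in> borel_measurable M"
    by (rule borel_measurable_LIMSEQ_metric[OF _ lim]) simp
  have VB: "cmod (V x) \<le> B" for x
    using Lim_bounded[OF tendsto_norm[OF lim[of x]], of 0 B] B by simp
  have "(\<lambda>k. sqdist V (U k)) \<longlonglongrightarrow> (\<integral>x. 0 \<partial>M)"
  proof (rule integral_dominated_convergence[where w = "\<lambda>_. (2 * B)\<^sup>2"])
    have "cmod (V x - U k x) \<le> 2 * B" for k x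
      using norm_triangle_ineq4[of "V x" "U k x"] B[of k x] VB[of x] by linarith
    then have "norm ((cmod (V x - U k x))\<^sup>2) \<le> (2 * B)\<^sup>2" for k x
      unfolding real_norm_def abs_power2 by (intro power_mono) auto
    then show "AE x in M. norm ((cmod (V x - U k x))\<^sup>2) \<le> (2 * B)\<^sup>2" for k by blast
    have "(\<lambda>k. (cmod (V x - U k x))\<^sup>2) \<longlonglongrightarrow> (cmod (V x - V x))\<^sup>2" for x
      by (intro tendsto_intros lim)
    then show "AE x in M. (\<lambda>k. (cmod (V x - U k x))\<^sup>2) \<longlonglongrightarrow> 0" by simp
  qed auto
  then have lim0: "(\<lambda>k. sqdist V (U k)) \<longlonglongrightarrow> 0" by simp
  have "\<exists>P\<in>trig_polys K. sqdist V P < e" if e: "e > 0" for e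
  proof -
    obtain k where k: "sqdist V (U k) < e / 4"
      using order_tendstoD(2)[OF lim0, of "e / 4"] e unfolding eventually_sequentially by auto
    obtain P where P: "P \<in> trig_polys K" "sqdist (U k) P < e / 4"
      using U[of k] e unfolding approximable_def by (meson divide_pos_pos zero_less_numeral)
    have pt: "(cmod (V x - P x))\<^sup>2 \<le> 2 * (cmod (V x - U k x))\<^sup>2 + 2 * (cmod (U k x - P x))\<^sup>2" for x
      using norm_add_square_le[of "V x - U k x" "U k x - P x"] by simp
    have i1: "integrable M (\<lambda>x. (cmod (V x - U k x))\<^sup>2)"
    proof (rule integrable_bounded_norm_square)
      show "cmod (V x - U k x) \<le> 2 * B" for x
        using norm_triangle_ineq4[of "V x" "U k x"] B[of k x] VB[of x] by linarith
    qed simp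
    have i2: "integrable M (\<lambda>x. (cmod (U k x - P x))\<^sup>2)"
      using P K B by (intro trig_polys_diff_square_integrable) auto
    have i3: "integrable M (\<lambda>x. (cmod (V x - P x))\<^sup>2)"
      using P K VB by (intro trig_polys_diff_square_integrable) auto
    have "sqdist V P \<le>
        (\<integral>x. 2 * (cmod (V x - U k x))\<^sup>2 + 2 * (cmod (U k x - P x))\<^sup>2 \<partial>M)"
      using i1 i2 i3 pt by (intro integral_mono) auto
    also have "\<dots> = 2 * sqdist V (U k) + 2 * sqdist (U k) P"
      using i1 i2 by simp
    also have "\<dots> < e" using k P by linarith
    finally show ?thesis using P by blast
  qed
  then show ?thesis unfolding approximable_def using VB by auto
qed

lemma approximable_const: "rv_subspace K \<Longrightarrow> K \<subseteq> H \<Longrightarrow> approximable K (\<lambda>_. c)"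
  by (intro approximable_trig_polys trig_polys_const)

text \<open>Euler's formula. The shift \<open>t\<close> goes into the coefficients, since
  \<open>c * u - t\<close> itself need not lie in \<open>K\<close>.\<close>

lemma approximable_sin:
  assumes K: "rv_subspace K" "K \<subseteq> H" and u: "u \<in> K"
  shows "approximable K (\<lambda>x. of_real (sin (c * u x - t)))"
proof -
  have "(\<lambda>x. cis (- t) / (2 * \<i>) * cis (c * u x) + - (cis t / (2 * \<i>)) * cis (- c * u x)) \<in> trig_polys K"
    by (intro trig_polys.intros rv_subspaceD(3)[OF K(1)] u)
  moreover have "cis (- t) / (2 * \<i>) * cis (c * u x) + - (cis t / (2 * \<i>)) * cis (- c * u x) =
      of_real (sin (c * u x - t))" for x
  proof -
    have cis_diff: "(cis x - cis (- x)) / (2 * \<i>) = of_real (sin x)" for x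
      by (simp add: complex_eq_iff Re_divide Im_divide)
    have e: "cis (c * u x - t) = cis (- t) * cis (c * u x)" "cis (- (c * u x - t)) = cis t * cis (- c * u x)"
      by (simp_all add: cis_mult)
    have "cis (- t) / (2 * \<i>) * cis (c * u x) + - (cis t / (2 * \<i>)) * cis (- c * u x) =
        (cis (c * u x - t) - cis (- (c * u x - t))) / (2 * \<i>)"
      unfolding e by (simp add: right_diff_distrib diff_divide_distrib mult.assoc)
    also have "\<dots> = of_real (sin (c * u x - t))"
      by (rule cis_diff)
    finally show ?thesis .
  qed
  ultimately show ?thesis using K approximable_trig_polys by simp
qed

lemma approximable_polynomial:
  assumes K: "rv_subspace K" "K \<subseteq> H" and S: "approximable K (\<lambda>x. of_real (S x))"
    and p: "real_polynomial_function p"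
  shows "approximable K (\<lambda>x. of_real (p (S x :: real)))"
  using p
proof (induction p rule: real_polynomial_function.induct)
  case (linear h)
  then have "h x = x * h 1" for x
    using linear_cmul[of h x 1] bounded_linear.linear by fastforce
  then have "of_real (h (S x)) = complex_of_real (S x) * of_real (h 1)" for x
    by (metis of_real_mult)
  then show ?case
    using approximable_mult[OF K S approximable_const[OF K, of "of_real (h 1)"]] by simp
next
  case (const c)
  then show ?case using approximable_const[OF K] by simp
next
  case (add f g)
  then show ?case using approximable_add[OF K(2) add.IH] by simp
next
  case (mult f g)
  then show ?case using approximable_mult[OF K mult.IH] by simp
qed

text \<open>Weierstrass on the range of the sine: polynomials uniformly close to \<open>g\<close> on
  \<open>{-1..1}\<close> inherit a common bound there, as \<open>approximable_limit\<close>
  demands.\<close>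

lemma approximable_continuous:
  assumes K: "rv_subspace K" "K \<subseteq> H" and S: "approximable K (\<lambda>x. of_real (S x))"
    and S1: "\<And>x. \<bar>S x\<bar> \<le> 1" and g: "continuous_on {-1..1::real} g"
  shows "approximable K (\<lambda>x. of_real (g (S x) :: real))"
proof -
  have "\<exists>p. real_polynomial_function p \<and> (\<forall>x\<in>{-1..1::real}. \<bar>g x - p x\<bar> < 1 / Suc k)" for k
  proof -
    have "0 < 1 / real (Suc k)" by simp
    then show ?thesis
      by (rule Stone_Weierstrass_real_polynomial_function[OF compact_Icc g]) blast
  qed
  then obtain p where p: "\<And>k. real_polynomial_function (p k)"
    "\<And>k x. x \<in> {-1..1::real} \<Longrightarrow> \<bar>g x - p k x\<bar> < 1 / Suc k" by metis
  have "bounded (g ` {-1..1})"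
    using g by (intro compact_imp_bounded compact_continuous_image) auto
  then obtain C where C: "\<And>x. x \<in> {-1..1} \<Longrightarrow> \<bar>g x\<bar> \<le> C"
    unfolding bounded_iff real_norm_def by blast
  have Sin: "S x \<in> {-1..1}" for x using S1[of x] by (simp add: abs_le_iff)
  show ?thesis
  proof (rule approximable_limit[OF K(2)])
    show "approximable K (\<lambda>x. of_real (p k (S x)))" for k
      by (rule approximable_polynomial[OF K S p(1)])
    show "cmod (of_real (p k (S x))) \<le> C + 1" for k x
    proof -
      have "1 / real (Suc k) \<le> 1" by simp
      then show ?thesis using p(2)[OF Sin, of x k] C[OF Sin, of x]
        unfolding norm_of_real by linarith
    qed
    have "(\<lambda>k. p k (S x)) \<longlonglongrightarrow> g (S x)" for x
    proof (rule LIM_zero_cancel, rule Lim_null_comparison)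
      show "\<forall>\<^sub>F k in sequentially. norm (p k (S x) - g (S x)) \<le> 1 / real (Suc k)"
        using p(2)[OF Sin, of x] by (intro always_eventually allI) (simp add: abs_minus_commute less_imp_le del: of_nat_Suc)
      show "(\<lambda>k. 1 / real (Suc k)) \<longlonglongrightarrow> 0" by (rule LIMSEQ_inverse_real_of_nat[unfolded inverse_eq_divide])
    qed
    then show "(\<lambda>k. complex_of_real (p k (S x))) \<longlonglongrightarrow> of_real (g (S x))" for x
      by (intro tendsto_of_real)
  qed
qed

section \<open>Events with approximable indicators\<close>

abbreviation approximable_set :: "('a \<Rightarrow> real) set \<Rightarrow> 'a set \<Rightarrow> bool" where
  "approximable_set K A \<equiv> approximable K (\<lambda>x. of_real (indicator A x))"

lemma approximable_set_greater:
  assumes K: "rv_subspace K" "K \<subseteq> H" and u: "u \<in> K"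
  shows "approximable_set K {x. t < u x}"
proof (rule approximable_limit[OF K(2)])
  define g where "g n y = min 1 (max 0 ((real (Suc n))\<^sup>2 * y))" for n :: nat and y :: real
  show "approximable K (\<lambda>x. of_real (g n (sin (1 / real (Suc n) * u x - t / real (Suc n)))))" for n
    by (rule approximable_continuous[OF K approximable_sin[OF K u]])
      (auto simp: g_def[abs_def] abs_sin_le_one intro!: continuous_intros)
  show "cmod (of_real (g n (sin (1 / real (Suc n) * u x - t / real (Suc n))))) \<le> 1" for n x
    by (simp add: g_def)
  have "(\<lambda>n. g n (sin ((u x - t) / real (Suc n)))) \<longlonglongrightarrow> indicator {x. t < u x} x" for x
    unfolding g_def using tendsto_clamped_sin[of "u x - t"]
    by (cases "t < u x") simp_all
  then show "(\<lambda>n. complex_of_real (g n (sin (1 / real (Suc n) * u x - t / real (Suc n)))))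
      \<longlonglongrightarrow> of_real (indicator {x. t < u x} x)" for x
    by (intro tendsto_of_real) (simp add: diff_divide_distrib)
qed

lemma approximable_set_Int:
  assumes "rv_subspace K" "K \<subseteq> H" "approximable_set K A" "approximable_set K B"
  shows "approximable_set K (A \<inter> B)"
  using approximable_mult[OF assms] by (simp add: indicator_inter_arith)

lemma approximable_set_Compl:
  assumes K: "rv_subspace K" "K \<subseteq> H" and A: "approximable_set K A"
  shows "approximable_set K (- A)"
proof -
  have "approximable K (\<lambda>x. 1 + (-1) * of_real (indicator A x))"
    by (intro approximable_add approximable_mult approximable_const K A)
  moreover have "1 + (-1) * of_real (indicator A x) = complex_of_real (indicator (- A) x)" for x
    by (simp add: indicator_def)
  ultimately show ?thesis by simp
qed

text \<open>The approximant is the constant 1; it differs from the indicator only outside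
  \<open>space M\<close>, where no integral sees it.\<close>

lemma approximable_set_space:
  assumes K: "rv_subspace K" "K \<subseteq> H"
  shows "approximable_set K (space M)"
  unfolding approximable_def
proof (intro conjI allI impI)
  show "(\<lambda>x. complex_of_real (indicator (space M) x)) \<in> borel_measurable M" by measurable
  show "\<exists>B. \<forall>x. cmod (complex_of_real (indicator (space M) x)) \<le> B"
    by (intro exI[of _ 1]) (simp add: indicator_def)
  fix e :: real assume "e > 0"
  have "(\<integral>x. (cmod (of_real (indicator (space M) x) - 1))\<^sup>2 \<partial>M) = (\<integral>x. 0 \<partial>M)"
    by (intro Bochner_Integration.integral_cong) auto
  then show "\<exists>P\<in>trig_polys K. (\<integral>x. (cmod (of_real (indicator (space M) x) - P x))\<^sup>2 \<partial>M) < e"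
    using \<open>e > 0\<close> by (intro bexI[of _ "\<lambda>_. 1"] trig_polys_const K) simp
qed

lemma approximable_set_UN:
  assumes K: "rv_subspace K" "K \<subseteq> H" and A: "\<And>i::nat. approximable_set K (A i)"
  shows "approximable_set K (\<Union>i. A i)"
proof (rule approximable_limit[OF K(2)])
  have "approximable_set K (- (\<Union>i<n. A i))" for n
  proof (induction n)
    case 0
    then show ?case using approximable_const[OF K, of 1] by simp
  next
    case (Suc n)
    have "- (\<Union>i<Suc n. A i) = - (\<Union>i<n. A i) \<inter> - A n" by (auto simp: less_Suc_eq)
    then show ?case
      using approximable_set_Int[OF K Suc approximable_set_Compl[OF K A[of n]]] by simp
  qed
  from approximable_set_Compl[OF K this] show "approximable_set K (\<Union>i<n. A i)" for n by simp
  show "cmod (complex_of_real (indicator (\<Union>i<n. A i) x)) \<le> 1" for n x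
    by (simp add: indicator_def)
  show "(\<lambda>n. complex_of_real (indicator (\<Union>i<n. A i) x)) \<longlonglongrightarrow> of_real (indicator (\<Union>i. A i) x)" for x
    by (intro tendsto_of_real LIMSEQ_indicator_UN)
qed

text \<open>Stands in for the \<sigma>-algebra generated by \<open>K\<close>: the approximable
  events already form a \<sigma>-algebra, and it makes all members of \<open>K\<close> measurable.
  Hence every event determined by \<open>K\<close> is approximable.\<close>

definition approximable_algebra :: "('a \<Rightarrow> real) set \<Rightarrow> 'a measure" where
  "approximable_algebra K = sigma (space M) {A \<in> sets M. approximable_set K A}"

lemma space_approximable_algebra [simp]: "space (approximable_algebra K) = space M"
  unfolding approximable_algebra_def by (simp add: space_measure_of_conv)

lemma sets_approximable_algebra:
  assumes K: "rv_subspace K" "K \<subseteq> H"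
  shows "sets (approximable_algebra K) = {A \<in> sets M. approximable_set K A}"
proof -
  have "sigma_algebra (space M) {A \<in> sets M. approximable_set K A}"
    unfolding sigma_algebra_iff2
  proof (intro conjI ballI allI impI)
    show "{A \<in> sets M. approximable_set K A} \<subseteq> Pow (space M)" using sets.sets_into_space by auto
    show "{} \<in> {A \<in> sets M. approximable_set K A}" using approximable_const[OF K, of 0] by simp
    fix A assume "A \<in> {A \<in> sets M. approximable_set K A}"
    then show "space M - A \<in> {A \<in> sets M. approximable_set K A}"
      using approximable_set_Int[OF K approximable_set_space[OF K] approximable_set_Compl[OF K, of A]]
      by (simp add: Diff_eq sets.compl_sets[unfolded Diff_eq])
  next
    fix A :: "nat \<Rightarrow> 'a set" assume "range A \<subseteq> {A \<in> sets M. approximable_set K A}"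
    then show "(\<Union>i. A i) \<in> {A \<in> sets M. approximable_set K A}"
      using approximable_set_UN[OF K, of A] by auto
  qed
  then show ?thesis
    unfolding approximable_algebra_def by (simp add: sigma_algebra.sets_measure_of_eq)
qed

lemma measurable_approximable_algebra:
  assumes K: "rv_subspace K" "K \<subseteq> H" and u: "u \<in> K"
  shows "u \<in> borel_measurable (approximable_algebra K)"
  unfolding borel_measurable_iff_greater
proof (intro allI)
  fix t
  have [measurable]: "u \<in> borel_measurable M" using u K rv_measurable by blast
  have "approximable_set K (space M \<inter> {x. t < u x})"
    by (intro approximable_set_Int approximable_set_space approximable_set_greater K u)
  moreover have "space M \<inter> {x. t < u x} = {x\<in>space M. t < u x}" by auto
  moreover have "{x\<in>space M. t < u x} \<in> sets M" by measurable
  ultimately show "{w \<in> space (approximable_algebra K). t < u w} \<in> sets (approximable_algebra K)"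
    by (simp add: sets_approximable_algebra[OF K])
qed

section \<open>From trigonometric polynomials to events\<close>

lemma approximating_sequence:
  assumes "approximable K U"
  shows "\<exists>P. (\<forall>k. P k \<in> trig_polys K) \<and> (\<lambda>k. sqdist U (P k)) \<longlonglongrightarrow> 0"
proof -
  have "\<exists>P\<in>trig_polys K. sqdist U P < 1 / Suc k" for k :: nat
    using assms unfolding approximable_def by simp
  then obtain P where P: "\<And>k. P k \<in> trig_polys K"
    "\<And>k::nat. sqdist U (P k) < 1 / Suc k" by metis
  have "(\<lambda>k. sqdist U (P k)) \<longlonglongrightarrow> 0"
  proof (rule Lim_null_comparison)
    show "\<forall>\<^sub>F k in sequentially. norm (sqdist U (P k)) \<le> 1 / real (Suc k)"
      using P(2) by (intro always_eventually allI) (simp add: less_imp_le del: of_nat_Suc)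
    show "(\<lambda>k. 1 / real (Suc k)) \<longlonglongrightarrow> 0" by (rule LIMSEQ_inverse_real_of_nat[unfolded inverse_eq_divide])
  qed
  with P(1) show ?thesis by blast
qed

lemma tendsto_expectation_mult:
  assumes K: "K \<subseteq> H" "L \<subseteq> H" and P: "\<And>k::nat. P k \<in> trig_polys K" and Q: "\<And>k. Q k \<in> trig_polys L"
    and U: "U \<in> borel_measurable M" "\<And>x. cmod (U x) \<le> B"
    and V: "V \<in> borel_measurable M" "\<And>x. cmod (V x) \<le> C"
    and PU: "(\<lambda>k. sqdist U (P k)) \<longlonglongrightarrow> 0"
    and QV: "(\<lambda>k. sqdist V (Q k)) \<longlonglongrightarrow> 0"
  shows "(\<lambda>k. cmoment (P k) (Q k)) \<longlonglongrightarrow> (cmoment U V)"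
proof (rule LIM_zero_cancel, rule Lim_null_comparison)
  note [measurable] = U(1) V(1)
  have [measurable]: "P k \<in> borel_measurable M" "Q k \<in> borel_measurable M" for k
    using P Q K trig_polys_mono trig_polys_measurable by blast+
  define a b where "a k x = cmod (U x - P k x)" and "b k x = cmod (V x - Q k x)" for k x
  define u v where "u x = cmod (U x)" and "v x = cmod (V x)" for x
  have [measurable]: "a k \<in> borel_measurable M" "b k \<in> borel_measurable M"
    "u \<in> borel_measurable M" "v \<in> borel_measurable M" for k
    unfolding a_def[abs_def] b_def[abs_def] u_def[abs_def] v_def[abs_def] by measurable
  have ia: "integrable M (\<lambda>x. (a k x)\<^sup>2)" "integrable M (\<lambda>x. (b k x)\<^sup>2)" for k
    unfolding a_def b_def
    by (rule trig_polys_diff_square_integrable[OF U P K(1)] trig_polys_diff_square_integrable[OF V Q K(2)])+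
  have iu: "integrable M (\<lambda>x. (u x)\<^sup>2)" "integrable M (\<lambda>x. (v x)\<^sup>2)"
    unfolding u_def v_def
    by (rule integrable_bounded_norm_square[OF U] integrable_bounded_norm_square[OF V])+
  have CS: "integrable M (\<lambda>x. p x * q x) \<and> (\<integral>x. p x * q x \<partial>M) \<le> sqrt (\<integral>x. (p x)\<^sup>2 \<partial>M) * sqrt (\<integral>x. (q x)\<^sup>2 \<partial>M)"
    if [measurable]: "p \<in> borel_measurable M" "q \<in> borel_measurable M"
      and "integrable M (\<lambda>x. (p x)\<^sup>2)" "integrable M (\<lambda>x. (q x)\<^sup>2)" for p q :: "'a \<Rightarrow> real"
  proof -
    note * = Cauchy_Schwarz_integral[OF that]
    have "(\<integral>x. p x * q x \<partial>M) \<le> (\<integral>x. \<bar>p x * q x\<bar> \<partial>M)"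
      using *(1) by (intro integral_mono) auto
    also have "\<dots> \<le> sqrt ((\<integral>x. (p x)\<^sup>2 \<partial>M) * (\<integral>x. (q x)\<^sup>2 \<partial>M))"
      by (rule real_le_rsqrt[OF *(2)])
    finally show ?thesis using *(1) by (simp add: real_sqrt_mult)
  qed
  have ab: "integrable M (\<lambda>x. a k x * b k x)" "integrable M (\<lambda>x. a k x * v x)" "integrable M (\<lambda>x. u x * b k x)" for k
    using CS ia iu by auto
  have iPQ: "integrable M (\<lambda>x. P k x * cnj (Q k x))" for k
    using P Q K trig_polys_mono by (intro trig_polys_integrable_mult) blast+
  have iUV: "integrable M (\<lambda>x. U x * cnj (V x))"
  proof (rule integrable_bounded_complex)
    show "cmod (U x * cnj (V x)) \<le> B * C" for x
      unfolding norm_mult complex_mod_cnj using U(2)[of x] V(2)[of x]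
      by (intro mult_mono) (auto intro: order_trans[OF norm_ge_zero])
  qed measurable
  have norm3: "cmod (x - y - z) \<le> cmod x + cmod y + cmod z" for x y z
    using norm_triangle_ineq4[of "x - y" z] norm_triangle_ineq4[of x y] by linarith
  have pt: "cmod (P k x * cnj (Q k x) - U x * cnj (V x)) \<le> a k x * b k x + a k x * v x + u x * b k x" for k x
  proof -
    \<comment> \<open>Expanded around the limits, each product consists of error factors and fixed
      bounded functions; no bound on \<open>P k\<close> or \<open>Q k\<close> uniform in
      \<open>k\<close> is available.\<close>
    have eq: "P k x * cnj (Q k x) - U x * cnj (V x) =
        (U x - P k x) * cnj (V x - Q k x) - (U x - P k x) * cnj (V x) - U x * cnj (V x - Q k x)"
      by (simp add: algebra_simps)
    have "cmod (P k x * cnj (Q k x) - U x * cnj (V x)) \<le> cmod ((U x - P k x) * cnj (V x - Q k x)) + cmod ((U x - P k x) * cnj (V x))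
        + cmod (U x * cnj (V x - Q k x))"
      unfolding eq by (rule norm3)
    also have "\<dots> = a k x * b k x + a k x * v x + u x * b k x"
      unfolding norm_mult complex_mod_cnj a_def b_def u_def v_def by (rule refl)
    finally show ?thesis .
  qed
  define \<alpha> \<beta> where "\<alpha> k = sqrt (\<integral>x. (a k x)\<^sup>2 \<partial>M)" and "\<beta> k = sqrt (\<integral>x. (b k x)\<^sup>2 \<partial>M)" for k
  define \<mu> \<nu> where "\<mu> = sqrt (\<integral>x. (u x)\<^sup>2 \<partial>M)" and "\<nu> = sqrt (\<integral>x. (v x)\<^sup>2 \<partial>M)"
  have "norm ((cmoment (P k) (Q k)) - (cmoment U V)) \<le> \<alpha> k * \<beta> k + \<alpha> k * \<nu> + \<mu> * \<beta> k" for k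
  proof -
    have "norm ((cmoment (P k) (Q k)) - (cmoment U V)) =
        norm (\<integral>x. P k x * cnj (Q k x) - U x * cnj (V x) \<partial>M)"
      using iPQ iUV by simp
    also have "\<dots> \<le> (\<integral>x. norm (P k x * cnj (Q k x) - U x * cnj (V x)) \<partial>M)" by (rule integral_norm_bound)
    also have "\<dots> \<le> (\<integral>x. a k x * b k x + a k x * v x + u x * b k x \<partial>M)"
      using iPQ[of k] iUV ab pt by (intro integral_mono) auto
    also have "\<dots> = (\<integral>x. a k x * b k x \<partial>M) + (\<integral>x. a k x * v x \<partial>M) + (\<integral>x. u x * b k x \<partial>M)"
      using ab by simp
    also have "\<dots> \<le> \<alpha> k * \<beta> k + \<alpha> k * \<nu> + \<mu> * \<beta> k"
      unfolding \<alpha>_def \<beta>_def \<mu>_def \<nu>_def using CS ia iu by (intro add_mono) auto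
    finally show ?thesis .
  qed
  then show "\<forall>\<^sub>F k in sequentially. norm ((cmoment (P k) (Q k)) - (cmoment U V))
      \<le> \<alpha> k * \<beta> k + \<alpha> k * \<nu> + \<mu> * \<beta> k" by (intro always_eventually allI)
  have "\<alpha> \<longlonglongrightarrow> sqrt 0" "\<beta> \<longlonglongrightarrow> sqrt 0"
    unfolding \<alpha>_def[abs_def] \<beta>_def[abs_def] a_def b_def by (intro tendsto_real_sqrt PU QV)+
  then have "(\<lambda>k. \<alpha> k * \<beta> k + \<alpha> k * \<nu> + \<mu> * \<beta> k) \<longlonglongrightarrow> sqrt 0 * sqrt 0 + sqrt 0 * \<nu> + \<mu> * sqrt 0"
    by (intro tendsto_intros)
  then show "(\<lambda>k. \<alpha> k * \<beta> k + \<alpha> k * \<nu> + \<mu> * \<beta> k) \<longlonglongrightarrow> 0" by simp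
qed

text \<open>A form of the Kolmogorov--Rozanov theorem: for Gaussian spaces the maximal correlation is
  already attained by linear functions.\<close>

theorem approximable_algebra_mixing:
  assumes K: "rv_subspace K" "K \<subseteq> H" and L: "rv_subspace L" "L \<subseteq> H" and \<rho>: "0 < \<rho>" "\<rho> \<le> 1"
    and corr: "\<And>u v. u \<in> K \<Longrightarrow> v \<in> L \<Longrightarrow> \<bar>ip u v\<bar> \<le> \<rho> / 2 * (ip u u + ip v v)"
    and A: "A \<in> sets (approximable_algebra K)" and B: "B \<in> sets (approximable_algebra L)"
  shows "prob (A \<inter> B) - prob A * prob B \<le> \<rho>"
proof -
  define U V where "U = (\<lambda>x. complex_of_real (indicator A x))" and "V = (\<lambda>x. complex_of_real (indicator B x))"
  have sets [measurable]: "A \<in> sets M" "B \<in> sets M" and "approximable K U" "approximable L V"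
    using A B sets_approximable_algebra[OF K] sets_approximable_algebra[OF L] by (auto simp: U_def V_def)
  from approximating_sequence[OF this(3)] approximating_sequence[OF this(4)] obtain P Q
    where P: "\<And>k::nat. P k \<in> trig_polys K" "(\<lambda>k. sqdist U (P k)) \<longlonglongrightarrow> 0"
      and Q: "\<And>k::nat. Q k \<in> trig_polys L" "(\<lambda>k. sqdist V (Q k)) \<longlonglongrightarrow> 0" by auto
  have U: "U \<in> borel_measurable M" "\<And>x. cmod (U x) \<le> 1" "V \<in> borel_measurable M" "\<And>x. cmod (V x) \<le> 1"
    by (auto simp: U_def V_def indicator_def)
  note lim = tendsto_expectation_mult[where B = 1 and C = 1]
  \<comment> \<open>The constant 1 is a trigonometric polynomial, so convergence of the means is the
    case of a mixed moment with 1.\<close>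
  have one: "(\<lambda>_. 1) \<in> trig_polys K" "(\<lambda>_. 1) \<in> trig_polys L" using K L trig_polys_const by blast+
  have "(\<lambda>k. \<integral>x. P k x * cnj 1 \<partial>M) \<longlonglongrightarrow> (\<integral>x. U x * cnj 1 \<partial>M)"
    by (rule lim[OF K(2) K(2) P(1) one(1) U(1,2) _ _ P(2)]) auto
  then have lim1: "(\<lambda>k. \<integral>x. P k x \<partial>M) \<longlonglongrightarrow> (\<integral>x. U x \<partial>M)" by simp
  have "(\<lambda>k. \<integral>x. Q k x * cnj 1 \<partial>M) \<longlonglongrightarrow> (\<integral>x. V x * cnj 1 \<partial>M)"
    by (rule lim[OF L(2) L(2) Q(1) one(2) U(3,4) _ _ Q(2)]) auto
  then have lim2: "(\<lambda>k. \<integral>x. Q k x \<partial>M) \<longlonglongrightarrow> (\<integral>x. V x \<partial>M)" by simp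
  have "Re ((cmoment U V) - (\<integral>x. U x \<partial>M) * cnj (\<integral>x. V x \<partial>M)) \<le>
    \<rho> / 2 * (Re (cmoment U U) + Re (cmoment V V))"
  proof (rule tendsto_le[OF sequentially_bot])
    show "(\<lambda>k. \<rho> / 2 * (Re (cmoment (P k) (P k)) + Re (cmoment (Q k) (Q k)))) \<longlonglongrightarrow>
       \<rho> / 2 * (Re (cmoment U U) + Re (cmoment V V))"
      by (intro tendsto_intros lim[OF K(2) K(2) P(1) P(1) U(1,2) U(1,2) P(2) P(2)]
        lim[OF L(2) L(2) Q(1) Q(1) U(3,4) U(3,4) Q(2) Q(2)])
    show "(\<lambda>k. Re ((cmoment (P k) (Q k)) - (\<integral>x. P k x \<partial>M) * cnj (\<integral>x. Q k x \<partial>M))) \<longlonglongrightarrow>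
       Re ((cmoment U V) - (\<integral>x. U x \<partial>M) * cnj (\<integral>x. V x \<partial>M))"
      by (intro tendsto_intros tendsto_cnj lim1 lim2 lim[OF K(2) L(2) P(1) Q(1) U P(2) Q(2)])
    show "\<forall>\<^sub>F k in sequentially. Re ((cmoment (P k) (Q k)) - (\<integral>x. P k x \<partial>M) * cnj (\<integral>x. Q k x \<partial>M)) \<le>
       \<rho> / 2 * (Re (cmoment (P k) (P k)) + Re (cmoment (Q k) (Q k)))"
      by (intro always_eventually allI trig_polys_covariance_le[OF K(1) L(1) K(2) L(2) \<rho> corr P(1) Q(1)])
  qed
  moreover have "(cmoment U V) = of_real (prob (A \<inter> B))"
    unfolding U_def V_def complex_cnj_complex_of_real of_real_mult[symmetric] indicator_inter_arith[symmetric]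
    by (simp add: integral_complex_of_real)
  moreover have "(cmoment U U) = of_real (prob A)"
    unfolding U_def V_def complex_cnj_complex_of_real of_real_mult[symmetric] indicator_inter_arith[symmetric]
    by (simp add: integral_complex_of_real)
  moreover have "(cmoment V V) = of_real (prob B)"
    unfolding U_def V_def complex_cnj_complex_of_real of_real_mult[symmetric] indicator_inter_arith[symmetric]
    by (simp add: integral_complex_of_real)
  moreover have "(\<integral>x. U x \<partial>M) = of_real (prob A)" "(\<integral>x. V x \<partial>M) = of_real (prob B)"
    unfolding U_def V_def by (simp_all add: integral_complex_of_real)
  ultimately have "prob (A \<inter> B) - prob A * prob B \<le> \<rho> / 2 * (prob A + prob B)" by simp
  also have "\<dots> \<le> \<rho> / 2 * (1 + 1)" using \<rho> by (intro mult_left_mono add_mono) auto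
  finally show ?thesis by simp
qed

end

subsection \<open>Linear forms under a spectral density\<close>

text \<open>Variances are only bounded from below, so the negative frequencies may be discarded:
  their contribution is nonnegative. Positive frequencies avoid absolute values in
  \<open>x powr (D - 1)\<close>, and the open interval leaves out the singularity at 0.\<close>

definition halfcircle :: "real measure" where
  "halfcircle = restrict_space lborel {0<..<pi}"

lemma space_halfcircle [simp]: "space halfcircle = {0<..<pi}"
  by (simp add: halfcircle_def space_restrict_space)

lemma measurable_halfcircle: "g \<in> borel_measurable borel \<Longrightarrow> g \<in> borel_measurable halfcircle"
  unfolding halfcircle_def by (intro measurable_restrict_space1) simp

lemma finite_measure_halfcircle: "finite_measure halfcircle"
  by (intro finite_measureI) (simp add: halfcircle_def space_restrict_space emeasure_restrict_space)

lemma integrable_halfcircle_bounded: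
  fixes g :: "real \<Rightarrow> real"
  assumes "g \<in> borel_measurable borel" "\<And>x. \<bar>g x\<bar> \<le> B"
  shows "integrable halfcircle g"
proof (rule finite_measure.integrable_const_bound[OF finite_measure_halfcircle])
  show "AE x in halfcircle. norm (g x) \<le> B" using assms(2) by (intro AE_I2) simp
  show "g \<in> borel_measurable halfcircle" by (rule measurable_halfcircle[OF assms(1)])
qed

lemma integral_halfcircle: "integral\<^sup>L halfcircle g = (LBINT x=ereal 0..ereal pi. g x)" for g :: "real \<Rightarrow> real"
  by (simp add: halfcircle_def integral_restrict_space interval_lebesgue_integral_def
      set_lebesgue_integral_def)

lemma integral_halfcircle_cos: "(\<integral>x. cos (real k * x) \<partial>halfcircle) = (if k = 0 then pi else 0)"
proof (cases "k = 0")
  case True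
  have "(LBINT x=ereal 0..ereal pi. 1) = pi - (0::real)"
    by (rule interval_integral_FTC_finite[where F = "\<lambda>x. x"]) (auto intro!: derivative_eq_intros continuous_intros)
  then have "(\<integral>x. 1 \<partial>halfcircle) = pi"
    unfolding integral_halfcircle by (simp add:)
  then show ?thesis using True by (simp only: of_nat_0 mult_zero_left cos_zero simp_thms if_True)
next
  case False
  have "(LBINT x=ereal 0..ereal pi. cos (real k * x)) = sin (real k * pi) / real k - sin (real k * 0) / real k"
    by (rule interval_integral_FTC_finite[where F = "\<lambda>x. sin (real k * x) / real k"])
      (use False in \<open>auto intro!: derivative_eq_intros continuous_intros
        simp: has_real_derivative_iff_has_vector_derivative[symmetric]\<close>)
  then show ?thesis using False by (simp add: integral_halfcircle)
qed

lemma halfcircle_powr: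
  assumes "0 < \<eta>"
  shows "integrable halfcircle (\<lambda>x. x powr (\<eta> - 1))"
    and "(\<integral>x. x powr (\<eta> - 1) \<partial>halfcircle) = pi powr \<eta> / \<eta>"
proof -
  have lim: "((\<lambda>x. x powr \<eta> / \<eta>) \<longlongrightarrow> 0 powr \<eta> / \<eta>) (at_right 0)"
    using assms by (intro tendsto_intros tendsto_powr') (auto simp: eventually_at_filter)
  have lim2: "((\<lambda>x. x powr \<eta> / \<eta>) \<longlongrightarrow> pi powr \<eta> / \<eta>) (at_left pi)"
    using assms by (intro tendsto_intros) auto
  note * = interval_integral_FTC_nonneg[where a = "ereal 0" and b = "ereal pi" and A = 0
      and F = "\<lambda>x. x powr \<eta> / \<eta>" and f = "\<lambda>x. x powr (\<eta> - 1)" and B = "pi powr \<eta> / \<eta>"]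
  have A: "(((\<lambda>x. x powr \<eta> / \<eta>) \<circ> real_of_ereal) \<longlongrightarrow> 0) (at_right (ereal 0))"
    unfolding ereal_tendsto_simps1 using lim assms by simp
  have B: "(((\<lambda>x. x powr \<eta> / \<eta>) \<circ> real_of_ereal) \<longlongrightarrow> pi powr \<eta> / \<eta>) (at_left (ereal pi))"
    unfolding ereal_tendsto_simps1 by (rule lim2)
  have "set_integrable lborel (einterval (ereal 0) (ereal pi)) (\<lambda>x. x powr (\<eta> - 1))"
    by (rule *(1)[OF _ _ _ _ A B]) (use assms in \<open>auto intro!: derivative_eq_intros continuous_intros\<close>)
  then show "integrable halfcircle (\<lambda>x. x powr (\<eta> - 1))"
    by (simp add: set_integrable_def halfcircle_def integrable_restrict_space)
  have "(LBINT x=ereal 0..ereal pi. x powr (\<eta> - 1)) = pi powr \<eta> / \<eta> - 0"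
    by (rule *(2)[OF _ _ _ _ A B]) (use assms in \<open>auto intro!: derivative_eq_intros continuous_intros\<close>)
  then show "(\<integral>x. x powr (\<eta> - 1) \<partial>halfcircle) = pi powr \<eta> / \<eta>"
    by (simp add: integral_halfcircle)
qed

section \<open>Trigonometric sums and the Dirichlet kernel\<close>

definition cos_sum :: "(nat \<Rightarrow> real) \<Rightarrow> nat \<Rightarrow> real \<Rightarrow> real" where
  "cos_sum a l x = (\<Sum>p<l. a p * cos (real p * x))"

definition sin_sum :: "(nat \<Rightarrow> real) \<Rightarrow> nat \<Rightarrow> real \<Rightarrow> real" where
  "sin_sum a l x = (\<Sum>p<l. a p * sin (real p * x))"

text \<open>The squared modulus of \<open>\<Sum> a_p exp (\<i> p x)\<close>, kept in real terms; for
  constant coefficients 1 it is the squared modulus of the one-sided Dirichlet kernel.\<close>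

definition power_sum :: "(nat \<Rightarrow> real) \<Rightarrow> nat \<Rightarrow> real \<Rightarrow> real" where
  "power_sum a l x = (cos_sum a l x)\<^sup>2 + (sin_sum a l x)\<^sup>2"

lemma power_sum_measurable [measurable]:
  "cos_sum a l \<in> borel_measurable borel" "sin_sum a l \<in> borel_measurable borel"
  "power_sum a l \<in> borel_measurable borel"
  unfolding cos_sum_def[abs_def] sin_sum_def[abs_def] power_sum_def[abs_def] by measurable

lemma power_sum_nonneg: "0 \<le> power_sum a l x"
  by (simp add: power_sum_def)

text \<open>For natural numbers \<open>p - q + (q - p)\<close> is the distance of \<open>p\<close>
  and \<open>q\<close>, as one of the truncated differences is 0. In this form the addition theorem
  produces the lags of the covariance function.\<close>

lemma cos_sum_mult_sin_sum:
  "cos_sum a l x * cos_sum b l x + sin_sum a l x * sin_sum b l x =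
    (\<Sum>p<l. \<Sum>q<l. a p * b q * cos (real (p - q + (q - p)) * x))"
proof -
  have "cos (real p * x) * cos (real q * x) + sin (real p * x) * sin (real q * x) =
      cos (real (p - q + (q - p)) * x)" for p q
  proof (cases "p \<le> q")
    case True
    then have "cos (real (p - q + (q - p)) * x) = cos (real q * x - real p * x)"
      by (simp add: of_nat_diff left_diff_distrib)
    then show ?thesis by (simp add: cos_diff mult.commute)
  next
    case False
    then have "cos (real (p - q + (q - p)) * x) = cos (real p * x - real q * x)"
      by (simp add: of_nat_diff left_diff_distrib)
    then show ?thesis by (simp add: cos_diff)
  qed
  then have *: "a p * b q * cos (real (p - q + (q - p)) * x) =
     (a p * cos (real p * x)) * (b q * cos (real q * x)) + (a p * sin (real p * x)) * (b q * sin (real q * x))" for p q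
    by (metis (no_types, opaque_lifting) distrib_left mult.assoc mult.left_commute)
  show ?thesis
    by (simp only: * sum.distrib cos_sum_def sin_sum_def sum_product)
qed

lemma power_sum_eq: "power_sum a l x = (\<Sum>p<l. \<Sum>q<l. a p * a q * cos (real (p - q + (q - p)) * x))"
  using cos_sum_mult_sin_sum[of a l x a] by (simp only: power_sum_def power2_eq_square)

text \<open>Half a period is enough: \<open>cos (k * x)\<close> integrates to 0 over (0, pi) for
  every positive integer \<open>k\<close>, so only the diagonal survives.\<close>

lemma halfcircle_orthogonality:
  "(\<integral>x. cos_sum a l x * cos_sum b l x + sin_sum a l x * sin_sum b l x \<partial>halfcircle) = pi * (\<Sum>p<l. a p * b p)"
proof -
  have int: "integrable halfcircle (\<lambda>x. cos (real k * x))" for k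
    by (rule integrable_halfcircle_bounded[where B = 1]) (auto intro: abs_cos_le_one)
  have "(\<integral>x. cos_sum a l x * cos_sum b l x + sin_sum a l x * sin_sum b l x \<partial>halfcircle) =
      (\<Sum>p<l. \<Sum>q<l. a p * b q * (\<integral>x. cos (real (p - q + (q - p)) * x) \<partial>halfcircle))"
    unfolding cos_sum_mult_sin_sum
    using int by (simp add: Bochner_Integration.integral_sum del: of_nat_add)
  also have "\<dots> = (\<Sum>p<l. \<Sum>q<l. if q = p then a p * b p * pi else 0)"
    unfolding integral_halfcircle_cos by (intro sum.cong refl) auto
  also have "\<dots> = pi * (\<Sum>p<l. a p * b p)"
    by (simp add: sum_distrib_left mult.commute)
  finally show ?thesis .
qed

lemma power_sum_le: "power_sum a l x \<le> (\<Sum>p<l. \<bar>a p\<bar>)\<^sup>2"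
proof -
  have "a p * a q * cos (real (p - q + (q - p)) * x) \<le> \<bar>a p\<bar> * \<bar>a q\<bar>" for p q
  proof -
    have "a p * a q * cos (real (p - q + (q - p)) * x) \<le> \<bar>a p * a q * cos (real (p - q + (q - p)) * x)\<bar>"
      by (rule abs_ge_self)
    also have "\<dots> \<le> \<bar>a p * a q\<bar> * 1"
      unfolding abs_mult[of "a p * a q"] by (intro mult_left_mono abs_cos_le_one) simp
    finally show ?thesis by (simp add: abs_mult)
  qed
  then show ?thesis
    unfolding power_sum_eq power2_eq_square sum_product by (intro sum_mono)
qed

text \<open>Geometric sum: \<open>(1 - cis x) * D = 1 - cis x ^ l\<close>, where the right side has
  modulus at most 2 and \<open>cmod (1 - cis x) = 2 * sin (x / 2)\<close> is at least
  \<open>2 * x / pi\<close>. The bound is uniform in \<open>l\<close>.\<close>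

lemma Dirichlet_power_sum_le:
  assumes "0 < x" "x < pi"
  shows "power_sum (\<lambda>_. 1) l x \<le> (pi / x)\<^sup>2"
proof -
  define D where "D = (\<Sum>p<l. cis x ^ p)"
  have ReIm: "Re D = cos_sum (\<lambda>_. 1) l x" "Im D = sin_sum (\<lambda>_. 1) l x"
    by (simp_all add: D_def cos_sum_def sin_sum_def cos_n_Re_cis_pow_n sin_n_Im_cis_pow_n)
  have D: "power_sum (\<lambda>_. 1) l x = (cmod D)\<^sup>2"
    by (simp add: cmod_power2 power_sum_def ReIm)
  have half: "(cmod (1 - cis x))\<^sup>2 = (2 * sin (x / 2))\<^sup>2"
  proof -
    have "(cmod (1 - cis x))\<^sup>2 = (1 - cos x)\<^sup>2 + (sin x)\<^sup>2" unfolding cmod_power2 by simp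
    also have "\<dots> = 2 - 2 * cos x"
      using sin_cos_squared_add[of x] by (simp add: power2_diff)
    also have "\<dots> = (2 * sin (x / 2))\<^sup>2"
      using cos_double_sin[of "x / 2"] by (simp add: power_mult_distrib)
    finally show ?thesis .
  qed
  have geom: "(1 - cis x) * D = 1 - cis x ^ l" unfolding D_def one_diff_power_eq ..
  have "2 * (x / 2) / pi \<le> sin (x / 2)" using assms by (intro Jordan_sin_ge) auto
  then have "(2 * x / pi)\<^sup>2 \<le> (2 * sin (x / 2))\<^sup>2"
    using assms by (intro power_mono) auto
  then have "(2 * x / pi)\<^sup>2 * (cmod D)\<^sup>2 \<le> (cmod (1 - cis x))\<^sup>2 * (cmod D)\<^sup>2"
    unfolding half by (intro mult_right_mono) auto
  also have "\<dots> = (cmod (1 - cis x ^ l))\<^sup>2"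
    unfolding geom[symmetric] by (simp add: norm_mult power_mult_distrib)
  also have "\<dots> \<le> 2\<^sup>2"
    using norm_triangle_ineq4[of 1 "cis x ^ l"] by (intro power_mono) (auto simp: norm_power)
  finally have "(cmod D)\<^sup>2 \<le> (pi / x)\<^sup>2"
    using assms by (simp add: power_divide power_mult_distrib divide_le_eq le_divide_eq mult.commute)
  then show ?thesis using D by simp
qed

text \<open>Interpolating between the two bounds \<open>l\<^sup>2\<close> and \<open>(pi / x)\<^sup>2\<close> with exponent \<open>D + \<eta>\<close> makes the
  weighted square of the Dirichlet kernel integrable at \<open>0\<close>.\<close>

lemma Dirichlet_weighted_integral:
  assumes D: "0 < D" "D \<le> 1" and \<eta>: "0 < \<eta>" "\<eta> \<le> 1" and l: "1 \<le> l"
  shows "integrable halfcircle (\<lambda>x. power_sum (\<lambda>_. 1) l x * x powr (1 - D))"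
    and "(\<integral>x. power_sum (\<lambda>_. 1) l x * x powr (1 - D) \<partial>halfcircle) \<le> pi\<^sup>2 / \<eta> * real l powr (D + \<eta>)"
proof -
  \<comment> \<open>The share \<open>s / 2\<close> of the exponent goes to the bound
    \<open>(pi / x)\<^sup>2\<close> and the rest to \<open>l\<^sup>2\<close>, which becomes
    \<open>l powr (D + \<eta>)\<close>. Then \<open>- s + (1 - D) = \<eta> - 1\<close> is just
    integrable at 0.\<close>
  define s where "s = 2 - D - \<eta>"
  have s: "0 \<le> s" "s \<le> 2" using D \<eta> by (auto simp: s_def)
  have bound: "power_sum (\<lambda>_. 1) l x * x powr (1 - D) \<le> real l powr (D + \<eta>) * pi powr s * x powr (\<eta> - 1)"
    if x: "0 < x" "x < pi" for x
  proof (cases "power_sum (\<lambda>_. 1) l x = 0")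
    case True
    then show ?thesis using x by simp
  next
    case False
    define P where "P = power_sum (\<lambda>_. 1) l x"
    have sq: "(y\<^sup>2) powr (t / 2) = y powr t" if "0 < y" for y t :: real
      using that by (simp add: powr_powr flip: powr_numeral)
    have P: "0 < P" using False power_sum_nonneg[of "\<lambda>_. 1" l x] by (simp add: P_def)
    have P1: "P powr ((2 - s) / 2) \<le> real l powr (D + \<eta>)"
    proof -
      have "P powr ((2 - s) / 2) \<le> ((real l)\<^sup>2) powr ((2 - s) / 2)"
        using s P power_sum_le[of "\<lambda>_. 1" l x] by (intro powr_mono2) (auto simp: P_def)
      then show ?thesis using sq[of "real l" "2 - s"] l by (simp add: s_def)
    qed
    have P2: "P powr (s / 2) \<le> pi powr s * x powr (- s)"
    proof -
      have "P powr (s / 2) \<le> ((pi / x)\<^sup>2) powr (s / 2)"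
        using s P Dirichlet_power_sum_le[OF x, of l] by (intro powr_mono2) (auto simp: P_def)
      also have "((pi / x)\<^sup>2) powr (s / 2) = (pi / x) powr s" using x by (intro sq) simp
      also have "\<dots> = pi powr s / x powr s" by (rule powr_divide)
      finally show ?thesis by (simp only: powr_minus divide_inverse)
    qed
    have P3: "P = P powr ((2 - s) / 2) * P powr (s / 2)"
      using P by (simp add: powr_add[symmetric] diff_divide_distrib)
    have "P \<le> real l powr (D + \<eta>) * (pi powr s * x powr (- s))"
      by (subst P3) (intro mult_mono P1 P2, auto)
    then have "P * x powr (1 - D) \<le> real l powr (D + \<eta>) * (pi powr s * x powr (- s)) * x powr (1 - D)"
      by (rule mult_right_mono) simp
    also have "\<dots> = real l powr (D + \<eta>) * pi powr s * (x powr (- s) * x powr (1 - D))"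
      by (simp only: mult.assoc)
    also have "x powr (- s) * x powr (1 - D) = x powr (\<eta> - 1)"
      unfolding powr_add[symmetric] by (simp add: s_def)
    finally show ?thesis by (simp add: P_def)
  qed
  have intb: "integrable halfcircle (\<lambda>x. real l powr (D + \<eta>) * pi powr s * x powr (\<eta> - 1))"
    by (intro integrable_mult_right halfcircle_powr \<eta>)
  show int: "integrable halfcircle (\<lambda>x. power_sum (\<lambda>_. 1) l x * x powr (1 - D))"
  proof (rule Bochner_Integration.integrable_bound[OF intb])
    show "AE x in halfcircle. norm (power_sum (\<lambda>_. 1) l x * x powr (1 - D)) \<le>
        norm (real l powr (D + \<eta>) * pi powr s * x powr (\<eta> - 1))"
      using bound by (intro AE_I2) (simp add: abs_mult power_sum_nonneg)
  qed (rule measurable_halfcircle, measurable)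
  have "(\<integral>x. power_sum (\<lambda>_. 1) l x * x powr (1 - D) \<partial>halfcircle) \<le>
      (\<integral>x. real l powr (D + \<eta>) * pi powr s * x powr (\<eta> - 1) \<partial>halfcircle)"
    by (rule integral_mono[OF int intb]) (simp add: bound)
  also have "\<dots> = real l powr (D + \<eta>) * pi powr s * (pi powr \<eta> / \<eta>)"
    using halfcircle_powr[OF \<eta>(1)] by simp
  also have "\<dots> = real l powr (D + \<eta>) * pi powr (2 - D) / \<eta>"
    by (simp add: s_def powr_add[symmetric])
  also have "\<dots> \<le> real l powr (D + \<eta>) * pi powr 2 / \<eta>"
    using D \<eta> pi_ge_two by (intro divide_right_mono mult_left_mono powr_mono) auto
  finally show "(\<integral>x. power_sum (\<lambda>_. 1) l x * x powr (1 - D) \<partial>halfcircle) \<le> pi\<^sup>2 / \<eta> * real l powr (D + \<eta>)"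
    by (simp add: mult.commute)
qed

text \<open>By orthogonality \<open>pi * (\<Sum>p<l. a p)\<close> is the pairing with the Dirichlet
  kernel. The weight is split as \<open>x powr (D - 1)\<close> for \<open>a\<close> against
  \<open>x powr (1 - D)\<close> for the kernel, and Cauchy-Schwarz is applied.\<close>

lemma sum_square_le_weighted_integral:
  assumes D: "0 < D" "D \<le> 1" and \<eta>: "0 < \<eta>" "\<eta> \<le> 1" and l: "1 \<le> l"
    and int: "integrable halfcircle (\<lambda>x. power_sum a l x * x powr (D - 1))"
  shows "(\<Sum>p<l. a p)\<^sup>2 \<le> real l powr (D + \<eta>) / \<eta> * (\<integral>x. power_sum a l x * x powr (D - 1) \<partial>halfcircle)"
proof -
  define f where "f x = sqrt (power_sum a l x * x powr (D - 1))" for x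
  define g where "g x = sqrt (power_sum (\<lambda>_. 1) l x * x powr (1 - D))" for x
  have [measurable]: "f \<in> borel_measurable borel" "g \<in> borel_measurable borel"
    unfolding f_def[abs_def] g_def[abs_def] by measurable
  note fg_meas = measurable_halfcircle[OF this(1)] measurable_halfcircle[OF this(2)]
  have f2: "(f x)\<^sup>2 = power_sum a l x * x powr (D - 1)" and g2: "(g x)\<^sup>2 = power_sum (\<lambda>_. 1) l x * x powr (1 - D)" for x
    by (simp_all add: f_def g_def power_sum_nonneg)
  note dir = Dirichlet_weighted_integral[OF D \<eta> l]
  have if2: "integrable halfcircle (\<lambda>x. (f x)\<^sup>2)" unfolding f2 by (rule int)
  have ig2: "integrable halfcircle (\<lambda>x. (g x)\<^sup>2)" unfolding g2 by (rule dir(1))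
  have fg: "integrable halfcircle (\<lambda>x. f x * g x)"
    by (rule Cauchy_Schwarz_integral(1)[OF fg_meas if2 ig2])
  have CS: "(\<integral>x. \<bar>f x * g x\<bar> \<partial>halfcircle)\<^sup>2 \<le> (\<integral>x. (f x)\<^sup>2 \<partial>halfcircle) * (\<integral>x. (g x)\<^sup>2 \<partial>halfcircle)"
    by (rule Cauchy_Schwarz_integral(2)[OF fg_meas if2 ig2])
  define h where "h x = cos_sum a l x * cos_sum (\<lambda>_. 1) l x + sin_sum a l x * sin_sum (\<lambda>_. 1) l x" for x
  have h_meas: "h \<in> borel_measurable halfcircle"
    unfolding h_def[abs_def] by (rule measurable_halfcircle) measurable
  have pt: "\<bar>h x\<bar> \<le> \<bar>f x * g x\<bar>" if x: "0 < x" "x < pi" for x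
  proof -
    have "(h x)\<^sup>2 \<le> power_sum a l x * power_sum (\<lambda>_. 1) l x"
    proof -
      \<comment> \<open>Lagrange's identity for two vectors in the plane.\<close>
      have "power_sum a l x * power_sum (\<lambda>_. 1) l x - (h x)\<^sup>2 =
          (cos_sum a l x * sin_sum (\<lambda>_. 1) l x - sin_sum a l x * cos_sum (\<lambda>_. 1) l x)\<^sup>2"
        unfolding power_sum_def h_def by (simp add: power2_eq_square algebra_simps)
      then show ?thesis by (metis diff_ge_0_iff_ge zero_le_power2)
    qed
    also have "\<dots> = power_sum a l x * x powr (D - 1) * (power_sum (\<lambda>_. 1) l x * x powr (1 - D))"
    proof -
      have "x powr (D - 1) * x powr (1 - D) = 1" using x by (simp add: powr_add[symmetric])
      moreover have "A * p * (B * q) = A * B * (p * q)" for A B p q :: real by (simp only: mult_ac)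
      ultimately show ?thesis by simp
    qed
    also have "\<dots> = (f x * g x)\<^sup>2" by (simp only: power_mult_distrib f2 g2)
    finally show ?thesis by (simp add: abs_le_square_iff)
  qed
  have ih: "integrable halfcircle h"
  proof (rule Bochner_Integration.integrable_bound[OF fg])
    show "AE x in halfcircle. norm (h x) \<le> norm (f x * g x)"
      unfolding real_norm_def by (intro AE_I2 pt) auto
  qed (rule h_meas)
  have "pi * \<bar>\<Sum>p<l. a p\<bar> = \<bar>\<integral>x. h x \<partial>halfcircle\<bar>"
    unfolding h_def halfcircle_orthogonality by (simp add: abs_mult)
  also have "\<dots> \<le> (\<integral>x. \<bar>h x\<bar> \<partial>halfcircle)" by (rule integral_abs_bound)
  also have "\<dots> \<le> (\<integral>x. \<bar>f x * g x\<bar> \<partial>halfcircle)"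
    by (rule integral_mono[OF integrable_abs[OF ih] integrable_abs[OF fg]]) (simp add: pt del: abs_mult)
  finally have "(pi * \<bar>\<Sum>p<l. a p\<bar>)\<^sup>2 \<le> (\<integral>x. \<bar>f x * g x\<bar> \<partial>halfcircle)\<^sup>2"
    by (intro power_mono) auto
  also have "\<dots> \<le> (\<integral>x. (f x)\<^sup>2 \<partial>halfcircle) * (pi\<^sup>2 / \<eta> * real l powr (D + \<eta>))"
    by (rule order_trans[OF CS], rule mult_left_mono) (simp_all only: g2 dir(2), simp)
  finally have "pi\<^sup>2 * (\<Sum>p<l. a p)\<^sup>2 \<le> pi\<^sup>2 * (real l powr (D + \<eta>) / \<eta> * (\<integral>x. (f x)\<^sup>2 \<partial>halfcircle))"
    by (simp add: power_mult_distrib algebra_simps)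
  then show ?thesis unfolding f2 using pi_gt_zero by (simp only: mult_le_cancel_left_pos zero_less_power)
qed

section \<open>Variance and covariance of linear forms in terms of \<open>\<gamma>\<close>\<close>

definition toeplitz_form :: "(nat \<Rightarrow> real) \<Rightarrow> (nat \<Rightarrow> real) \<Rightarrow> nat \<Rightarrow> real" where
  "toeplitz_form \<gamma> a l = (\<Sum>p<l. \<Sum>q<l. a p * a q * \<gamma> (p - q + (q - p)))"

text \<open>The covariance of linear forms in two windows of length \<open>l\<close> at offset
  \<open>k\<close>. The truncated \<open>k + q - p\<close> is the true lag as soon as
  \<open>l \<le> k\<close>.\<close>

definition cross_form :: "(nat \<Rightarrow> real) \<Rightarrow> nat \<Rightarrow> (nat \<Rightarrow> real) \<Rightarrow> (nat \<Rightarrow> real) \<Rightarrow> nat \<Rightarrow> real" where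
  "cross_form \<gamma> k a b l = (\<Sum>p<l. \<Sum>q<l. a p * b q * \<gamma> (k + q - p))"

text \<open>The form equals the integral of \<open>power_sum a l\<close> against \<open>f\<close>,
  so a lower bound on \<open>f\<close> bounds it from below by the weighted integral. Orthogonality
  then yields the first claim and duality with the Dirichlet kernel the second.\<close>

lemma spectral_density_variance_bounds:
  assumes sd: "spectral_density \<gamma> f" and c: "0 < c" and D: "0 < D" "D \<le> 1"
    and lower: "\<And>x. 0 < x \<Longrightarrow> x < pi \<Longrightarrow> c * x powr (D - 1) \<le> f x"
  shows "(\<Sum>p<l. (a p)\<^sup>2) \<le> 1 / c * toeplitz_form \<gamma> a l"
    and "0 < \<eta> \<Longrightarrow> \<eta> \<le> 1 \<Longrightarrow> 1 \<le> l \<Longrightarrow> (\<Sum>p<l. a p)\<^sup>2 \<le> real l powr (D + \<eta>) / (\<eta> * c) * toeplitz_form \<gamma> a l"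
proof -
  have fint: "set_integrable lborel {-pi..pi} f" and fnn: "\<And>x. x \<in> {-pi..pi} \<Longrightarrow> 0 \<le> f x"
    and \<gamma>: "\<And>k. complex_of_real (\<gamma> k) = (CLBINT x:{-pi..pi}. exp (\<i> * of_nat k * of_real x) * of_real (f x))"
    using sd unfolding spectral_density_def by auto
  \<comment> \<open>The density is prescribed on \<open>{-pi..pi}\<close> only; its extension by 0
    is integrable and nonnegative on the whole line.\<close>
  define F where "F x = indicator {-pi..pi} x * f x" for x
  have F: "integrable lborel F" using fint unfolding set_integrable_def F_def[abs_def] by simp
  have [measurable]: "F \<in> borel_measurable borel" using borel_measurable_integrable[OF F] by simp
  have Fnn: "0 \<le> F x" for x using fnn[of x] by (simp add: F_def indicator_def)
  have intF: "integrable lborel (\<lambda>x. h x * F x)" if [measurable]: "h \<in> borel_measurable borel" and B: "\<And>x. \<bar>h x\<bar> \<le> B" for h :: "real \<Rightarrow> real" and B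
  proof (rule Bochner_Integration.integrable_bound[OF integrable_mult_right[OF F, of B]])
    show "AE x in lborel. norm (h x * F x) \<le> norm (B * F x)"
      using B by (intro AE_I2) (auto simp: abs_mult intro!: mult_right_mono order_trans[OF B abs_ge_self])
  qed measurable
  have \<gamma>eq: "\<gamma> k = (\<integral>x. cos (real k * x) * F x \<partial>lborel)" for k
  proof -
    have i: "integrable lborel (\<lambda>x. exp (\<i> * of_nat k * of_real x) * complex_of_real (F x))"
    proof (rule Bochner_Integration.integrable_bound[OF F])
      have "cmod (exp (\<i> * of_nat k * of_real x)) = 1" for x :: real
        by (simp add: norm_exp_eq_Re)
      then show "AE x in lborel. norm (exp (\<i> * of_nat k * of_real x) * complex_of_real (F x)) \<le> norm (F x)"
        by (simp add: norm_mult)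
    qed measurable
    have "complex_of_real (\<gamma> k) = (CLINT x|lborel. exp (\<i> * of_nat k * of_real x) * of_real (F x))"
      unfolding \<gamma> set_lebesgue_integral_def F_def
      by (intro Bochner_Integration.integral_cong) (auto simp: indicator_def)
    then have "\<gamma> k = Re (CLINT x|lborel. exp (\<i> * of_nat k * of_real x) * of_real (F x))"
      by (metis Re_complex_of_real)
    also have "\<dots> = (\<integral>x. Re (exp (\<i> * of_nat k * of_real x) * of_real (F x)) \<partial>lborel)"
      by (rule integral_bounded_linear[OF bounded_linear_Re i, symmetric])
    also have "\<dots> = (\<integral>x. cos (real k * x) * F x \<partial>lborel)"
      by (simp add: Re_exp)
    finally show ?thesis .
  qed
  have icos: "integrable lborel (\<lambda>x. cos (real k * x) * F x)" for k
    by (rule intF[where B = 1]) (auto intro: abs_cos_le_one)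
  have VF: "toeplitz_form \<gamma> a l = (\<integral>x. power_sum a l x * F x \<partial>lborel)" and iV: "integrable lborel (\<lambda>x. power_sum a l x * F x)" for a l
  proof -
    have "(\<integral>x. power_sum a l x * F x \<partial>lborel) =
        (\<integral>x. (\<Sum>p<l. \<Sum>q<l. a p * a q * (cos (real (p - q + (q - p)) * x) * F x)) \<partial>lborel)"
      unfolding power_sum_eq by (simp add: sum_distrib_right mult.assoc)
    also have "\<dots> = (\<Sum>p<l. \<Sum>q<l. a p * a q * \<gamma> (p - q + (q - p)))"
      unfolding \<gamma>eq using icos by (simp add: Bochner_Integration.integral_sum del: of_nat_add)
    finally show "toeplitz_form \<gamma> a l = (\<integral>x. power_sum a l x * F x \<partial>lborel)" by (simp add: toeplitz_form_def)
    show "integrable lborel (\<lambda>x. power_sum a l x * F x)"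
      by (rule intF[where B = "(\<Sum>p<l. \<bar>a p\<bar>)\<^sup>2"]) (auto simp: power_sum_nonneg power_sum_le)
  qed
  have lowerF: "c * x powr (D - 1) \<le> F x" if "0 < x" "x < pi" for x
    using lower[OF that] that by (simp add: F_def indicator_def)
  have iVh: "integrable halfcircle (\<lambda>x. power_sum a l x * F x)" for a l
    unfolding halfcircle_def
    by (subst integrable_restrict_space) (use integrable_mult_indicator[OF _ iV, of "{0<..<pi}"] in auto)
  have Vle: "(\<integral>x. power_sum a l x * F x \<partial>halfcircle) \<le> toeplitz_form \<gamma> a l" for a l
  proof -
    have "(\<integral>x. power_sum a l x * F x \<partial>halfcircle) = (\<integral>x. indicator {0<..<pi} x *\<^sub>R (power_sum a l x * F x) \<partial>lborel)"
      unfolding halfcircle_def by (subst integral_restrict_space) auto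
    also have "\<dots> \<le> (\<integral>x. power_sum a l x * F x \<partial>lborel)"
      using integrable_mult_indicator[OF _ iV[of a l], of "{0<..<pi}"] iV[of a l]
      by (intro integral_mono) (auto simp: indicator_def power_sum_nonneg Fnn)
    finally show ?thesis by (simp add: VF)
  qed
  have iw: "integrable halfcircle (\<lambda>x. power_sum a l x * x powr (D - 1))" for a l
  proof (rule Bochner_Integration.integrable_bound[OF integrable_mult_right[OF iVh, of "1 / c"]])
    show "AE x in halfcircle. norm (power_sum a l x * x powr (D - 1)) \<le> norm (1 / c * (power_sum a l x * F x))"
    proof (intro AE_I2)
      fix x assume "x \<in> space halfcircle"
      then have "x powr (D - 1) \<le> 1 / c * F x" using lowerF[of x] c by (simp add: field_simps)
      then have "power_sum a l x * x powr (D - 1) \<le> power_sum a l x * (1 / c * F x)"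
        by (intro mult_left_mono power_sum_nonneg)
      then show "norm (power_sum a l x * x powr (D - 1)) \<le> norm (1 / c * (power_sum a l x * F x))"
        using c by (simp add: abs_mult power_sum_nonneg Fnn)
    qed
  qed (rule measurable_halfcircle, measurable)
  have wV: "(\<integral>x. power_sum a l x * x powr (D - 1) \<partial>halfcircle) \<le> 1 / c * toeplitz_form \<gamma> a l" for a l
  proof -
    have "c * (\<integral>x. power_sum a l x * x powr (D - 1) \<partial>halfcircle) =
        (\<integral>x. power_sum a l x * (c * x powr (D - 1)) \<partial>halfcircle)"
      by (simp add: mult.left_commute)
    also have "\<dots> \<le> (\<integral>x. power_sum a l x * F x \<partial>halfcircle)"
      using iVh integrable_mult_right[OF iw, of c] lowerF
      by (intro integral_mono mult_left_mono power_sum_nonneg) (auto simp: mult.left_commute)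
    also have "\<dots> \<le> toeplitz_form \<gamma> a l" by (rule Vle)
    finally show ?thesis using c by (simp add: field_simps)
  qed
  show "(\<Sum>p<l. a p)\<^sup>2 \<le> real l powr (D + \<eta>) / (\<eta> * c) * toeplitz_form \<gamma> a l" if "0 < \<eta>" "\<eta> \<le> 1" "1 \<le> l"
  proof -
    have "(\<Sum>p<l. a p)\<^sup>2 \<le> real l powr (D + \<eta>) / \<eta> * (\<integral>x. power_sum a l x * x powr (D - 1) \<partial>halfcircle)"
      by (rule sum_square_le_weighted_integral[OF D that iw])
    also have "\<dots> \<le> real l powr (D + \<eta>) / \<eta> * (1 / c * toeplitz_form \<gamma> a l)"
      using that by (intro mult_left_mono wV) auto
    finally show ?thesis by simp
  qed
  \<comment> \<open>As \<open>D \<le> 1\<close>, the weight is bounded below by its value at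
    \<open>pi\<close>; with this constant weight orthogonality applies, and the factor
    \<open>pi powr D \<ge> 1\<close> is dropped at the end.\<close>
  have "(\<integral>x. power_sum a l x * pi powr (D - 1) \<partial>halfcircle) \<le> (\<integral>x. power_sum a l x * x powr (D - 1) \<partial>halfcircle)"
  proof (rule integral_mono[OF _ iw])
    show "integrable halfcircle (\<lambda>x. power_sum a l x * pi powr (D - 1))"
      by (intro integrable_mult_left integrable_halfcircle_bounded[where B = "(\<Sum>p<l. \<bar>a p\<bar>)\<^sup>2"])
        (auto simp: power_sum_nonneg power_sum_le)
    show "power_sum a l x * pi powr (D - 1) \<le> power_sum a l x * x powr (D - 1)" if "x \<in> space halfcircle" for x
      using that D by (intro mult_left_mono power_sum_nonneg powr_mono2') auto
  qed
  then have "pi powr (D - 1) * (pi * (\<Sum>p<l. (a p)\<^sup>2)) \<le> 1 / c * toeplitz_form \<gamma> a l"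
    using halfcircle_orthogonality[of a l a] wV[of a l]
    by (simp add: power_sum_def power2_eq_square mult.commute)
  moreover have "pi powr (D - 1) * (pi * (\<Sum>p<l. (a p)\<^sup>2)) = pi powr D * (\<Sum>p<l. (a p)\<^sup>2)"
    using powr_add[of pi "D - 1" 1] by simp
  moreover have "1 * (\<Sum>p<l. (a p)\<^sup>2) \<le> pi powr D * (\<Sum>p<l. (a p)\<^sup>2)"
    using D pi_ge_two by (intro mult_right_mono ge_one_powr_ge_zero sum_nonneg) auto
  ultimately show "(\<Sum>p<l. (a p)\<^sup>2) \<le> 1 / c * toeplitz_form \<gamma> a l" by linarith
qed

subsection \<open>Blocks of a stationary Gaussian process\<close>

text \<open>Linear combinations may degenerate, so the point masses are treated separately: being
  centred, they sit at 0 and the formula reads 1 = 1.\<close>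

lemma gaussian_rv_centered:
  assumes "prob_space M" and g: "gaussian_rv M X" and mean: "(\<integral>\<omega>. X \<omega> \<partial>M) = 0"
  shows "integrable M (\<lambda>\<omega>. (X \<omega>)\<^sup>2)"
    and "(\<integral>\<omega>. cis (X \<omega>) \<partial>M) = of_real (exp (- (\<integral>\<omega>. (X \<omega>)\<^sup>2 \<partial>M) / 2))"
proof -
  interpret prob_space M by fact
  have [measurable]: "X \<in> borel_measurable M" using g unfolding gaussian_rv_def by blast
  obtain \<mu> \<sigma> where "(\<sigma> > 0 \<and> distr M borel X = density lborel (normal_density \<mu> \<sigma>)) \<or>
      (\<sigma> = 0 \<and> distr M borel X = return borel \<mu>)"
    using g unfolding gaussian_rv_def by blast
  then have "integrable M (\<lambda>\<omega>. (X \<omega>)\<^sup>2) \<and>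
    (\<integral>\<omega>. cis (X \<omega>) \<partial>M) = of_real (exp (- (\<integral>\<omega>. (X \<omega>)\<^sup>2 \<partial>M) / 2))"
  proof (elim disjE conjE)
    assume \<sigma>: "\<sigma> > 0" and d: "distr M borel X = density lborel (normal_density \<mu> \<sigma>)"
    have "distr M lborel X = distr M borel X" by (intro distr_cong) auto
    then have D: "distributed M lborel X (normal_density \<mu> \<sigma>)"
      using d \<sigma> unfolding distributed_def by auto
    have "\<mu> = 0" using normal_distributed_expectation[OF \<sigma> D] mean by simp
    note D = D[unfolded this]
    have var: "(\<integral>\<omega>. (X \<omega>)\<^sup>2 \<partial>M) = \<sigma>\<^sup>2"
      using normal_distributed_variance[OF \<sigma> D] mean by simp
    have int: "integrable M (\<lambda>\<omega>. (X \<omega>)\<^sup>2)"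
    proof -
      have "integrable lborel (\<lambda>x. normal_density 0 \<sigma> x * (x - 0) ^ 2)"
        by (rule integrable_normal_moment[OF \<sigma>])
      then show ?thesis
        using distributed_integrable[OF D, of "\<lambda>x. x\<^sup>2"] \<sigma> by simp
    qed
    have "distributed M lborel (\<lambda>\<omega>. (X \<omega> - 0) / \<sigma>) std_normal_density"
      using D normal_standard_normal_convert[OF \<sigma>, of X 0] by simp
    then have "distr M lborel (\<lambda>\<omega>. X \<omega> / \<sigma>) = std_normal_distribution"
      unfolding distributed_def by simp
    moreover have "distr M lborel (\<lambda>\<omega>. X \<omega> / \<sigma>) = distr M borel (\<lambda>\<omega>. X \<omega> / \<sigma>)"
      by (intro distr_cong) auto
    \<comment> \<open>After division by \<sigma> the law is standard normal, and \<sigma> reappears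
      as the argument of its characteristic function.\<close>
    ultimately have "char (distr M borel (\<lambda>\<omega>. X \<omega> / \<sigma>)) \<sigma> = exp (- \<sigma>\<^sup>2 / 2)"
      by (simp add: char_std_normal_distribution)
    moreover have "char (distr M borel (\<lambda>\<omega>. X \<omega> / \<sigma>)) \<sigma> = (\<integral>\<omega>. cis (X \<omega>) \<partial>M)"
      unfolding char_def using \<sigma> by (subst integral_distr) (auto simp: cis_conv_exp)
    ultimately show ?thesis using int var by simp
  next
    assume d: "distr M borel X = return borel \<mu>"
    have "AE x in distr M borel X. x = \<mu>" unfolding d by (subst AE_return) auto
    then have ae: "AE \<omega> in M. X \<omega> = \<mu>" by (subst (asm) AE_distr_iff) auto
    have "(\<integral>\<omega>. X \<omega> \<partial>M) = (\<integral>\<omega>. \<mu> \<partial>M)" using ae by (intro integral_cong_AE) auto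
    then have "\<mu> = 0" using mean prob_space by simp
    then have ae: "AE \<omega> in M. X \<omega> = 0" using ae by simp
    have "integrable M (\<lambda>\<omega>. (X \<omega>)\<^sup>2)"
      using ae by (subst integrable_cong_AE[where g = "\<lambda>_. 0"]) auto
    moreover have "(\<integral>\<omega>. (X \<omega>)\<^sup>2 \<partial>M) = (\<integral>\<omega>. 0 \<partial>M)" using ae by (intro integral_cong_AE) auto
    moreover have "(\<integral>\<omega>. cis (X \<omega>) \<partial>M) = (\<integral>\<omega>. 1 \<partial>M)"
    proof (rule integral_cong_AE)
      show "(\<lambda>\<omega>. cis (X \<omega>)) \<in> borel_measurable M" unfolding cis_conv_exp by measurable
      show "AE \<omega> in M. cis (X \<omega>) = 1" using ae by eventually_elim simp
    qed simp
    ultimately show ?thesis using prob_space by simp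
  qed
  then show "integrable M (\<lambda>\<omega>. (X \<omega>)\<^sup>2)"
    "(\<integral>\<omega>. cis (X \<omega>) \<partial>M) = of_real (exp (- (\<integral>\<omega>. (X \<omega>)\<^sup>2 \<partial>M) / 2))" by blast+
qed

section \<open>The Gaussian space spanned by finitely many variables\<close>

definition lincombs :: "(nat \<Rightarrow> 'a \<Rightarrow> real) \<Rightarrow> nat set \<Rightarrow> ('a \<Rightarrow> real) set" where
  "lincombs \<xi> J = range (\<lambda>c \<omega>. \<Sum>j\<in>J. c j * \<xi> j \<omega>)"

lemma lincombsI: "(\<lambda>\<omega>. \<Sum>j\<in>J. c j * \<xi> j \<omega>) \<in> lincombs \<xi> J"
  unfolding lincombs_def by (rule rangeI)

lemma lincombsE:
  assumes "u \<in> lincombs \<xi> J"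
  obtains c where "u = (\<lambda>\<omega>. \<Sum>j\<in>J. c j * \<xi> j \<omega>)"
  using assms unfolding lincombs_def by blast

lemma rv_subspace_lincombs: "rv_subspace (lincombs \<xi> J)"
  unfolding rv_subspace_def
proof (intro conjI ballI allI)
  show "(\<lambda>_. 0) \<in> lincombs \<xi> J" using lincombsI[where J = J and \<xi> = \<xi> and c = "\<lambda>_. 0"] by simp
  fix u assume "u \<in> lincombs \<xi> J"
  then obtain c where u: "u = (\<lambda>\<omega>. \<Sum>j\<in>J. c j * \<xi> j \<omega>)" by (rule lincombsE)
  show "(\<lambda>\<omega>. d * u \<omega>) \<in> lincombs \<xi> J" for d
    using lincombsI[where J = J and \<xi> = \<xi> and c = "\<lambda>j. d * c j"] by (simp add: u sum_distrib_left mult.assoc)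
  fix v assume "v \<in> lincombs \<xi> J"
  then obtain d where v: "v = (\<lambda>\<omega>. \<Sum>j\<in>J. d j * \<xi> j \<omega>)" by (rule lincombsE)
  show "(\<lambda>\<omega>. u \<omega> + v \<omega>) \<in> lincombs \<xi> J"
    using lincombsI[where J = J and \<xi> = \<xi> and c = "\<lambda>j. c j + d j"] by (simp add: u v sum.distrib distrib_right)
qed

lemma lincombs_mono:
  assumes "J \<subseteq> J'" "finite J'"
  shows "lincombs \<xi> J \<subseteq> lincombs \<xi> J'"
proof
  fix u assume "u \<in> lincombs \<xi> J"
  then obtain c where u: "u = (\<lambda>\<omega>. \<Sum>j\<in>J. c j * \<xi> j \<omega>)" by (rule lincombsE)
  have "(\<Sum>j\<in>J. c j * \<xi> j \<omega>) = (\<Sum>j\<in>J'. (if j \<in> J then c j else 0) * \<xi> j \<omega>)" for \<omega>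
    using assms by (intro sum.mono_neutral_cong_left) auto
  then show "u \<in> lincombs \<xi> J'" unfolding u using lincombsI by simp
qed

lemma lincombs_member:
  assumes "finite J" "j \<in> J"
  shows "\<xi> j \<in> lincombs \<xi> J"
proof -
  have "(\<Sum>i\<in>J. (if i = j then 1 else 0) * \<xi> i \<omega>) = \<xi> j \<omega>" for \<omega>
  proof -
    have "(\<Sum>i\<in>J. (if i = j then 1 else 0) * \<xi> i \<omega>) = (\<Sum>i\<in>J. if i = j then \<xi> j \<omega> else 0)"
      by (intro sum.cong) auto
    then show ?thesis using assms by simp
  qed
  then show ?thesis using lincombsI[where J = J and \<xi> = \<xi> and c = "\<lambda>i. if i = j then 1 else 0"] by simp
qed

lemma gaussian_process_sum:
  assumes "gaussian_process M I \<xi>" "finite J" "J \<subseteq> I"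
  shows "gaussian_rv M (\<lambda>\<omega>. \<Sum>j\<in>J. c j * \<xi> j \<omega>)"
  using assms unfolding gaussian_process_def by simp

lemma gaussian_process_member:
  assumes "gaussian_process M I \<xi>" "j \<in> I"
  shows "gaussian_rv M (\<xi> j)"
proof -
  show ?thesis using gaussian_process_sum[OF assms(1), of "{j}" "\<lambda>_. 1"] assms(2) by simp
qed

lemma gaussian_space_lincombs:
  assumes M: "prob_space M" and gp: "gaussian_process M I \<xi>"
    and mean: "\<And>j. j \<in> I \<Longrightarrow> (\<integral>\<omega>. \<xi> j \<omega> \<partial>M) = 0" and J: "finite J" "J \<subseteq> I"
  shows "gaussian_space M (lincombs \<xi> J)"
proof -
  interpret prob_space M by fact
  have int: "integrable M (\<xi> j)" if "j \<in> J" for j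
  proof (rule square_integrable_imp_integrable)
    have g: "gaussian_rv M (\<xi> j)" using gaussian_process_member[OF gp] that J by blast
    then show "\<xi> j \<in> borel_measurable M" unfolding gaussian_rv_def by blast
    show "integrable M (\<lambda>\<omega>. (\<xi> j \<omega>)\<^sup>2)"
      using gaussian_rv_centered(1)[OF M g mean] that J by blast
  qed
  have g: "gaussian_rv M u" "(\<integral>\<omega>. u \<omega> \<partial>M) = 0" if u_in: "u \<in> lincombs \<xi> J" for u
  proof -
    obtain c where u: "u = (\<lambda>\<omega>. \<Sum>j\<in>J. c j * \<xi> j \<omega>)" using u_in by (rule lincombsE)
    show "gaussian_rv M u" unfolding u by (rule gaussian_process_sum[OF gp J])
    have "(\<integral>\<omega>. u \<omega> \<partial>M) = (\<Sum>j\<in>J. c j * (\<integral>\<omega>. \<xi> j \<omega> \<partial>M))"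
      unfolding u using int by (simp add: Bochner_Integration.integral_sum)
    also have "\<dots> = 0" using mean J by (intro sum.neutral) auto
    finally show "(\<integral>\<omega>. u \<omega> \<partial>M) = 0" .
  qed
  show ?thesis
  proof
    show "rv_subspace (lincombs \<xi> J)" by (rule rv_subspace_lincombs)
    fix u assume u: "u \<in> lincombs \<xi> J"
    show "u \<in> borel_measurable M" using g(1)[OF u] unfolding gaussian_rv_def by blast
    show "integrable M (\<lambda>\<omega>. (u \<omega>)\<^sup>2)"
      and "(\<integral>\<omega>. cis (u \<omega>) \<partial>M) = of_real (exp (- (\<integral>\<omega>. (u \<omega>)\<^sup>2 \<partial>M) / 2))"
      using gaussian_rv_centered[OF M g[OF u]] by blast+
  qed
qed

text \<open>A shift by \<open>i - 1\<close> moves the pair to the times \<open>1\<close> and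
  \<open>1 + k\<close>, where the definition of the autocovariance applies; symmetry covers the
  reversed order.\<close>

lemma stationary_product_moment:
  assumes st: "stationary_process M \<xi>" and mean: "\<And>n. 1 \<le> n \<Longrightarrow> (\<integral>\<omega>. \<xi> n \<omega> \<partial>M) = 0"
    and i: "1 \<le> i" and j: "1 \<le> j"
  shows "(\<integral>\<omega>. \<xi> i \<omega> * \<xi> j \<omega> \<partial>M) = autocovariance M \<xi> (i - j + (j - i))"
proof -
  have *: "(\<integral>\<omega>. \<xi> i \<omega> * \<xi> (i + k) \<omega> \<partial>M) = autocovariance M \<xi> k" if "1 \<le> i" for i k
  proof -
    define J where "J = {1, 1 + k}"
    have [measurable]: "\<xi> n \<in> borel_measurable M" if "1 \<le> n" for n
      using st that unfolding stationary_process_def by blast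
    have meas: "(\<lambda>\<omega>. \<lambda>j\<in>J. \<xi> (j + h) \<omega>) \<in> measurable M (\<Pi>\<^sub>M j\<in>J. borel)" for h
      by (intro measurable_restrict) (auto simp: J_def)
    have eq: "distr M (\<Pi>\<^sub>M j\<in>J. borel) (\<lambda>\<omega>. \<lambda>j\<in>J. \<xi> (j + (i - 1)) \<omega>) =
        distr M (\<Pi>\<^sub>M j\<in>J. borel) (\<lambda>\<omega>. \<lambda>j\<in>J. \<xi> (j + 0) \<omega>)"
      using st unfolding stationary_process_def J_def by simp
    have [measurable]: "(\<lambda>x. x 1 * x (1 + k)) \<in> borel_measurable (\<Pi>\<^sub>M j\<in>J. (borel :: real measure))"
      by (intro borel_measurable_times measurable_component_singleton) (auto simp: J_def)
    have "(\<integral>x. x 1 * x (1 + k) \<partial>distr M (\<Pi>\<^sub>M j\<in>J. borel) (\<lambda>\<omega>. \<lambda>j\<in>J. \<xi> (j + h) \<omega>)) =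
        (\<integral>\<omega>. \<xi> (1 + h) \<omega> * \<xi> (1 + k + h) \<omega> \<partial>M)" for h
      by (subst integral_distr[OF meas]) (auto simp: J_def)
    from this[of 0] this[of "i - 1"] have "(\<integral>\<omega>. \<xi> i \<omega> * \<xi> (i + k) \<omega> \<partial>M) = (\<integral>\<omega>. \<xi> 1 \<omega> * \<xi> (1 + k) \<omega> \<partial>M)"
      unfolding eq using that by (simp add: add.commute)
    then show ?thesis
      unfolding autocovariance_def covariance_def using mean by simp
  qed
  show ?thesis
  proof (cases "i \<le> j")
    case True
    then show ?thesis using *[of i "j - i"] i by simp
  next
    case False
    then show ?thesis using *[of j "i - j"] j by (simp add: mult.commute)
  qed
qed

subsection \<open>Decay of the linear correlation\<close>

lemma sum_abs_square_le:
  fixes a :: "nat \<Rightarrow> real"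
  shows "(\<Sum>p<l. \<bar>a p\<bar>)\<^sup>2 \<le> real l * (\<Sum>p<l. (a p)\<^sup>2)"
  using Cauchy_Schwarz_ineq_sum[of "\<lambda>_. 1" "\<lambda>p. \<bar>a p\<bar>" "{..<l}"] by simp

text \<open>Freezing all covariances at lag \<open>k - l\<close> leaves a rank-one form, the product
  of the two coefficient sums, which \<open>C\<^sub>2\<close> controls; the deviations cost a factor
  \<open>l\<close> against the sums of squares, which \<open>C\<^sub>1\<close> controls. The
  reference lag lies just below all lags that occur, so increments are needed in the forward
  direction alone. \<open>A\<close> and \<open>B\<close> stand for the variances.\<close>

lemma Toeplitz_cross_form_bound:
  fixes \<gamma> :: "nat \<Rightarrow> real"
  assumes C: "0 \<le> C\<^sub>1" "0 \<le> \<Delta>"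
    and k: "l \<le> k" and \<Delta>: "\<And>m. k - l < m \<Longrightarrow> m < k + l \<Longrightarrow> \<bar>\<gamma> m - \<gamma> (k - l)\<bar> \<le> \<Delta>"
    and a: "(\<Sum>p<l. (a p)\<^sup>2) \<le> C\<^sub>1 * A" "(\<Sum>p<l. a p)\<^sup>2 \<le> C\<^sub>2 * A"
    and b: "(\<Sum>p<l. (b p)\<^sup>2) \<le> C\<^sub>1 * B" "(\<Sum>p<l. b p)\<^sup>2 \<le> C\<^sub>2 * B"
  shows "\<bar>cross_form \<gamma> k a b l\<bar> \<le> (\<bar>\<gamma> (k - l)\<bar> * C\<^sub>2 + \<Delta> * real l * C\<^sub>1) / 2 * (A + B)"
proof -
  have amgm: "\<bar>x * y\<bar> \<le> (x\<^sup>2 + y\<^sup>2) / 2" for x y :: real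
    using sum_squares_bound[of "\<bar>x\<bar>" "\<bar>y\<bar>"] by (simp add: abs_mult)
  define E where "E p q = \<gamma> (k + q - p) - \<gamma> (k - l)" for p q
  have E: "\<bar>E p q\<bar> \<le> \<Delta>" if "p < l" "q < l" for p q
    unfolding E_def using that k by (intro \<Delta>) auto
  have "(\<Sum>p<l. \<Sum>q<l. a p * b q * \<gamma> (k + q - p)) =
      (\<Sum>p<l. \<Sum>q<l. \<gamma> (k - l) * (a p * b q)) + (\<Sum>p<l. \<Sum>q<l. a p * b q * E p q)"
    unfolding sum.distrib[symmetric] E_def by (intro sum.cong refl) (simp add: algebra_simps)
  also have "(\<Sum>p<l. \<Sum>q<l. \<gamma> (k - l) * (a p * b q)) = \<gamma> (k - l) * ((\<Sum>p<l. a p) * (\<Sum>q<l. b q))"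
    by (simp only: sum_product) (simp only: sum_distrib_left)
  finally have split: "(\<Sum>p<l. \<Sum>q<l. a p * b q * \<gamma> (k + q - p)) =
      \<gamma> (k - l) * ((\<Sum>p<l. a p) * (\<Sum>q<l. b q)) + (\<Sum>p<l. \<Sum>q<l. a p * b q * E p q)" .
  have 1: "\<bar>\<gamma> (k - l) * ((\<Sum>p<l. a p) * (\<Sum>q<l. b q))\<bar> \<le> \<bar>\<gamma> (k - l)\<bar> * ((C\<^sub>2 * A + C\<^sub>2 * B) / 2)"
  proof -
    have "\<bar>(\<Sum>p<l. a p) * (\<Sum>q<l. b q)\<bar> \<le> (C\<^sub>2 * A + C\<^sub>2 * B) / 2"
      by (rule order_trans[OF amgm]) (use a(2) b(2) in simp)
    then show ?thesis unfolding abs_mult[of "\<gamma> (k - l)"] by (intro mult_left_mono) auto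
  qed
  have "\<bar>\<Sum>p<l. \<Sum>q<l. a p * b q * E p q\<bar> \<le> (\<Sum>p<l. \<Sum>q<l. \<bar>a p * b q * E p q\<bar>)"
    by (intro order_trans[OF sum_abs] sum_mono sum_abs)
  also have "\<dots> \<le> (\<Sum>p<l. \<Sum>q<l. \<bar>a p\<bar> * \<bar>b q\<bar> * \<Delta>)"
    using E by (intro sum_mono) (auto simp: abs_mult intro!: mult_left_mono)
  also have "\<dots> = \<Delta> * ((\<Sum>p<l. \<bar>a p\<bar>) * (\<Sum>q<l. \<bar>b q\<bar>))"
    by (simp only: sum_product) (simp only: sum_distrib_left mult_ac)
  also have "\<dots> \<le> \<Delta> * ((real l * (C\<^sub>1 * A) + real l * (C\<^sub>1 * B)) / 2)"
  proof (rule mult_left_mono[OF _ C(2)])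
    have "(\<Sum>p<l. \<bar>a p\<bar>)\<^sup>2 \<le> real l * (C\<^sub>1 * A)"
      by (rule order_trans[OF sum_abs_square_le]) (intro mult_left_mono a(1), simp)
    moreover have "(\<Sum>p<l. \<bar>b p\<bar>)\<^sup>2 \<le> real l * (C\<^sub>1 * B)"
      by (rule order_trans[OF sum_abs_square_le]) (intro mult_left_mono b(1), simp)
    ultimately show "(\<Sum>p<l. \<bar>a p\<bar>) * (\<Sum>q<l. \<bar>b q\<bar>) \<le> (real l * (C\<^sub>1 * A) + real l * (C\<^sub>1 * B)) / 2"
      by - (rule order_trans[OF order_trans[OF abs_ge_self amgm]], simp)
  qed
  finally have 2: "\<bar>\<Sum>p<l. \<Sum>q<l. a p * b q * E p q\<bar> \<le> \<Delta> * ((real l * (C\<^sub>1 * A) + real l * (C\<^sub>1 * B)) / 2)" .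
  have "\<bar>\<gamma> (k - l)\<bar> * ((C\<^sub>2 * A + C\<^sub>2 * B) / 2) + \<Delta> * ((real l * (C\<^sub>1 * A) + real l * (C\<^sub>1 * B)) / 2) =
      (\<bar>\<gamma> (k - l)\<bar> * C\<^sub>2 + \<Delta> * real l * C\<^sub>1) / 2 * (A + B)"
    by (simp add: algebra_simps add_divide_distrib)
  with order_trans[OF abs_triangle_ineq add_mono[OF 1 2]] show ?thesis
    unfolding cross_form_def split by simp
qed

text \<open>Each step \<open>k \<le> 2 m / 3\<close> costs at most an additive constant, so \<open>L\<close> grows at most
  logarithmically.\<close>

lemma doubling_growth:
  fixes L :: "nat \<Rightarrow> real"
  assumes \<eta>: "0 < \<eta>" and step: "\<And>k m. k\<^sub>1 \<le> k \<Longrightarrow> k < m \<Longrightarrow> m \<le> 3 * k - 1 \<Longrightarrow> L m \<le> L k + K"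
  shows "\<exists>A\<ge>0. \<forall>m\<ge>1. L m \<le> A * real m powr \<eta>"
proof -
  define m\<^sub>0 where "m\<^sub>0 = 2 * k\<^sub>1 + 4"
  define q where "q = (2 / 3 :: real) powr \<eta>"
  have q: "0 < q" "q < 1" using \<eta> powr_less_mono2[of \<eta> "2 / 3" 1] by (auto simp: q_def)
  \<comment> \<open>Large enough for the finitely many start values and for
    \<open>K \<le> A * (1 - q)\<close>, so that the additive loss fits into the gap between
    \<open>q * m powr \<eta>\<close> and \<open>m powr \<eta>\<close>.\<close>
  define A where "A = max (Max (insert 0 (L ` {..<m\<^sub>0}))) (K / (1 - q))"
  have A0: "0 \<le> A" and AL: "\<And>m. m < m\<^sub>0 \<Longrightarrow> L m \<le> A" and AK: "K \<le> A * (1 - q)"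
  proof -
    show "0 \<le> A" unfolding A_def by (intro max.coboundedI1 Max_ge) auto
    show "L m \<le> A" if "m < m\<^sub>0" for m
      unfolding A_def using that by (intro max.coboundedI1 Max_ge) auto
    have "K / (1 - q) \<le> A" unfolding A_def by simp
    then show "K \<le> A * (1 - q)" using q by (simp add: divide_le_eq)
  qed
  have "L m \<le> A * real m powr \<eta>" if "1 \<le> m" for m
    using that
  proof (induction m rule: less_induct)
    case (less m)
    have m1: "1 \<le> real m powr \<eta>" using less.prems \<eta> by (intro ge_one_powr_ge_zero) auto
    show ?case
    proof (cases "m < m\<^sub>0")
      case True
      have "L m \<le> A * 1" using AL[OF True] by simp
      also have "\<dots> \<le> A * real m powr \<eta>" by (intro mult_left_mono m1 A0)
      finally show ?thesis .
    next
      case False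
      \<comment> \<open>The size of \<open>m\<^sub>0\<close> leaves room for the rounding:
        \<open>k\<close> stays above \<open>k\<^sub>1\<close>, reaches \<open>m\<close> within
        \<open>3 * k - 1\<close>, and is at most two thirds of \<open>m\<close>.\<close>
      define k where "k = (m + 1) div 2"
      have k: "k\<^sub>1 \<le> k" "k < m" "m \<le> 3 * k - 1" "1 \<le> k" "3 * k \<le> 2 * m"
        using False by (auto simp: k_def m\<^sub>0_def)
      have "real k powr \<eta> \<le> (2 / 3 * real m) powr \<eta>"
        using k \<eta> by (intro powr_mono2) auto
      also have "\<dots> = q * real m powr \<eta>" unfolding q_def by (rule powr_mult)
      finally have kq: "real k powr \<eta> \<le> q * real m powr \<eta>" .
      have "L m \<le> L k + K" by (rule step) (use k in auto)
      also have "\<dots> \<le> A * real k powr \<eta> + A * (1 - q) * 1"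
        using less.IH[of k] k AK by simp
      also have "\<dots> \<le> A * (q * real m powr \<eta>) + A * (1 - q) * real m powr \<eta>"
        using A0 q by (intro add_mono mult_left_mono kq m1) auto
      also have "\<dots> = A * real m powr \<eta>" by (simp add: algebra_simps)
      finally show ?thesis .
    qed
  qed
  with A0 show ?thesis by blast
qed

text \<open>As \<open>x / y \<le> 1\<close> and \<open>D \<le> 1\<close>, the ratio of the powers is
  at least \<open>x / y\<close>, and \<open>x / y \<ge> 1 - (y - x) / x\<close>.\<close>

lemma powr_neg_diff_le:
  fixes x y D :: real
  assumes D: "0 < D" "D \<le> 1" and x: "0 < x" "x \<le> y"
  shows "\<bar>y powr (- D) - x powr (- D)\<bar> \<le> x powr (- D) * ((y - x) / x)"
proof -
  have le: "y powr (- D) \<le> x powr (- D)" using D x by (intro powr_mono2') auto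
  have "(x / y) powr 1 \<le> (x / y) powr D" using D x by (intro powr_mono') auto
  moreover have "(x / y) powr D = y powr (- D) / x powr (- D)"
    using x by (simp add: powr_divide powr_minus field_simps)
  ultimately have "x / y * x powr (- D) \<le> y powr (- D)"
    using x by (simp add: field_simps)
  moreover have "1 - (y - x) / x \<le> x / y"
  proof -
    have "x / y - (1 - (y - x) / x) = (y - x)\<^sup>2 / (x * y)"
      using x by (simp add: field_simps power2_eq_square)
    then show ?thesis using x by (smt (verit) divide_nonneg_nonneg mult_nonneg_nonneg zero_le_power2)
  qed
  then have "(1 - (y - x) / x) * x powr (- D) \<le> x / y * x powr (- D)"
    by (intro mult_right_mono) auto
  ultimately show ?thesis using le by (simp add: algebra_simps)
qed

text \<open>A product rule: the change of \<open>L\<close> costs \<open>K * l / k\<close>, the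
  change of the power at most \<open>2 * l / k\<close> relative to its size, since
  \<open>m - k < 2 * l\<close>. Both gain a factor \<open>l / k\<close> over
  \<open>\<gamma> k\<close> itself.\<close>

lemma power_law_increment:
  fixes L \<gamma> :: "nat \<Rightarrow> real"
  assumes D: "0 < D" "D \<le> 1" and k: "1 \<le> k" and m: "k < m" "m < k + 2 * l"
    and \<gamma>: "\<gamma> k = real k powr (- D) * L k" "\<gamma> m = real m powr (- D) * L m"
    and L: "0 \<le> L k" "L k \<le> U" "\<bar>L k - L m\<bar> \<le> K * (real l / real k)" and "0 \<le> K"
  shows "\<bar>\<gamma> m - \<gamma> k\<bar> \<le> real k powr (- 1 - D) * real l * (K + 2 * U)"
proof -
  have le: "real m powr (- D) \<le> real k powr (- D)" using D k m by (intro powr_mono2') auto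
  have pk: "real k powr (- D) * (x / real k) = real k powr (- 1 - D) * x" for x
  proof -
    have "real k powr (- 1 - D) = real k powr (- D) * real k powr (- 1)"
      unfolding powr_add[symmetric] by (rule arg_cong[where f = "(powr) (real k)"]) simp
    then show ?thesis using k by (simp add: powr_minus divide_inverse)
  qed
  have "\<gamma> m - \<gamma> k = real m powr (- D) * (L m - L k) + (real m powr (- D) - real k powr (- D)) * L k"
    by (simp add: \<gamma> algebra_simps)
  then have "\<bar>\<gamma> m - \<gamma> k\<bar> \<le> real m powr (- D) * \<bar>L k - L m\<bar> + \<bar>real m powr (- D) - real k powr (- D)\<bar> * L k"
    using abs_triangle_ineq[of "real m powr (- D) * (L m - L k)" "(real m powr (- D) - real k powr (- D)) * L k"] L(1)
    by (simp add: abs_mult abs_minus_commute)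
  also have "\<dots> \<le> real k powr (- D) * (K * (real l / real k)) + real k powr (- D) * (2 * real l / real k) * U"
  proof (intro add_mono mult_mono)
    have "\<bar>real m powr (- D) - real k powr (- D)\<bar> \<le> real k powr (- D) * ((real m - real k) / real k)"
      by (rule powr_neg_diff_le) (use D k m in auto)
    also have "\<dots> \<le> real k powr (- D) * (2 * real l / real k)"
      using k m by (intro mult_left_mono divide_right_mono) auto
    finally show "\<bar>real m powr (- D) - real k powr (- D)\<bar> \<le> real k powr (- D) * (2 * real l / real k)" .
  qed (use le L k in auto)
  also have "\<dots> = real k powr (- 1 - D) * real l * (K + 2 * U)"
    using pk[of "K * real l"] pk[of "2 * real l"] by (simp add: algebra_simps)
  finally show ?thesis .
qed

text \<open>Counting powers of \<open>n\<close>: since \<theta> is at most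
  \<open>1 - \<epsilon>\<close>, the first exponent is at most
  \<open>2 * \<eta> - \<epsilon> * D - \<epsilon> * \<eta>\<close>, the others are
  \<open>- 2 * \<epsilon>\<close> and \<open>- 2 * \<epsilon> + \<eta>\<close>. The choice
  \<open>\<eta> = \<epsilon> * D / 4\<close> makes all of them negative.\<close>

lemma power_rate_tendsto_0:
  assumes D: "0 < D" "D \<le> 1" and \<epsilon>: "0 < \<epsilon>" "\<epsilon> \<le> 1" and \<delta>: "0 < \<delta>" and B: "0 < B"
  defines "\<eta> \<equiv> \<epsilon> * D / 4" and "\<theta> \<equiv> (1 + D) / 2 - \<epsilon>"
  shows "(\<lambda>n. (\<delta> * real n) powr (- D) * (A * real n powr \<eta>) * ((B * real n powr \<theta>) powr (D + \<eta>) / (\<eta> * c))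
      + (\<delta> * real n) powr (- 1 - D) * (B * real n powr \<theta>)\<^sup>2 * (K + 2 * (A * real n powr \<eta>)) / c) \<longlonglongrightarrow> 0"
    (is "?R \<longlonglongrightarrow> 0")
proof -
  define e\<^sub>1 where "e\<^sub>1 = - D + \<eta> + \<theta> * (D + \<eta>)"
  define e\<^sub>2 where "e\<^sub>2 = - 1 - D + \<theta> * 2"
  define e\<^sub>3 where "e\<^sub>3 = e\<^sub>2 + \<eta>"
  define c\<^sub>1 where "c\<^sub>1 = \<delta> powr (- D) * A * (B powr (D + \<eta>) / (\<eta> * c))"
  define c\<^sub>2 where "c\<^sub>2 = \<delta> powr (- 1 - D) * B\<^sup>2 / c"
  have \<eta>: "0 < \<eta>" using D \<epsilon> by (simp add: \<eta>_def)
  have "\<theta> \<le> 1 - \<epsilon>" using D by (simp add: \<theta>_def)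
  then have "\<theta> * (D + \<eta>) \<le> (1 - \<epsilon>) * (D + \<eta>)" using D \<eta> by (intro mult_right_mono) auto
  also have "\<dots> = D + \<eta> - \<epsilon> * D - \<epsilon> * \<eta>" by (simp add: algebra_simps)
  finally have "e\<^sub>1 \<le> 2 * \<eta> - \<epsilon> * D - \<epsilon> * \<eta>" by (simp add: e\<^sub>1_def)
  moreover have "0 < \<epsilon> * D" "0 < \<epsilon> * \<eta>" using D \<epsilon> \<eta> by simp_all
  moreover have "2 * \<eta> = \<epsilon> * D / 2" by (simp add: \<eta>_def)
  ultimately have e1: "e\<^sub>1 < 0" by linarith
  have "e\<^sub>2 = - 2 * \<epsilon>" by (simp add: e\<^sub>2_def \<theta>_def field_simps)
  moreover have "\<epsilon> * D \<le> \<epsilon> * 1" using D \<epsilon> by (intro mult_left_mono) auto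
  ultimately have e2: "e\<^sub>2 < 0" "e\<^sub>3 < 0" using \<epsilon> by (simp_all add: e\<^sub>3_def \<eta>_def)
  have lim: "(\<lambda>n. real n powr e) \<longlonglongrightarrow> 0" if "e < 0" for e
    using that by (intro tendsto_neg_powr filterlim_real_sequentially)
  have "(\<lambda>n. c\<^sub>1 * real n powr e\<^sub>1 + c\<^sub>2 * K * real n powr e\<^sub>2 + c\<^sub>2 * (2 * A) * real n powr e\<^sub>3) \<longlonglongrightarrow>
      c\<^sub>1 * 0 + c\<^sub>2 * K * 0 + c\<^sub>2 * (2 * A) * 0"
    using e1 e2 by (intro tendsto_intros lim)
  moreover have "\<forall>\<^sub>F n in sequentially.
      c\<^sub>1 * real n powr e\<^sub>1 + c\<^sub>2 * K * real n powr e\<^sub>2 + c\<^sub>2 * (2 * A) * real n powr e\<^sub>3 = ?R n"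
    using eventually_gt_at_top[of 0]
  proof eventually_elim
    case (elim n)
    define x where "x = real n"
    have x: "0 < x" using elim by (simp add: x_def)
    have p1: "(\<delta> * x) powr a = \<delta> powr a * x powr a" for a
      by (rule powr_mult)
    have p2: "(B * x powr \<theta>) powr a = B powr a * x powr (\<theta> * a)" for a
      by (subst powr_mult) (simp add: powr_powr)
    have p3: "(B * x powr \<theta>)\<^sup>2 = B\<^sup>2 * x powr (\<theta> * 2)"
      using x by (simp add: power_mult_distrib power2_eq_square powr_add[symmetric] mult.commute[of \<theta>])
    have E1: "x powr e\<^sub>1 = x powr (- D) * x powr \<eta> * x powr (\<theta> * (D + \<eta>))"
      by (simp only: e\<^sub>1_def powr_add)
    have E2: "x powr e\<^sub>2 = x powr (- 1 - D) * x powr (\<theta> * 2)"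
      by (simp only: e\<^sub>2_def powr_add)
    have E3: "x powr e\<^sub>3 = x powr (- 1 - D) * x powr (\<theta> * 2) * x powr \<eta>"
      by (simp only: e\<^sub>3_def E2[symmetric] powr_add)
    show ?case
      unfolding x_def[symmetric] p1 p2 p3 E1 E2 E3 c\<^sub>1_def c\<^sub>2_def
      by (simp add: distrib_left add_divide_distrib mult_ac)
  qed
  ultimately show ?thesis using Lim_transform_eventually by force
qed

text \<open>The two size conditions come from the same growth bound as the correlation and are
  consumed with it: one leaves at least \<open>n / 2\<close> blocks, the other makes the lags in
  \<open>cross_form\<close> genuine.\<close>

abbreviation linear_mixing :: "(nat \<Rightarrow> real) \<Rightarrow> (nat \<Rightarrow> nat) \<Rightarrow> real \<Rightarrow> (nat \<Rightarrow> real) \<Rightarrow> bool" where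
  "linear_mixing \<gamma> l \<delta> R \<equiv> \<forall>\<^sub>F n in sequentially. 2 * l n \<le> n \<and>
     (\<forall>k a b. \<delta> * real n \<le> real k \<and> k \<le> n \<longrightarrow> l n \<le> k \<and>
       \<bar>cross_form \<gamma> k a b (l n)\<bar> \<le> R n / 2 * (toeplitz_form \<gamma> a (l n) + toeplitz_form \<gamma> b (l n)))"

lemma linear_mixing_rate:
  fixes \<gamma> L :: "nat \<Rightarrow> real" and l :: "nat \<Rightarrow> nat"
  assumes D: "0 < D" "D \<le> 1" and l1: "\<And>n. 1 \<le> n \<Longrightarrow> 1 \<le> l n" and mono: "mono_on {1..} l"
    and O: "\<exists>\<epsilon>>0. (\<lambda>n. real (l n)) \<in> O(\<lambda>n. real n powr ((1 + D) / 2 - \<epsilon>))"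
    and \<gamma>: "\<And>k. 1 \<le> k \<Longrightarrow> \<gamma> k = real k powr (- D) * L k" and L0: "\<And>k. 1 \<le> k \<Longrightarrow> 0 \<le> L k"
    and K: "\<And>k l' m. 1 \<le> k \<Longrightarrow> l k \<le> l' \<Longrightarrow> l' \<le> k \<Longrightarrow> k < m \<Longrightarrow> m < k + 2 * l' \<Longrightarrow>
      \<bar>L k - L m\<bar> \<le> K * (real l' / real k)" and K0: "0 \<le> K"
    and sd: "spectral_density \<gamma> f" and c: "0 < c"
    and lower: "\<And>x. 0 < x \<Longrightarrow> x < pi \<Longrightarrow> c * x powr (D - 1) \<le> f x"
    and \<delta>: "0 < \<delta>"
  shows "\<exists>R. R \<longlonglongrightarrow> 0 \<and> linear_mixing \<gamma> l \<delta> R"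
proof -
  obtain \<epsilon>\<^sub>0 where \<epsilon>\<^sub>0: "0 < \<epsilon>\<^sub>0" "(\<lambda>n. real (l n)) \<in> O(\<lambda>n. real n powr ((1 + D) / 2 - \<epsilon>\<^sub>0))" using O by blast
  \<comment> \<open>The cap only weakens the growth bound and keeps \<open>\<eta> \<le> 1\<close>,
    as the variance bound demands.\<close>
  define \<epsilon> where "\<epsilon> = min \<epsilon>\<^sub>0 1"
  define \<theta> where "\<theta> = (1 + D) / 2 - \<epsilon>"
  define \<eta> where "\<eta> = \<epsilon> * D / 4"
  have \<epsilon>: "0 < \<epsilon>" "\<epsilon> \<le> 1" using \<epsilon>\<^sub>0 by (auto simp: \<epsilon>_def)
  have \<eta>: "0 < \<eta>" using D \<epsilon> by (simp add: \<eta>_def)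
  have "\<epsilon> * D \<le> 1 * 1" using D \<epsilon> by (intro mult_mono) auto
  then have \<eta>1: "\<eta> \<le> 1" by (simp add: \<eta>_def)
  obtain B where B: "0 < B" "\<forall>\<^sub>F n in sequentially. real (l n) \<le> B * real n powr \<theta>"
  proof -
    obtain B where B: "B > 0" "\<forall>\<^sub>F n in sequentially. norm (real (l n)) \<le> B * norm (real n powr ((1 + D) / 2 - \<epsilon>\<^sub>0))"
      using \<epsilon>\<^sub>0(2) by (rule landau_o.bigE)
    have "\<forall>\<^sub>F n in sequentially. real (l n) \<le> B * real n powr \<theta>"
      using B(2) eventually_ge_at_top[of 1]
    proof eventually_elim
      case (elim n)
      have "real n powr ((1 + D) / 2 - \<epsilon>\<^sub>0) \<le> real n powr \<theta>"
        using elim by (intro powr_mono) (auto simp: \<theta>_def \<epsilon>_def)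
      then have "B * real n powr ((1 + D) / 2 - \<epsilon>\<^sub>0) \<le> B * real n powr \<theta>" using B(1) by simp
      then show ?case using elim by simp
    qed
    then show thesis using B(1) that by blast
  qed
  have small: "\<forall>\<^sub>F n in sequentially. B * real n powr \<theta> \<le> d * real n" if d: "0 < d" for d
  proof -
    have "\<theta> - 1 < 0" using D \<epsilon> by (simp add: \<theta>_def field_simps)
    then have "(\<lambda>n. B * real n powr (\<theta> - 1)) \<longlonglongrightarrow> B * 0"
      by (intro tendsto_intros tendsto_neg_powr filterlim_real_sequentially)
    then have "\<forall>\<^sub>F n in sequentially. B * real n powr (\<theta> - 1) < d"
      using d by (intro order_tendstoD(2)) auto
    then show ?thesis
      using eventually_gt_at_top[of 0]
    proof eventually_elim
      case (elim n)
      then have "B * real n powr (\<theta> - 1) * real n \<le> d * real n" by (intro mult_right_mono) auto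
      moreover have "real n powr (\<theta> - 1) * real n = real n powr \<theta>"
        using elim powr_add[of "real n" "\<theta> - 1" 1] by simp
      ultimately show ?case by (simp add: mult.assoc)
    qed
  qed
  obtain A where A: "0 \<le> A" "\<And>m. 1 \<le> m \<Longrightarrow> L m \<le> A * real m powr \<eta>"
  proof -
    obtain k\<^sub>1 where k1: "\<And>n. k\<^sub>1 \<le> n \<Longrightarrow> l n \<le> n \<and> 1 \<le> n"
    proof -
      have "\<forall>\<^sub>F n in sequentially. l n \<le> n \<and> 1 \<le> n"
        using B(2) small[of 1, OF zero_less_one] eventually_ge_at_top[of 1] by eventually_elim auto
      then show thesis using that unfolding eventually_sequentially by blast
    qed
    \<comment> \<open>Condition (1) with the largest admissible \<open>l' = k\<close>: it reaches up
      to \<open>3 * k - 1\<close> with relative factor 1. This is where \<open>l k \<le> k\<close>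
      for large \<open>k\<close> is used.\<close>
    have "L m \<le> L k + K" if "k\<^sub>1 \<le> k" "k < m" "m \<le> 3 * k - 1" for k m
    proof -
      have k: "l k \<le> k" "1 \<le> k" using k1[OF that(1)] by auto
      then have "\<bar>L k - L m\<bar> \<le> K * (real k / real k)"
        using that by (intro K) auto
      then show ?thesis using k by simp
    qed
    from doubling_growth[of \<eta> k\<^sub>1 L K, OF \<eta> this] obtain A
      where A: "0 \<le> A" "\<forall>m\<ge>1. L m \<le> A * real m powr \<eta>" by blast
    show thesis by (rule that[OF A(1)]) (use A(2) in simp)
  qed
  \<comment> \<open>The factor \<open>\<delta> / 2\<close> appears because the reference lag
    \<open>h = k - l n\<close> may drop to half of \<open>k\<close>.\<close>
  define R where "R n = (\<delta> / 2 * real n) powr (- D) * (A * real n powr \<eta>) * ((B * real n powr \<theta>) powr (D + \<eta>) / (\<eta> * c))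
      + (\<delta> / 2 * real n) powr (- 1 - D) * (B * real n powr \<theta>)\<^sup>2 * (K + 2 * (A * real n powr \<eta>)) / c" for n
  have "R \<longlonglongrightarrow> 0"
    unfolding R_def \<eta>_def \<theta>_def using D \<epsilon> \<delta> B(1) by (intro power_rate_tendsto_0) auto
  moreover have "linear_mixing \<gamma> l \<delta> R"
    using B(2) small[of "\<delta> / 2", OF half_gt_zero[OF \<delta>]] small[of "1 / 2", OF half_gt_zero[OF zero_less_one]] eventually_ge_at_top[of 1]
  proof eventually_elim
    case (elim n)
    have "\<bar>cross_form \<gamma> k a b (l n)\<bar> \<le> R n / 2 * (toeplitz_form \<gamma> a (l n) + toeplitz_form \<gamma> b (l n)) \<and> l n \<le> k"
      if k: "\<delta> * real n \<le> real k" "k \<le> n" for k a b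
    proof -
      define h where "h = k - l n"
      have l2: "2 * real (l n) \<le> real k" using elim k by linarith
      have lk: "2 * l n \<le> k" using l2 by linarith
      have ln1: "1 \<le> l n" using l1 elim by blast
      have h: "1 \<le> h" "l n \<le> h" "h \<le> n" "real h = real k - real (l n)"
        using lk ln1 k by (auto simp: h_def of_nat_diff)
      have hn: "\<delta> / 2 * real n \<le> real h" using l2 h(4) k by simp
      have dn: "0 < \<delta> / 2 * real n" using \<delta> elim by simp
      \<comment> \<open>Condition (1) at lag \<open>h\<close> admits \<open>l' \<ge> l h\<close>
        only; monotonicity of \<open>l\<close> and \<open>h \<le> n\<close> make
        \<open>l' = l n\<close> admissible.\<close>
      have lh: "l h \<le> l n" using mono h elim by (auto simp: mono_on_def)
      define U where "U = A * real n powr \<eta>"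
      have LU: "L h \<le> U"
      proof -
        have "L h \<le> A * real h powr \<eta>" using A(2) h by blast
        also have "\<dots> \<le> U" unfolding U_def using A(1) h \<eta> by (intro mult_left_mono powr_mono2) auto
        finally show ?thesis .
      qed
      have U0: "0 \<le> U" using A(1) by (simp add: U_def)
      define \<Delta> where "\<Delta> = real h powr (- 1 - D) * real (l n) * (K + 2 * U)"
      have \<Delta>0: "0 \<le> \<Delta>" using K0 U0 by (simp add: \<Delta>_def)
      define C\<^sub>2 where "C\<^sub>2 = real (l n) powr (D + \<eta>) / (\<eta> * c)"
      note var = spectral_density_variance_bounds[OF sd c D lower]
      have v1: "(\<Sum>p<l n. (a p)\<^sup>2) \<le> 1 / c * toeplitz_form \<gamma> a (l n)" for a
        by (rule var(1))
      have v2: "(\<Sum>p<l n. a p)\<^sup>2 \<le> C\<^sub>2 * toeplitz_form \<gamma> a (l n)" for a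
        unfolding C\<^sub>2_def by (rule var(2)[OF _ _ \<eta> \<eta>1 ln1])
      have bound: "\<bar>cross_form \<gamma> k a b (l n)\<bar> \<le>
          (\<bar>\<gamma> (k - l n)\<bar> * C\<^sub>2 + \<Delta> * real (l n) * (1 / c)) / 2 * (toeplitz_form \<gamma> a (l n) + toeplitz_form \<gamma> b (l n))"
      proof (rule Toeplitz_cross_form_bound[OF _ \<Delta>0 _ _ v1 v2 v1 v2])
        fix m assume m: "k - l n < m" "m < k + l n"
        then have m': "h < m" "m < h + 2 * l n" using lk by (auto simp: h_def)
        show "\<bar>\<gamma> m - \<gamma> (k - l n)\<bar> \<le> \<Delta>"
          unfolding \<Delta>_def h_def[symmetric]
          by (rule power_law_increment[where L = L, OF D h(1) m' \<gamma> \<gamma> L0 LU K K0]) (use h lh m' in auto)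
      qed (use c lk in auto)
      have g: "\<bar>\<gamma> h\<bar> \<le> (\<delta> / 2 * real n) powr (- D) * U"
      proof -
        have "\<bar>\<gamma> h\<bar> = real h powr (- D) * L h" using \<gamma>[OF h(1)] L0[OF h(1)] by (simp add: abs_mult)
        also have "\<dots> \<le> (\<delta> / 2 * real n) powr (- D) * U"
          using LU L0[OF h(1)] D dn hn by (intro mult_mono powr_mono2') auto
        finally show ?thesis .
      qed
      have l_le: "real (l n) \<le> B * real n powr \<theta>" using elim by blast
      have C2: "C\<^sub>2 \<le> (B * real n powr \<theta>) powr (D + \<eta>) / (\<eta> * c)" "0 \<le> C\<^sub>2"
        unfolding C\<^sub>2_def using D \<eta> c l_le by (auto intro!: divide_right_mono powr_mono2)
      have \<Delta>le: "\<Delta> * real (l n) * (1 / c) \<le>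
          (\<delta> / 2 * real n) powr (- 1 - D) * (B * real n powr \<theta>)\<^sup>2 * (K + 2 * U) / c"
      proof -
        have "\<Delta> * real (l n) * (1 / c) = real h powr (- 1 - D) * (real (l n))\<^sup>2 * (K + 2 * U) / c"
          by (simp add: \<Delta>_def power2_eq_square)
        also have "\<dots> \<le> (\<delta> / 2 * real n) powr (- 1 - D) * (B * real n powr \<theta>)\<^sup>2 * (K + 2 * U) / c"
          using D dn hn l_le c K0 U0
          by (intro divide_right_mono mult_right_mono mult_mono powr_mono2' power_mono) auto
        finally show ?thesis .
      qed
      have "\<bar>\<gamma> h\<bar> * C\<^sub>2 \<le> (\<delta> / 2 * real n) powr (- D) * U * ((B * real n powr \<theta>) powr (D + \<eta>) / (\<eta> * c))"
        using g C2 U0 by (intro mult_mono) auto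
      then have R: "\<bar>\<gamma> (k - l n)\<bar> * C\<^sub>2 + \<Delta> * real (l n) * (1 / c) \<le> R n"
        using \<Delta>le unfolding R_def U_def[symmetric] h_def[symmetric] by linarith
      have V0: "0 \<le> toeplitz_form \<gamma> a (l n)" for a
      proof -
        have "0 \<le> (\<Sum>p<l n. (a p)\<^sup>2)" by (intro sum_nonneg) auto
        also have "\<dots> \<le> 1 / c * toeplitz_form \<gamma> a (l n)" by (rule v1)
        finally show ?thesis using c by (simp add: zero_le_divide_iff)
      qed
      have "(\<bar>\<gamma> (k - l n)\<bar> * C\<^sub>2 + \<Delta> * real (l n) * (1 / c)) / 2 * (toeplitz_form \<gamma> a (l n) + toeplitz_form \<gamma> b (l n)) \<le>
          R n / 2 * (toeplitz_form \<gamma> a (l n) + toeplitz_form \<gamma> b (l n))"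
        using R V0[of a] V0[of b] by (intro mult_right_mono divide_right_mono) auto
      then show ?thesis using bound lk by simp
    qed
    moreover have "2 * l n \<le> n" using elim by linarith
    ultimately show ?case by blast
  qed
  ultimately show ?thesis by blast
qed

subsection \<open>Concentration of the subsampling estimator\<close>

lemma block_measurable:
  assumes "\<And>j. i \<le> j \<Longrightarrow> j < i + l \<Longrightarrow> X j \<in> borel_measurable S"
  shows "block X i l \<in> measurable S (\<Pi>\<^sub>M j\<in>{1..l}. borel)"
  unfolding block_def[abs_def] by (intro measurable_restrict assms) auto

text \<open>An event of the block starting at \<open>i\<close> lies in the approximable
  \<sigma>-algebra of the span of its own window, whatever \<open>G\<close> and \<open>E\<close>
  are, so the bound on linear forms passes to events. Both windows must live in one Gaussian space,
  hence the union \<open>J\<close>.\<close>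

lemma block_mixing:
  assumes M: "prob_space M" and gp: "gaussian_process M {1..} \<xi>"
    and mean: "\<And>n. 1 \<le> n \<Longrightarrow> (\<integral>\<omega>. \<xi> n \<omega> \<partial>M) = 0"
    and G: "G \<in> borel_measurable borel" and X: "\<And>n \<omega>. X n \<omega> = G (\<xi> n \<omega>)"
    and ij: "1 \<le> i" "1 \<le> j" and \<rho>: "0 < \<rho>" "\<rho> \<le> 1"
    and corr: "\<And>u v. u \<in> lincombs \<xi> {i..<i + l} \<Longrightarrow> v \<in> lincombs \<xi> {j..<j + l} \<Longrightarrow>
      \<bar>\<integral>\<omega>. u \<omega> * v \<omega> \<partial>M\<bar> \<le> \<rho> / 2 * ((\<integral>\<omega>. u \<omega> * u \<omega> \<partial>M) + (\<integral>\<omega>. v \<omega> * v \<omega> \<partial>M))"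
    and E: "E \<in> sets (\<Pi>\<^sub>M j\<in>{1..l}. borel)"
  defines "A \<equiv> \<lambda>i. {\<omega>\<in>space M. block X i l \<omega> \<in> E}"
  shows "measure M (A i \<inter> A j) - measure M (A i) * measure M (A j) \<le> \<rho>"
proof -
  define J where "J = {i..<i + l} \<union> {j..<j + l}"
  have J: "finite J" "J \<subseteq> {1..}" using ij by (auto simp: J_def)
  interpret gaussian_space M "lincombs \<xi> J"
    by (rule gaussian_space_lincombs[OF M gp _ J]) (use mean in auto)
  have "A m \<in> sets (approximable_algebra (lincombs \<xi> {m..<m + l}))"
    if m: "{m..<m + l} \<subseteq> J" for m
  proof -
    have sub: "lincombs \<xi> {m..<m + l} \<subseteq> lincombs \<xi> J" by (rule lincombs_mono[OF m J(1)])
    have "X n \<in> borel_measurable (approximable_algebra (lincombs \<xi> {m..<m + l}))"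
      if "m \<le> n" "n < m + l" for n
    proof -
      have "\<xi> n \<in> borel_measurable (approximable_algebra (lincombs \<xi> {m..<m + l}))"
        by (rule measurable_approximable_algebra[OF rv_subspace_lincombs sub lincombs_member])
          (use that in auto)
      from measurable_compose[OF this G] show ?thesis using X[of n] by (simp add: fun_eq_iff[symmetric] cong: measurable_cong)
    qed
    then have "block X m l \<in> measurable (approximable_algebra (lincombs \<xi> {m..<m + l})) (\<Pi>\<^sub>M j\<in>{1..l}. borel)"
      by (rule block_measurable)
    from measurable_sets[OF this E] show ?thesis
      by (simp add: A_def vimage_def Int_def conj_commute)
  qed
  then have "A i \<in> sets (approximable_algebra (lincombs \<xi> {i..<i + l}))"
    "A j \<in> sets (approximable_algebra (lincombs \<xi> {j..<j + l}))" by (auto simp: J_def)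
  moreover have "lincombs \<xi> {i..<i + l} \<subseteq> lincombs \<xi> J" "lincombs \<xi> {j..<j + l} \<subseteq> lincombs \<xi> J"
    by (rule lincombs_mono[OF _ J(1)], simp add: J_def)+
  ultimately show ?thesis
    by (intro approximable_algebra_mixing[OF rv_subspace_lincombs _ rv_subspace_lincombs _ \<rho> corr])
qed

text \<open>Stationarity concerns \<xi>; the coordinatewise map \<open>g\<close> transfers it to
  blocks of \<open>X\<close>, with shift \<open>i - 1\<close>.\<close>

lemma block_distribution:
  assumes st: "stationary_process M \<xi>"
    and G: "G \<in> borel_measurable borel" and X: "\<And>n \<omega>. X n \<omega> = G (\<xi> n \<omega>)"
    and i: "1 \<le> i" and E: "E \<in> sets (\<Pi>\<^sub>M j\<in>{1..l}. borel)"
  shows "measure M {\<omega>\<in>space M. block X i l \<omega> \<in> E} = measure M {\<omega>\<in>space M. block X 1 l \<omega> \<in> E}"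
proof -
  define P where "P = (\<Pi>\<^sub>M j\<in>{1..l}. (borel :: real measure))"
  define g where "g x = (\<lambda>j\<in>{1..l}. G (x j))" for x :: "nat \<Rightarrow> real"
  have g: "g \<in> measurable P P"
    unfolding g_def[abs_def] P_def
    by (intro measurable_restrict measurable_compose[OF _ G]) (rule measurable_component_singleton)
  have meas: "(\<lambda>\<omega>. \<lambda>j\<in>{1..l}. \<xi> (j + h) \<omega>) \<in> measurable M P" for h
    using st unfolding stationary_process_def P_def by (intro measurable_restrict) auto
  have bl: "block X (1 + h) l \<omega> = g (\<lambda>j\<in>{1..l}. \<xi> (j + h) \<omega>)" for h \<omega>
    unfolding block_def g_def X by (intro restrict_ext) (simp add: add.commute)
  have F: "g -` E \<inter> space P \<in> sets P" using measurable_sets[OF g, of E] E by (simp add: P_def)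
  have *: "measure M {\<omega>\<in>space M. block X (1 + h) l \<omega> \<in> E} =
      measure (distr M P (\<lambda>\<omega>. \<lambda>j\<in>{1..l}. \<xi> (j + h) \<omega>)) (g -` E \<inter> space P)" for h
    unfolding measure_distr[OF meas F] bl
    using measurable_space[OF meas, of _ h] by (intro arg_cong[where f = "measure M"]) auto
  have "distr M P (\<lambda>\<omega>. \<lambda>j\<in>{1..l}. \<xi> (j + (i - 1)) \<omega>) = distr M P (\<lambda>\<omega>. \<lambda>j\<in>{1..l}. \<xi> (j + 0) \<omega>)"
    using st unfolding stationary_process_def P_def by simp
  then show ?thesis using *[of "i - 1"] *[of 0] i by simp
qed

text \<open>Each index has at most \<open>2 * m\<close> partners closer than \<open>m\<close>, each
  contributing at most 1; the other pairs contribute at most \<rho>. Upper bounds on covariances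
  suffice because a second moment is estimated.\<close>

lemma (in prob_space) average_second_moment:
  assumes A: "\<And>i. i \<in> {1..n} \<Longrightarrow> A i \<in> events" and p: "\<And>i. i \<in> {1..n} \<Longrightarrow> prob (A i) = p"
    and n: "1 \<le> n" and \<rho>: "0 \<le> \<rho>"
    and far: "\<And>i j. i \<in> {1..n} \<Longrightarrow> j \<in> {1..n} \<Longrightarrow> m \<le> i - j + (j - i) \<Longrightarrow> prob (A i \<inter> A j) - p * p \<le> \<rho>"
  shows "(\<integral>\<omega>. (1 / real n * (\<Sum>i=1..n. indicator (A i) \<omega>) - p)\<^sup>2 \<partial>M) \<le> 2 * real m / real n + \<rho>"
proof -
  define f where "f i \<omega> = indicator (A i) \<omega> - p" for i \<omega>
  have avg: "1 / real n * (\<Sum>i=1..n. indicator (A i) \<omega>) - p = 1 / real n * (\<Sum>i=1..n. f i \<omega>)" for \<omega>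
    using n by (simp add: f_def sum_subtractf field_simps)
  have int: "integrable M (\<lambda>\<omega>. f i \<omega> * f j \<omega>)" and val: "(\<integral>\<omega>. f i \<omega> * f j \<omega> \<partial>M) = prob (A i \<inter> A j) - p * p"
    if "i \<in> {1..n}" "j \<in> {1..n}" for i j
  proof -
    have ev: "A i \<in> events" "A j \<in> events" "A i \<inter> A j \<in> events" using A that by auto
    have eq: "f i \<omega> * f j \<omega> = indicator (A i \<inter> A j) \<omega> - p * indicator (A i) \<omega> - p * indicator (A j) \<omega> + p * p" for \<omega>
      by (simp add: f_def indicator_def algebra_simps)
    show "integrable M (\<lambda>\<omega>. f i \<omega> * f j \<omega>)"
      unfolding eq using ev by (intro Bochner_Integration.integrable_add Bochner_Integration.integrable_diff
        integrable_mult_right integrable_const integrable_real_indicator) (auto simp: less_top[symmetric])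
    show "(\<integral>\<omega>. f i \<omega> * f j \<omega> \<partial>M) = prob (A i \<inter> A j) - p * p"
      unfolding eq using ev p that prob_space by (simp add: less_top[symmetric])
  qed
  have p01: "0 \<le> p" "p \<le> 1" using p[of 1] n prob_le_1[of "A 1"] measure_nonneg[of M "A 1"] by auto
  have le: "prob (A i \<inter> A j) - p * p \<le> (if i - j + (j - i) < m then 1 else 0) + \<rho>"
    if "i \<in> {1..n}" "j \<in> {1..n}" for i j
  proof (cases "i - j + (j - i) < m")
    case True
    have "prob (A i \<inter> A j) - p * p \<le> 1 + \<rho>"
      using prob_le_1[of "A i \<inter> A j"] zero_le_square[of p] \<rho> by linarith
    then show ?thesis using True by simp
  next
    case False
    then show ?thesis using far[OF that] by simp
  qed
  have card: "(\<Sum>j=1..n. if i - j + (j - i) < m then 1 else 0) \<le> 2 * real m" for i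
  proof -
    have "(\<Sum>j=1..n. if i - j + (j - i) < m then 1 else 0) = real (card {j\<in>{1..n}. i - j + (j - i) < m})"
      by (simp add: sum.If_cases Int_def)
    \<comment> \<open>If \<open>m\<close> exceeds \<open>i + 1\<close>, the lower end is truncated
      to 0 and the count \<open>i + m\<close> is still below \<open>2 * m\<close>.\<close>
    also have "\<dots> \<le> real (card {i + 1 - m..<i + m})"
      by (intro of_nat_mono card_mono) auto
    also have "\<dots> \<le> 2 * real m" by simp
    finally show ?thesis .
  qed
  have "(\<integral>\<omega>. (1 / real n * (\<Sum>i=1..n. indicator (A i) \<omega>) - p)\<^sup>2 \<partial>M) =
      (\<integral>\<omega>. (1 / real n)\<^sup>2 * (\<Sum>i=1..n. \<Sum>j=1..n. f i \<omega> * f j \<omega>) \<partial>M)"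
    unfolding avg power_mult_distrib by (simp add: power2_eq_square sum_product)
  also have "\<dots> = (1 / real n)\<^sup>2 * (\<Sum>i=1..n. \<Sum>j=1..n. prob (A i \<inter> A j) - p * p)"
  proof -
    have "(\<integral>\<omega>. (\<Sum>i=1..n. \<Sum>j=1..n. f i \<omega> * f j \<omega>) \<partial>M) = (\<Sum>i=1..n. \<integral>\<omega>. (\<Sum>j=1..n. f i \<omega> * f j \<omega>) \<partial>M)"
      by (intro Bochner_Integration.integral_sum Bochner_Integration.integrable_sum int)
    also have "\<dots> = (\<Sum>i=1..n. \<Sum>j=1..n. \<integral>\<omega>. f i \<omega> * f j \<omega> \<partial>M)"
      by (intro sum.cong refl Bochner_Integration.integral_sum int)
    also have "\<dots> = (\<Sum>i=1..n. \<Sum>j=1..n. prob (A i \<inter> A j) - p * p)"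
      by (intro sum.cong refl val)
    finally show ?thesis by simp
  qed
  also have "\<dots> \<le> (1 / real n)\<^sup>2 * (\<Sum>i=1..n. \<Sum>j=1..n. (if i - j + (j - i) < m then 1 else 0) + \<rho>)"
    using le by (intro mult_left_mono sum_mono) auto
  also have "\<dots> \<le> (1 / real n)\<^sup>2 * (\<Sum>i=1..n. 2 * real m + real n * \<rho>)"
    unfolding sum.distrib using card by (intro mult_left_mono add_mono sum_mono) auto
  also have "\<dots> = 2 * real m / real n + \<rho>"
    using n by (simp add: power2_eq_square field_simps)
  finally show ?thesis .
qed

text \<open>A value above the rational supremum would persist on an interval to the right of
  \<open>t\<close>, which contains a rational. The reduction to a countable supremum makes the
  supremum measurable in \<omega>.\<close>

lemma SUP_rationals_eq:
  fixes g :: "real \<Rightarrow> real"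
  assumes cont: "\<And>t. continuous (at_right t) g" and bdd: "\<And>t. g t \<le> B"
  shows "(SUP t. g t) = (SUP t\<in>\<rat>. g t)"
proof (rule antisym)
  have bdd': "bdd_above (g ` S)" for S using bdd by (intro bdd_aboveI[of _ B]) auto
  show "(SUP t\<in>\<rat>. g t) \<le> (SUP t. g t)"
    by (intro cSUP_subset_mono bdd') (auto intro: exI[of _ "0::real"])
  show "(SUP t. g t) \<le> (SUP t\<in>\<rat>. g t)"
  proof (rule cSUP_least)
    fix t
    show "g t \<le> (SUP t\<in>\<rat>. g t)"
    proof (rule ccontr)
      assume "\<not> g t \<le> (SUP t\<in>\<rat>. g t)"
      moreover have "(g \<longlongrightarrow> g t) (at_right t)" using cont[of t] by (simp add: continuous_within)
      ultimately have "\<forall>\<^sub>F s in at_right t. (SUP t\<in>\<rat>. g t) < g s" by (intro order_tendstoD(1)) auto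
      then obtain b where b: "b > t" "\<And>s. t < s \<Longrightarrow> s < b \<Longrightarrow> (SUP t\<in>\<rat>. g t) < g s"
        unfolding eventually_at_right_field by blast
      obtain s where s: "s \<in> \<rat>" "t < s" "s < b" using Rats_dense_in_real[OF b(1)] by blast
      have "g s \<le> (SUP t\<in>\<rat>. g t)" by (intro cSUP_upper bdd' s(1))
      with b(2)[OF s(2,3)] show False by simp
    qed
  qed simp
qed

text \<open>Polya's theorem in quantitative form: between neighbouring grid points monotonicity
  sandwiches \<open>h\<close>, and uniform continuity limits the increase of the limit. One grid
  serves all \<open>h\<close>, hence both the deterministic and the random distribution
  functions.\<close>

lemma (in real_distribution) finite_grid:
  assumes cont: "continuous_on UNIV (cdf M)" and e: "0 < e"
  shows "\<exists>S. finite S \<and> (\<forall>h. mono h \<and> (\<forall>t. 0 \<le> h t \<and> h t \<le> 1) \<and> (\<forall>s\<in>S. \<bar>h s - cdf M s\<bar> \<le> e) \<longrightarrow>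
      (\<forall>t. \<bar>h t - cdf M t\<bar> \<le> 2 * e))"
proof -
  define F where "F = cdf M"
  have Fmono: "F x \<le> F y" if "x \<le> y" for x y using cdf_nondecreasing[OF that] by (simp add: F_def)
  have F01: "0 \<le> F x" "F x \<le> 1" for x by (auto simp: F_def cdf_nonneg cdf_bounded_prob)
  have "\<forall>\<^sub>F x in at_bot. F x < e"
    using cdf_lim_at_bot e unfolding F_def by (intro order_tendstoD(2)) auto
  then obtain a\<^sub>0 where a0: "\<And>x. x \<le> a\<^sub>0 \<Longrightarrow> F x < e" unfolding eventually_at_bot_linorder by blast
  have "\<forall>\<^sub>F x in at_top. 1 - e < F x"
    using cdf_lim_at_top_prob e unfolding F_def by (intro order_tendstoD(1)) auto
  then obtain b\<^sub>0 where b0: "\<And>x. b\<^sub>0 \<le> x \<Longrightarrow> 1 - e < F x" unfolding eventually_at_top_linorder by blast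
  \<comment> \<open>Widening by 1 secures \<open>a < b\<close>. Outside the interval, monotonicity
    and the range [0, 1] alone keep \<open>h\<close> and \<open>F\<close> close.\<close>
  define a b where "a = min a\<^sub>0 b\<^sub>0 - 1" and "b = max a\<^sub>0 b\<^sub>0 + 1"
  have ab: "a < b" "F a < e" "1 - e < F b" by (auto simp: a_def b_def intro!: a0 b0)
  have "uniformly_continuous_on {a..b} F"
    using cont unfolding F_def by (intro compact_uniformly_continuous continuous_on_subset[OF cont]) auto
  then obtain d where d: "0 < d" "\<And>x y. x \<in> {a..b} \<Longrightarrow> y \<in> {a..b} \<Longrightarrow> dist y x < d \<Longrightarrow> dist (F y) (F x) < e"
    unfolding uniformly_continuous_on_def using e by metis
  obtain n :: nat where n: "(b - a) / d < real n" using reals_Archimedean2 by blast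
  then have n0: "0 < n" using ab d by (cases n) (auto simp: divide_less_eq)
  define w where "w = (b - a) / real n"
  have w: "0 < w" "w < d" using n n0 ab d by (auto simp: w_def field_simps)
  define s where "s j = a + real j * w" for j
  have sn: "s n = b" using n0 by (simp add: s_def w_def)
  have "\<bar>h t - F t\<bar> \<le> 2 * e"
    if h: "mono h" "\<And>t. 0 \<le> h t" "\<And>t. h t \<le> 1" "\<And>x. x \<in> s ` {..n} \<Longrightarrow> \<bar>h x - F x\<bar> \<le> e" for h t
  proof -
    have sa: "s 0 = a" by (simp add: s_def)
    have ha: "\<bar>h a - F a\<bar> \<le> e" and hb: "\<bar>h b - F b\<bar> \<le> e"
      using h(4)[of a] h(4)[of b] sa[symmetric] sn[symmetric] by auto
    consider "t < a" | "b \<le> t" | "a \<le> t" "t < b" by linarith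
    then show ?thesis
    proof cases
      case 1
      then show ?thesis
        using monoD[OF h(1), of t a] Fmono[of t a] ha ab h(2)[of t] F01(1)[of t] by linarith
    next
      case 2
      then show ?thesis
        using monoD[OF h(1), of b t] Fmono[of b t] hb ab h(3)[of t] F01(2)[of t] by linarith
    next
      case 3
      define j where "j = nat \<lfloor>(t - a) / w\<rfloor>"
      have nn: "0 \<le> (t - a) / w" using 3 w by simp
      have j: "real j \<le> (t - a) / w" "(t - a) / w < real j + 1"
        using nn by (auto simp: j_def of_nat_nat floor_correct)
      have sj: "s j \<le> t" "t \<le> s (Suc j)"
        using j w by (auto simp: s_def field_simps)
      have "(t - a) / w < real n" using 3 w n0 ab by (simp add: w_def field_simps)
      then have jn: "j < n" using j by linarith
      have in1: "s j \<in> {a..b}" "s (Suc j) \<in> {a..b}"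
      proof -
        have "s j \<le> s (Suc j)" "a \<le> s j" using w by (auto simp: s_def algebra_simps)
        moreover have "s (Suc j) \<le> s n" using jn w unfolding s_def by (intro add_left_mono mult_right_mono) auto
        ultimately show "s j \<in> {a..b}" "s (Suc j) \<in> {a..b}" using sn by auto
      qed
      have "dist (s (Suc j)) (s j) < d" using w by (simp add: s_def dist_real_def algebra_simps)
      from d(2)[OF in1 this] have "F (s (Suc j)) - F (s j) < e" by (simp add: dist_real_def)
      moreover have "\<bar>h (s j) - F (s j)\<bar> \<le> e" "\<bar>h (s (Suc j)) - F (s (Suc j))\<bar> \<le> e"
        using jn by (auto intro!: h(4))
      ultimately show ?thesis
        using monoD[OF h(1) sj(1)] monoD[OF h(1) sj(2)] Fmono[OF sj(1)] Fmono[OF sj(2)] by linarith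
    qed
  qed
  then show ?thesis unfolding F_def by (intro exI[of _ "s ` {..n}"]) auto
qed

lemma block_covariance:
  fixes \<xi> :: "nat \<Rightarrow> 'a \<Rightarrow> real"
  assumes M: "prob_space M" and gp: "gaussian_process M {1..} \<xi>" and st: "stationary_process M \<xi>"
    and mean: "\<And>n. 1 \<le> n \<Longrightarrow> (\<integral>\<omega>. \<xi> n \<omega> \<partial>M) = 0" and ij: "1 \<le> i" "1 \<le> j"
  shows "(\<integral>\<omega>. (\<Sum>p<l. a p * \<xi> (i + p) \<omega>) * (\<Sum>q<l. b q * \<xi> (j + q) \<omega>) \<partial>M) =
    (\<Sum>p<l. \<Sum>q<l. a p * b q * autocovariance M \<xi> (i + p - (j + q) + (j + q - (i + p))))"
proof -
  define J where "J = {i..<i + l} \<union> {j..<j + l}"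
  have J: "finite J" "J \<subseteq> {1..}" using ij by (auto simp: J_def)
  interpret gaussian_space M "lincombs \<xi> J"
    by (rule gaussian_space_lincombs[OF M gp _ J]) (use mean in auto)
  have mem: "\<xi> (i + p) \<in> lincombs \<xi> J" "\<xi> (j + p) \<in> lincombs \<xi> J" if "p < l" for p
    using that by (auto intro!: lincombs_member simp: J_def)
  show ?thesis
  proof (subst ip_sum)
    show "(\<Sum>p<l. \<Sum>q<l. a p * b q * ip (\<xi> (i + p)) (\<xi> (j + q))) =
        (\<Sum>p<l. \<Sum>q<l. a p * b q * autocovariance M \<xi> (i + p - (j + q) + (j + q - (i + p))))"
      by (intro sum.cong refl arg_cong2[where f = "(*)"] stationary_product_moment[OF st mean])
        (use ij in auto)
  qed (use mem in auto)
qed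

text \<open>Re-indexing both windows from 0 turns the three moments into forms of the
  autocovariance; \<open>l \<le> k\<close> puts the second window after the first, so the distance
  of two indices is \<open>k + q - p\<close>.\<close>

lemma block_linear_correlation:
  fixes \<xi> :: "nat \<Rightarrow> 'a \<Rightarrow> real"
  assumes M: "prob_space M" and gp: "gaussian_process M {1..} \<xi>" and st: "stationary_process M \<xi>"
    and mean: "\<And>n. 1 \<le> n \<Longrightarrow> (\<integral>\<omega>. \<xi> n \<omega> \<partial>M) = 0" and i: "1 \<le> i" and k: "l \<le> k"
    and cross: "\<And>a b. \<bar>cross_form (autocovariance M \<xi>) k a b l\<bar> \<le>
      \<rho> / 2 * (toeplitz_form (autocovariance M \<xi>) a l + toeplitz_form (autocovariance M \<xi>) b l)"
    and u: "u \<in> lincombs \<xi> {i..<i + l}" and v: "v \<in> lincombs \<xi> {i + k..<i + k + l}"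
  shows "\<bar>\<integral>\<omega>. u \<omega> * v \<omega> \<partial>M\<bar> \<le> \<rho> / 2 * ((\<integral>\<omega>. u \<omega> * u \<omega> \<partial>M) + (\<integral>\<omega>. v \<omega> * v \<omega> \<partial>M))"
proof -
  have shift: "(\<Sum>j\<in>{m..<m + l}. g j) = (\<Sum>p<l. g (m + p))" for m and g :: "nat \<Rightarrow> real"
    by (simp add: sum.atLeastLessThan_shift_0[of g m "m + l"] atLeast0LessThan o_def)
  have coeffs: "\<exists>a. w = (\<lambda>\<omega>. \<Sum>p<l. a p * \<xi> (m + p) \<omega>)" if w: "w \<in> lincombs \<xi> {m..<m + l}" for w m
  proof -
    obtain c where "w = (\<lambda>\<omega>. \<Sum>j\<in>{m..<m + l}. c j * \<xi> j \<omega>)" using w by (rule lincombsE)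
    then show ?thesis using shift by (intro exI[of _ "\<lambda>p. c (m + p)"]) simp
  qed
  obtain a where a: "u = (\<lambda>\<omega>. \<Sum>p<l. a p * \<xi> (i + p) \<omega>)" using coeffs[OF u] by blast
  obtain b where b: "v = (\<lambda>\<omega>. \<Sum>p<l. b p * \<xi> (i + k + p) \<omega>)" using coeffs[OF v] by blast
  note cov = block_covariance[OF M gp st mean]
  have uv: "(\<integral>\<omega>. u \<omega> * v \<omega> \<partial>M) = cross_form (autocovariance M \<xi>) k a b l"
    unfolding a b cross_form_def
  proof (subst cov)
    show "(\<Sum>p<l. \<Sum>q<l. a p * b q * autocovariance M \<xi> (i + p - (i + k + q) + (i + k + q - (i + p)))) =
        (\<Sum>p<l. \<Sum>q<l. a p * b q * autocovariance M \<xi> (k + q - p))"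
    proof (intro sum.cong refl)
      fix p q assume "p \<in> {..<l}" "q \<in> {..<l}"
      then have "i + p - (i + k + q) + (i + k + q - (i + p)) = k + q - p" using k by auto
      then show "a p * b q * autocovariance M \<xi> (i + p - (i + k + q) + (i + k + q - (i + p))) =
          a p * b q * autocovariance M \<xi> (k + q - p)" by simp
    qed
  qed (use i in auto)
  have uu: "(\<integral>\<omega>. u \<omega> * u \<omega> \<partial>M) = toeplitz_form (autocovariance M \<xi>) a l" and vv: "(\<integral>\<omega>. v \<omega> * v \<omega> \<partial>M) = toeplitz_form (autocovariance M \<xi>) b l"
    unfolding a b toeplitz_form_def using i by (subst cov; simp)+
  show ?thesis unfolding uv uu vv by (rule cross)
qed

text \<open>Chebyshev's inequality. By stationarity the mean of the estimator is the distribution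
  function of the first block's statistic; its variance is split into pairs at lag below and above
  \<open>\<delta> n\<close>.\<close>

lemma subsampling_concentration:
  fixes \<xi> X :: "nat \<Rightarrow> 'a \<Rightarrow> real" and l :: "nat \<Rightarrow> nat"
  assumes M: "prob_space M" and gp: "gaussian_process M {1..} \<xi>" and st: "stationary_process M \<xi>"
    and mean: "\<And>n. 1 \<le> n \<Longrightarrow> (\<integral>\<omega>. \<xi> n \<omega> \<partial>M) = 0"
    and G: "G \<in> borel_measurable borel" and X: "\<And>n \<omega>. X n \<omega> = G (\<xi> n \<omega>)"
    and T: "statistics T" and l1: "\<And>n. 1 \<le> n \<Longrightarrow> 1 \<le> l n"
    and rate: "\<And>\<delta>. 0 < \<delta> \<Longrightarrow> \<exists>R. R \<longlonglongrightarrow> 0 \<and> linear_mixing (autocovariance M \<xi>) l \<delta> R"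
  shows "\<forall>\<^sub>F n in sequentially. 2 * l n \<le> n \<and> (\<forall>t. subsampling_cdf T X (l n) n t \<in> borel_measurable M)"
    and "0 < e \<Longrightarrow> (\<lambda>n. measure M {\<omega>\<in>space M.
      e < \<bar>subsampling_cdf T X (l n) n t \<omega> - cdf (distr M borel (\<lambda>\<omega>. T (l n) (block X 1 (l n) \<omega>))) t\<bar>}) \<longlonglongrightarrow> 0"
proof -
  interpret prob_space M by fact
  define \<gamma> where "\<gamma> = autocovariance M \<xi>"
  have \<xi>meas: "\<xi> n \<in> borel_measurable M" if "1 \<le> n" for n
    using st that unfolding stationary_process_def by blast
  have Xmeas: "X n \<in> borel_measurable M" if "1 \<le> n" for n
    using measurable_compose[OF \<xi>meas[OF that] G] by (simp add: X[abs_def])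
  have blmeas: "block X i m \<in> measurable M (\<Pi>\<^sub>M j\<in>{1..m}. borel)" if "1 \<le> i" for i m
    by (rule block_measurable) (use that Xmeas in auto)
  have Tmeas: "T m \<in> borel_measurable (\<Pi>\<^sub>M j\<in>{1..m}. borel)" if "1 \<le> m" for m
    using T that unfolding statistics_def by blast
  have Tbl: "(\<lambda>\<omega>. T m (block X i m \<omega>)) \<in> borel_measurable M" if "1 \<le> i" "1 \<le> m" for i m
    by (rule measurable_compose[OF blmeas[OF that(1)] Tmeas[OF that(2)]])
  have Ymeas: "subsampling_cdf T X m n t \<in> borel_measurable M" if m: "1 \<le> m" for m n t
  proof -
    have "(\<lambda>\<omega>. indicator {..t} (T m (block X i m \<omega>)) :: real) \<in> borel_measurable M" if "1 \<le> i" for i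
      using Tbl[OF that m] by measurable
    then show ?thesis
      unfolding subsampling_cdf_def[abs_def] by (intro borel_measurable_times borel_measurable_sum) auto
  qed
  obtain R\<^sub>1 where "linear_mixing (autocovariance M \<xi>) l 1 R\<^sub>1"
    using rate[OF zero_less_one] by blast
  then have l2: "\<forall>\<^sub>F n in sequentially. 2 * l n \<le> n" by eventually_elim blast
  show "\<forall>\<^sub>F n in sequentially. 2 * l n \<le> n \<and> (\<forall>t. subsampling_cdf T X (l n) n t \<in> borel_measurable M)"
    using l2 eventually_ge_at_top[of 1] by eventually_elim (use Ymeas l1 in blast)
  define Z where "Z n = prob {\<omega>\<in>space M.
      e < \<bar>subsampling_cdf T X (l n) n t \<omega> - cdf (distr M borel (\<lambda>\<omega>. T (l n) (block X 1 (l n) \<omega>))) t\<bar>}" for n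
  show "(\<lambda>n. prob {\<omega>\<in>space M.
      e < \<bar>subsampling_cdf T X (l n) n t \<omega> - cdf (distr M borel (\<lambda>\<omega>. T (l n) (block X 1 (l n) \<omega>))) t\<bar>}) \<longlonglongrightarrow> 0"
    if e: "0 < e"
    unfolding Z_def[symmetric]
  proof (rule order_tendstoI)
    show "\<forall>\<^sub>F n in sequentially. z < Z n" if "z < 0" for z
      using that by (intro always_eventually allI) (auto simp: Z_def intro: less_le_trans)
    fix z :: real assume z: "0 < z"
    \<comment> \<open>With this value the near pairs contribute
      \<open>4 * \<delta> / e\<^sup>2 = z / 2\<close>; all remaining terms tend to 0.\<close>
    define \<delta> where "\<delta> = z * e\<^sup>2 / 8"
    have \<delta>: "0 < \<delta>" using z e by (simp add: \<delta>_def)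
    obtain R where R0: "R \<longlonglongrightarrow> 0" and R: "linear_mixing (autocovariance M \<xi>) l \<delta> R"
      using rate[OF \<delta>] by blast
    \<comment> \<open>The mixing lemma needs a strictly positive correlation bound, while
      \<open>R n\<close> may be 0 or negative; the added term vanishes in the limit.\<close>
    define \<rho> where "\<rho> n = \<bar>R n\<bar> + 1 / real (Suc n)" for n
    have "\<rho> \<longlonglongrightarrow> \<bar>0\<bar> + 0"
      unfolding \<rho>_def by (intro tendsto_intros R0 LIMSEQ_Suc[OF lim_1_over_n])
    then have \<rho>0: "\<rho> \<longlonglongrightarrow> 0" by simp
    have "\<forall>\<^sub>F n in sequentially. \<rho> n < 1" using \<rho>0 by (intro order_tendstoD(2)) auto
    moreover have "\<forall>\<^sub>F n in sequentially. (4 * \<delta> + 4 / real n + \<rho> n) / e\<^sup>2 < z"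
    proof (rule order_tendstoD(2))
      show "(\<lambda>n. (4 * \<delta> + 4 / real n + \<rho> n) / e\<^sup>2) \<longlonglongrightarrow> (4 * \<delta> + 0 + 0) / e\<^sup>2"
        using e by (intro tendsto_intros \<rho>0 lim_const_over_n) auto
      show "(4 * \<delta> + 0 + 0) / e\<^sup>2 < z" using e z by (simp add: \<delta>_def)
    qed
    ultimately show "\<forall>\<^sub>F n in sequentially. Z n < z"
      using R eventually_ge_at_top[of 1]
    proof eventually_elim
      case (elim n)
      define m where "m = l n"
      define N where "N = n + 1 - m"
      have m1: "1 \<le> m" using l1 elim by (simp add: m_def)
      have N: "1 \<le> N" "real n / 2 \<le> real N" "N \<le> n" using elim m1 by (auto simp: N_def m_def of_nat_diff)
      define E where "E = {x\<in>space (\<Pi>\<^sub>M j\<in>{1..m}. borel). T m x \<le> t}"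
      have E: "E \<in> sets (\<Pi>\<^sub>M j\<in>{1..m}. borel)"
        unfolding E_def using Tmeas[OF m1] by measurable
      define A where "A i = {\<omega>\<in>space M. block X i m \<omega> \<in> E}" for i
      have A_eq: "A i = {\<omega>\<in>space M. T m (block X i m \<omega>) \<le> t}" if "1 \<le> i" for i
        using measurable_space[OF blmeas[OF that, of m]] by (auto simp: A_def E_def)
      have A_ev: "A i \<in> events" if "1 \<le> i" for i
        unfolding A_eq[OF that] using Tbl[OF that m1] by measurable
      define F where "F = cdf (distr M borel (\<lambda>\<omega>. T m (block X 1 m \<omega>))) t"
      have F: "F = prob (A 1)"
        unfolding F_def cdf_def2 using Tbl[OF order_refl m1]
        by (subst measure_distr) (auto simp: A_eq vimage_def Int_def conj_commute)
      have pA: "prob (A i) = F" if "1 \<le> i" for i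
        unfolding F A_def by (rule block_distribution[OF st G X that E])
      have \<rho>pos: "0 < \<rho> n" "R n \<le> \<rho> n"
      proof -
        have "0 < 1 / real (Suc n)" by simp
        then show "0 < \<rho> n" "R n \<le> \<rho> n" unfolding \<rho>_def by linarith+
      qed
      have mix: "prob (A i \<inter> A (i + k)) - F * F \<le> \<rho> n"
        if ik: "1 \<le> i" "\<delta> * real n \<le> real k" "k \<le> n" for i k
      proof -
        have mk: "m \<le> k" and cross: "\<And>a b. \<bar>cross_form \<gamma> k a b m\<bar> \<le>
            R n / 2 * (toeplitz_form \<gamma> a m + toeplitz_form \<gamma> b m)"
          using elim ik unfolding m_def \<gamma>_def by blast+
        have V0: "0 \<le> toeplitz_form \<gamma> a m" for a
        proof -
          have "toeplitz_form \<gamma> a m = (\<integral>\<omega>. (\<Sum>p<m. a p * \<xi> (1 + p) \<omega>) * (\<Sum>p<m. a p * \<xi> (1 + p) \<omega>) \<partial>M)"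
            unfolding toeplitz_form_def \<gamma>_def by (subst block_covariance[OF M gp st mean]) simp_all
          also have "\<dots> \<ge> 0" by (intro Bochner_Integration.integral_nonneg) simp
          finally show ?thesis .
        qed
        have cross': "\<bar>cross_form \<gamma> k a b m\<bar> \<le>
            \<rho> n / 2 * (toeplitz_form \<gamma> a m + toeplitz_form \<gamma> b m)" for a b
          using cross[of a b] V0[of a] V0[of b] \<rho>pos
          by (elim order_trans) (intro mult_right_mono divide_right_mono, auto)
        have "prob (A i \<inter> A (i + k)) - prob (A i) * prob (A (i + k)) \<le> \<rho> n"
          unfolding A_def
          by (rule block_mixing[OF M gp mean G X ik(1) _ \<rho>pos(1) _ block_linear_correlation[OF M gp st mean ik(1) mk cross'[unfolded \<gamma>_def]] E])
            (use elim ik in auto)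
        then show ?thesis using pA ik by simp
      qed
      \<comment> \<open>Rounding up makes lag \<open>d\<close> count as far; the excess of at most 1
        is the source of the term \<open>4 / n\<close>.\<close>
      define d where "d = nat \<lceil>\<delta> * real n\<rceil>"
      have d: "\<delta> * real n \<le> real d" "real d \<le> \<delta> * real n + 1"
        using \<delta> by (auto simp: d_def of_nat_nat)
      have Y: "subsampling_cdf T X m n t \<omega> = 1 / real N * (\<Sum>i=1..N. indicator (A i) \<omega>)" if "\<omega> \<in> space M" for \<omega>
        unfolding subsampling_cdf_def N_def
        by (intro arg_cong2[where f = "(*)"] refl sum.cong) (use that in \<open>auto simp: A_eq indicator_def\<close>)
      define W where "W \<omega> = 1 / real N * (\<Sum>i=1..N. indicator (A i) \<omega>) - F" for \<omega>
      have "(\<integral>\<omega>. (W \<omega>)\<^sup>2 \<partial>M) \<le> 2 * real d / real N + \<rho> n"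
        unfolding W_def
      proof (rule average_second_moment)
        fix i j assume ij: "i \<in> {1..N}" "j \<in> {1..N}" "d \<le> i - j + (j - i)"
        show "prob (A i \<inter> A j) - F * F \<le> \<rho> n"
        proof (cases "i \<le> j")
          case True
          then show ?thesis using mix[of i "j - i"] ij d N by (auto simp: of_nat_diff)
        next
          case False
          then show ?thesis using mix[of j "i - j"] ij d N by (auto simp: of_nat_diff Int_commute)
        qed
      qed (use A_ev pA N \<rho>pos in auto)
      also have "\<dots> \<le> 4 * \<delta> + 4 / real n + \<rho> n"
      proof -
        have n0: "0 < real n" using elim by simp
        have "2 * real d / real N \<le> 2 * (\<delta> * real n + 1) / (real n / 2)"
          using d N n0 \<delta> by (intro frac_le) auto
        also have "\<dots> = 4 * \<delta> + 4 / real n" using n0 by (simp add: field_simps)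
        finally show ?thesis by simp
      qed
      finally have W2: "(\<integral>\<omega>. (W \<omega>)\<^sup>2 \<partial>M) \<le> 4 * \<delta> + 4 / real n + \<rho> n" .
      have Wmeas [measurable]: "W \<in> borel_measurable M"
        unfolding W_def[abs_def] using A_ev by (intro borel_measurable_diff borel_measurable_times borel_measurable_sum) auto
      have W1: "\<bar>W \<omega>\<bar> \<le> 2" for \<omega>
      proof -
        have "0 \<le> (\<Sum>i=1..N. indicator (A i) \<omega> :: real)" by (intro sum_nonneg) auto
        moreover have "(\<Sum>i=1..N. indicator (A i) \<omega> :: real) \<le> (\<Sum>i=1..N. 1)" by (intro sum_mono) (auto simp: indicator_def)
        ultimately have "0 \<le> 1 / real N * (\<Sum>i=1..N. indicator (A i) \<omega>)" "1 / real N * (\<Sum>i=1..N. indicator (A i) \<omega>) \<le> 1"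
          using N by (auto simp: divide_le_eq)
        moreover have "0 \<le> F" "F \<le> 1" by (simp_all add: F)
        ultimately show ?thesis unfolding W_def by linarith
      qed
      have iW: "integrable M (\<lambda>\<omega>. (W \<omega>)\<^sup>2)"
      proof (rule integrable_const_bound)
        have "norm ((W \<omega>)\<^sup>2) \<le> 4" for \<omega>
          using power_mono[OF W1[of \<omega>] abs_ge_zero, of 2] by simp
        then show "AE \<omega> in M. norm ((W \<omega>)\<^sup>2) \<le> 4" by simp
      qed measurable
      have "{\<omega>\<in>space M. e < \<bar>subsampling_cdf T X m n t \<omega> - F\<bar>} = {\<omega>\<in>space M. e < \<bar>W \<omega>\<bar>}"
        unfolding W_def by (rule Collect_cong) (simp add: Y cong: conj_cong)
      then have "Z n = prob {\<omega>\<in>space M. e < \<bar>W \<omega>\<bar>}"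
        unfolding Z_def m_def[symmetric] F_def[symmetric] by simp
      also have "\<dots> \<le> prob {\<omega>\<in>space M. e \<le> \<bar>W \<omega>\<bar>}" by (intro finite_measure_mono) auto
      also have "\<dots> \<le> (\<integral>\<omega>. (W \<omega>)\<^sup>2 \<partial>M) / e\<^sup>2"
        by (rule second_moment_method[OF Wmeas iW e])
      also have "\<dots> \<le> (4 * \<delta> + 4 / real n + \<rho> n) / e\<^sup>2" using W2 by (intro divide_right_mono) auto
      also have "\<dots> < z" using elim by simp
      finally show ?case .
    qed
  qed
qed

section \<open>Path properties of the subsampling distribution function\<close>

lemma subsampling_cdf_mono: "mono (\<lambda>t. subsampling_cdf T X m n t \<omega>)"
  unfolding subsampling_cdf_def
  by (intro monoI mult_left_mono sum_mono) (auto simp: indicator_def)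

lemma subsampling_cdf_bounds: "0 \<le> subsampling_cdf T X m n t \<omega>" "subsampling_cdf T X m n t \<omega> \<le> 1"
proof -
  have "(\<Sum>i=1..n + 1 - m. indicator {..t} (T m (block X i m \<omega>)) :: real) \<le> (\<Sum>i=1..n + 1 - m. 1)"
    by (intro sum_mono) (auto simp: indicator_def)
  then show "subsampling_cdf T X m n t \<omega> \<le> 1"
    \<comment> \<open>Without any block the sum is empty and the value is 0, so the bounds hold for
      all \<open>m\<close> and \<open>n\<close>.\<close>
    unfolding subsampling_cdf_def by (cases "n + 1 - m = 0") (auto simp: divide_le_eq)
  show "0 \<le> subsampling_cdf T X m n t \<omega>"
    unfolding subsampling_cdf_def by (intro mult_nonneg_nonneg sum_nonneg) auto
qed

lemma subsampling_cdf_right_continuous: "continuous (at_right t) (\<lambda>t. subsampling_cdf T X m n t \<omega>)"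
proof -
  have ind: "continuous (at_right t) (\<lambda>s. indicator {..s} x :: real)" for x
  proof (cases "x \<le> t")
    case True
    then show ?thesis
      unfolding continuous_within by (intro tendsto_eventually) (auto simp: eventually_at_filter)
  next
    case False
    then have "\<forall>\<^sub>F s in at_right t. s < x"
      unfolding eventually_at_right_field by (intro exI[of _ x]) auto
    then have "\<forall>\<^sub>F s in at_right t. (indicator {..s} x :: real) = indicator {..t} x"
      by eventually_elim (use False in auto)
    then show ?thesis unfolding continuous_within by (rule tendsto_eventually)
  qed
  show ?thesis
    unfolding subsampling_cdf_def by (intro continuous_intros ind)
qed

theorem theorem1:
  fixes M :: "'a measure" and N :: "'b measure"
    and D :: real and l :: "nat \<Rightarrow> nat"
    and \<xi> X :: "nat \<Rightarrow> 'a \<Rightarrow> real"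
    and L\<^sub>\<gamma> f L\<^sub>f G :: "real \<Rightarrow> real"
    and T :: "nat \<Rightarrow> (nat \<Rightarrow> real) \<Rightarrow> real"
    and T\<^sub>n :: "nat \<Rightarrow> 'a \<Rightarrow> real"
    and T_lim :: "'b \<Rightarrow> real"
  assumes "prob_space M"
    and "0 < D" "D \<le> 1"
    and "\<forall>n\<ge>1. l n \<ge> 1"
    and "mono_on {1..} l"
    and "filterlim l at_top sequentially"
    and "\<exists>\<epsilon>>0. (\<lambda>n. real (l n)) \<in> O(\<lambda>n. real n powr ((1 + D) / 2 - \<epsilon>))"
    and "gaussian_process M {1..} \<xi>"
    and "stationary_process M \<xi>"
    and "\<forall>n\<ge>1. prob_space.expectation M (\<xi> n) = 0"
    and "\<forall>n\<ge>1. prob_space.variance M (\<xi> n) = 1"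
    and "\<forall>k\<ge>1. autocovariance M \<xi> k = real k powr (- D) * L\<^sub>\<gamma> (real k)"
    and "slowly_varying_at_infinity L\<^sub>\<gamma>"
    and "\<exists>K. \<forall>k\<ge>1. \<forall>l'\<in>{l k..k}.
           (MAX k'\<in>{k + 1..k + 2 * l' - 1}. \<bar>L\<^sub>\<gamma> (real k) - L\<^sub>\<gamma> (real k')\<bar>)
             \<le> K * (real l' / real k) * min (L\<^sub>\<gamma> (real k)) 1"
    and "spectral_density (autocovariance M \<xi>) f"
    and "\<forall>x\<in>{-pi..pi} - {0}. f x = \<bar>x\<bar> powr (D - 1) * L\<^sub>f x"
    and "slowly_varying_at_origin L\<^sub>f"
    and "\<exists>C>0. \<forall>x\<in>{0..pi}. L\<^sub>f x \<ge> C"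
    and "\<exists>c::ereal. 0 < c \<and> ((\<lambda>x. ereal (L\<^sub>f x)) \<longlongrightarrow> c) (at 0)"
    and "G \<in> borel_measurable borel"
    and X: "\<And>n \<omega>. X n \<omega> = G (\<xi> n \<omega>)"
    and "statistics T"
    and T\<^sub>n: "\<And>n \<omega>. T\<^sub>n n \<omega> = T n (block X 1 n \<omega>)"
    and "prob_space N"
    and "T_lim \<in> borel_measurable N"
    and "weak_conv_m (\<lambda>n. distr M borel (T\<^sub>n n)) (distr N borel T_lim)"
  shows "(\<forall>t. isCont (cdf (distr N borel T_lim)) t \<longrightarrow>
            tendsto_in_probability M
              (\<lambda>n \<omega>. cdf (distr M borel (T\<^sub>n n)) t - subsampling_cdf T X (l n) n t \<omega>) 0) \<and>
         (continuous_on UNIV (cdf (distr N borel T_lim)) \<longrightarrow>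
            tendsto_in_probability M
              (\<lambda>n \<omega>. SUP t. \<bar>cdf (distr M borel (T\<^sub>n n)) t - subsampling_cdf T X (l n) n t \<omega>\<bar>) 0)"
proof -
  interpret prob_space M by fact
  have D: "0 < D" "D \<le> 1" by fact+
  have l1: "1 \<le> l n" if "1 \<le> n" for n using assms(4) that by blast
  have mean: "expectation (\<xi> n) = 0" if "1 \<le> n" for n using assms(10) that by blast
  have Lpos: "0 < L\<^sub>\<gamma> (real k)" if "1 \<le> k" for k
    using assms(13) that unfolding slowly_varying_at_infinity_def by simp
  obtain K where K: "\<And>k l'. 1 \<le> k \<Longrightarrow> l' \<in> {l k..k} \<Longrightarrow>
      (MAX k'\<in>{k + 1..k + 2 * l' - 1}. \<bar>L\<^sub>\<gamma> (real k) - L\<^sub>\<gamma> (real k')\<bar>)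
        \<le> K * (real l' / real k) * min (L\<^sub>\<gamma> (real k)) 1"
    using assms(14) by blast
  have increment: "\<bar>L\<^sub>\<gamma> (real k) - L\<^sub>\<gamma> (real m)\<bar> \<le> max K 0 * (real l' / real k)"
    if "1 \<le> k" "l k \<le> l'" "l' \<le> k" "k < m" "m < k + 2 * l'" for k l' m
  proof -
    have "\<bar>L\<^sub>\<gamma> (real k) - L\<^sub>\<gamma> (real m)\<bar> \<le> (MAX k'\<in>{k + 1..k + 2 * l' - 1}. \<bar>L\<^sub>\<gamma> (real k) - L\<^sub>\<gamma> (real k')\<bar>)"
      using that by (intro Max_ge finite_imageI imageI) auto
    also have "\<dots> \<le> K * (real l' / real k) * min (L\<^sub>\<gamma> (real k)) 1"
      using that by (intro K) auto
    \<comment> \<open>Passing to \<open>max K 0\<close> makes the factors nonnegative, so that the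
      minimum can be bounded by 1.\<close>
    also have "\<dots> \<le> max K 0 * (real l' / real k) * 1"
      using Lpos[OF that(1)] by (intro mult_mono mult_right_mono) auto
    finally show ?thesis by simp
  qed
  obtain C where C: "0 < C" "\<And>x. x \<in> {0..pi} \<Longrightarrow> C \<le> L\<^sub>f x" using assms(18) by blast
  have lower: "C * x powr (D - 1) \<le> f x" if "0 < x" "x < pi" for x
  proof -
    have "f x = x powr (D - 1) * L\<^sub>f x" using assms(16) that by auto
    moreover have "x powr (D - 1) * C \<le> x powr (D - 1) * L\<^sub>f x"
      using C(2)[of x] that by (intro mult_left_mono) auto
    ultimately show ?thesis by (simp add: mult.commute)
  qed
  have rate: "\<exists>R. R \<longlonglongrightarrow> 0 \<and> linear_mixing (autocovariance M \<xi>) l \<delta> R"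
    if "0 < \<delta>" for \<delta>
  proof (rule linear_mixing_rate[where K = "max K 0" and c = C and f = f and L = "\<lambda>k. L\<^sub>\<gamma> (real k)"])
    show "\<bar>L\<^sub>\<gamma> (real k) - L\<^sub>\<gamma> (real m)\<bar> \<le> max K 0 * (real l' / real k)"
      if "1 \<le> k" "l k \<le> l'" "l' \<le> k" "k < m" "m < k + 2 * l'" for k l' m
      using that by (rule increment)
    show "C * x powr (D - 1) \<le> f x" if "0 < x" "x < pi" for x using that by (rule lower)
    show "autocovariance M \<xi> k = real k powr (- D) * L\<^sub>\<gamma> (real k)" if "1 \<le> k" for k
      using assms(12) that by blast
    show "0 \<le> L\<^sub>\<gamma> (real k)" if "1 \<le> k" for k using Lpos[OF that] by simp
    show "1 \<le> l n" if "1 \<le> n" for n by (rule l1[OF that])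
  qed (use D C that assms(5,7,15) in auto)
  note conc = subsampling_concentration[OF assms(1,8,9) _ assms(20) X assms(22)]
  define F where "F = cdf (distr N borel T_lim)"
  define F\<^sub>n where "F\<^sub>n n = cdf (distr M borel (T\<^sub>n n))" for n
  define Y where "Y n t \<omega> = subsampling_cdf T X (l n) n t \<omega>" for n t \<omega>
  have Tdistr: "distr M borel (\<lambda>\<omega>. T (l n) (block X 1 (l n) \<omega>)) = distr M borel (T\<^sub>n (l n))" for n
    by (intro arg_cong[where f = "distr M borel"]) (simp add: T\<^sub>n fun_eq_iff)
  have Ymeas: "\<forall>\<^sub>F n in sequentially. \<forall>t. Y n t \<in> borel_measurable M"
  proof -
    have "\<forall>\<^sub>F n in sequentially. 2 * l n \<le> n \<and> (\<forall>t. subsampling_cdf T X (l n) n t \<in> borel_measurable M)"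
      by (rule conc(1)) (rule mean l1 rate, assumption)+
    then show ?thesis unfolding Y_def[abs_def] by eventually_elim blast
  qed
  have conc2: "(\<lambda>n. prob {\<omega>\<in>space M. e < \<bar>Y n t \<omega> - F\<^sub>n (l n) t\<bar>}) \<longlonglongrightarrow> 0" if "0 < e" for e t
    unfolding Y_def F\<^sub>n_def Tdistr[symmetric]
    by (rule conc(2)[OF _ _ _ that]) (rule mean l1 rate, assumption)+
  have weak: "(\<lambda>n. F\<^sub>n n t) \<longlonglongrightarrow> F t" if "isCont F t" for t
    using assms(26) that unfolding weak_conv_m_def weak_conv_def F_def F\<^sub>n_def by blast
  have weak_l: "(\<lambda>n. F\<^sub>n (l n) t) \<longlonglongrightarrow> F t" if "isCont F t" for t
    by (rule filterlim_compose[OF weak[OF that] assms(6)])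
  \<comment> \<open>The centre \<open>a\<close> is left free because two are needed:
    \<open>F\<^sub>n n t\<close> for the pointwise claim and \<open>F t\<close> at the grid points
    of the uniform one.\<close>
  have shift: "(\<lambda>n. prob {\<omega>\<in>space M. e < \<bar>Y n t \<omega> - a n\<bar>}) \<longlonglongrightarrow> 0"
    if t: "isCont F t" and a: "a \<longlonglongrightarrow> F t" and e: "0 < e" for a t e
  proof (rule tendsto_sandwich)
    show "\<forall>\<^sub>F n in sequentially. 0 \<le> prob {\<omega>\<in>space M. e < \<bar>Y n t \<omega> - a n\<bar>}" by simp
    have "(\<lambda>n. \<bar>F\<^sub>n (l n) t - a n\<bar>) \<longlonglongrightarrow> \<bar>F t - F t\<bar>"
      by (intro tendsto_intros weak_l t a)
    then have "\<forall>\<^sub>F n in sequentially. \<bar>F\<^sub>n (l n) t - a n\<bar> < e / 2"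
      using e by (intro order_tendstoD(2)) auto
    then show "\<forall>\<^sub>F n in sequentially. prob {\<omega>\<in>space M. e < \<bar>Y n t \<omega> - a n\<bar>} \<le>
        prob {\<omega>\<in>space M. e / 2 < \<bar>Y n t \<omega> - F\<^sub>n (l n) t\<bar>}"
      using Ymeas
    proof eventually_elim
      case (elim n)
      then have [measurable]: "Y n t \<in> borel_measurable M" by blast
      have "{\<omega>\<in>space M. e < \<bar>Y n t \<omega> - a n\<bar>} \<subseteq> {\<omega>\<in>space M. e / 2 < \<bar>Y n t \<omega> - F\<^sub>n (l n) t\<bar>}"
      proof (intro Collect_mono impI conjI; elim conjE)
        fix \<omega> assume "e < \<bar>Y n t \<omega> - a n\<bar>"
        then show "e / 2 < \<bar>Y n t \<omega> - F\<^sub>n (l n) t\<bar>" using elim(1) by linarith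
      qed
      then show ?case by (rule finite_measure_mono) measurable
    qed
    show "(\<lambda>n. prob {\<omega>\<in>space M. e / 2 < \<bar>Y n t \<omega> - F\<^sub>n (l n) t\<bar>}) \<longlonglongrightarrow> 0"
      using e by (intro conc2) simp
  qed simp
  have "tendsto_in_probability M (\<lambda>n \<omega>. F\<^sub>n n t - Y n t \<omega>) 0" if t: "isCont F t" for t
    unfolding tendsto_in_probability_def
  proof (intro conjI allI impI)
    show "\<forall>\<^sub>F n in sequentially. (\<lambda>\<omega>. F\<^sub>n n t - Y n t \<omega>) \<in> borel_measurable M"
      using Ymeas by eventually_elim (intro borel_measurable_diff borel_measurable_const, blast)
    show "(\<lambda>n. prob {\<omega>\<in>space M. e < \<bar>F\<^sub>n n t - Y n t \<omega> - 0\<bar>}) \<longlonglongrightarrow> 0" if "0 < e" for e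
      using shift[OF t weak[OF t] that] by (simp add: abs_minus_commute)
  qed
  moreover have "tendsto_in_probability M (\<lambda>n \<omega>. SUP t. \<bar>F\<^sub>n n t - Y n t \<omega>\<bar>) 0"
    if cont: "continuous_on UNIV F"
    unfolding tendsto_in_probability_def
  proof (intro conjI allI impI)
    interpret N: prob_space N by fact
    interpret Nd: real_distribution "distr N borel T_lim"
      by (rule N.real_distribution_distr) fact
    have Fcont: "isCont F t" for t using cont by (simp add: continuous_on_eq_continuous_at)
    have Tn_meas: "T\<^sub>n n \<in> borel_measurable M" if "1 \<le> n" for n
    proof -
      have "X j \<in> borel_measurable M" if "1 \<le> j" for j
      proof -
        have "\<xi> j \<in> borel_measurable M" using assms(9) that unfolding stationary_process_def by blast
        from measurable_compose[OF this assms(20)] show ?thesis by (simp add: X[abs_def])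
      qed
      then have "block X 1 n \<in> measurable M (\<Pi>\<^sub>M j\<in>{1..n}. borel)" by (intro block_measurable) auto
      moreover have "T n \<in> borel_measurable (\<Pi>\<^sub>M j\<in>{1..n}. borel)"
        using assms(22) that unfolding statistics_def by blast
      ultimately have "(\<lambda>\<omega>. T n (block X 1 n \<omega>)) \<in> borel_measurable M" by (rule measurable_compose)
      then show ?thesis by (simp add: T\<^sub>n[abs_def])
    qed
    have rd: "real_distribution (distr M borel (T\<^sub>n n))" if "1 \<le> n" for n
      by (rule real_distribution_distr[OF Tn_meas[OF that]])
    note fb = real_distribution.finite_borel_measure_M[OF rd]
    have Fn01: "0 \<le> F\<^sub>n n t" "F\<^sub>n n t \<le> 1" if "1 \<le> n" for n t
      unfolding F\<^sub>n_def using that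
      by (simp_all add: finite_borel_measure.cdf_nonneg[OF fb] real_distribution.cdf_bounded_prob[OF rd])
    have Fn_mono: "mono (F\<^sub>n n)" if "1 \<le> n" for n
      unfolding F\<^sub>n_def using that by (intro monoI finite_borel_measure.cdf_nondecreasing[OF fb])
    have Fn_cont: "continuous (at_right t) (F\<^sub>n n)" if "1 \<le> n" for n t
      unfolding F\<^sub>n_def using that by (intro finite_borel_measure.cdf_is_right_cont[OF fb])
    have diff1: "\<bar>F\<^sub>n n t - Y n t \<omega>\<bar> \<le> 1" if "1 \<le> n" for n t \<omega>
      using Fn01[OF that, of t] subsampling_cdf_bounds[of T X "l n" n t \<omega>] unfolding Y_def by (simp add: abs_le_iff)
    have Ybounds: "0 \<le> Y n t \<omega>" "Y n t \<omega> \<le> 1" and Ymono: "mono (\<lambda>t. Y n t \<omega>)"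
      and Ycont: "continuous (at_right t) (\<lambda>t. Y n t \<omega>)" for n t \<omega>
      unfolding Y_def by (rule subsampling_cdf_bounds subsampling_cdf_mono subsampling_cdf_right_continuous)+
    show "\<forall>\<^sub>F n in sequentially. (\<lambda>\<omega>. SUP t. \<bar>F\<^sub>n n t - Y n t \<omega>\<bar>) \<in> borel_measurable M"
      using Ymeas eventually_ge_at_top[of 1]
    proof eventually_elim
      case (elim n)
      have "(SUP t. \<bar>F\<^sub>n n t - Y n t \<omega>\<bar>) = (SUP t\<in>\<rat>. \<bar>F\<^sub>n n t - Y n t \<omega>\<bar>)" for \<omega>
        by (rule SUP_rationals_eq[where B = 1])
          (intro continuous_intros Fn_cont Ycont elim diff1)+
      moreover have "(\<lambda>\<omega>. SUP t\<in>\<rat>. \<bar>F\<^sub>n n t - Y n t \<omega>\<bar>) \<in> borel_measurable M"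
      proof (rule borel_measurable_cSUP)
        show "countable (\<rat> :: real set)" by (rule countable_rat)
        show "(\<lambda>\<omega>. \<bar>F\<^sub>n n t - Y n t \<omega>\<bar>) \<in> borel_measurable M" for t
        proof -
          have [measurable]: "Y n t \<in> borel_measurable M" using elim by blast
          show ?thesis by measurable
        qed
        show "bdd_above ((\<lambda>t. \<bar>F\<^sub>n n t - Y n t \<omega>\<bar>) ` \<rat>)" for \<omega>
          using diff1 elim by (intro bdd_aboveI[of _ 1]) auto
      qed
      ultimately show ?case by simp
    qed
    fix e :: real assume e: "0 < e"
    \<comment> \<open>On the good event \<open>F\<^sub>n n\<close> and \<open>Y n\<close> are both
      within \<open>2 * (e / 8)\<close> of \<open>F\<close> everywhere, hence within
      \<open>e / 2\<close> of each other.\<close>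
    obtain S where S: "finite S" "\<And>h t. mono h \<Longrightarrow> (\<And>t. 0 \<le> h t \<and> h t \<le> 1) \<Longrightarrow> (\<And>s. s \<in> S \<Longrightarrow> \<bar>h s - F s\<bar> \<le> e / 8) \<Longrightarrow>
        \<bar>h t - F t\<bar> \<le> 2 * (e / 8)"
      using Nd.finite_grid[of "e / 8"] cont e unfolding F_def by force
    show "(\<lambda>n. prob {\<omega>\<in>space M. e < \<bar>(SUP t. \<bar>F\<^sub>n n t - Y n t \<omega>\<bar>) - 0\<bar>}) \<longlonglongrightarrow> 0"
    proof (rule tendsto_sandwich)
      show "\<forall>\<^sub>F n in sequentially. 0 \<le> prob {\<omega>\<in>space M. e < \<bar>(SUP t. \<bar>F\<^sub>n n t - Y n t \<omega>\<bar>) - 0\<bar>}" by simp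
      have "(\<lambda>n. \<Sum>s\<in>S. prob {\<omega>\<in>space M. e / 8 < \<bar>Y n s \<omega> - F s\<bar>}) \<longlonglongrightarrow> (\<Sum>s\<in>S. 0)"
        using e by (intro tendsto_sum shift Fcont tendsto_const) simp
      then show "(\<lambda>n. \<Sum>s\<in>S. prob {\<omega>\<in>space M. e / 8 < \<bar>Y n s \<omega> - F s\<bar>}) \<longlonglongrightarrow> 0" by simp
      have "\<forall>\<^sub>F n in sequentially. \<bar>F\<^sub>n n s - F s\<bar> < e / 8" for s
      proof -
        have "(\<lambda>n. \<bar>F\<^sub>n n s - F s\<bar>) \<longlonglongrightarrow> \<bar>F s - F s\<bar>" by (intro tendsto_intros weak Fcont)
        then show ?thesis using e by (intro order_tendstoD(2)) auto
      qed
      then have "\<forall>\<^sub>F n in sequentially. \<forall>s\<in>S. \<bar>F\<^sub>n n s - F s\<bar> < e / 8"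
        using S(1) by (intro eventually_ball_finite) auto
      then show "\<forall>\<^sub>F n in sequentially. prob {\<omega>\<in>space M. e < \<bar>(SUP t. \<bar>F\<^sub>n n t - Y n t \<omega>\<bar>) - 0\<bar>} \<le>
          (\<Sum>s\<in>S. prob {\<omega>\<in>space M. e / 8 < \<bar>Y n s \<omega> - F s\<bar>})"
        using Ymeas eventually_ge_at_top[of 1]
      proof eventually_elim
        case (elim n)
        have meas: "{\<omega>\<in>space M. e / 8 < \<bar>Y n s \<omega> - F s\<bar>} \<in> events" for s
        proof -
          have [measurable]: "Y n s \<in> borel_measurable M" using elim by blast
          show ?thesis by measurable
        qed
        have Fn: "\<bar>F\<^sub>n n t - F t\<bar> \<le> 2 * (e / 8)" for t
          using elim by (intro S(2) Fn_mono) (auto intro: Fn01 less_imp_le)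
        have "\<bar>SUP t. \<bar>F\<^sub>n n t - Y n t \<omega>\<bar>\<bar> \<le> e" if \<omega>: "\<And>s. s \<in> S \<Longrightarrow> \<bar>Y n s \<omega> - F s\<bar> \<le> e / 8" for \<omega>
        proof -
          have Yt: "\<bar>Y n t \<omega> - F t\<bar> \<le> 2 * (e / 8)" for t
            by (rule S(2)[OF Ymono]) (use Ybounds \<omega> in auto)
          have le: "\<bar>F\<^sub>n n t - Y n t \<omega>\<bar> \<le> e" for t using Fn[of t] Yt[of t] e by linarith
          have "(SUP t. \<bar>F\<^sub>n n t - Y n t \<omega>\<bar>) \<le> e" by (intro cSUP_least le) simp
          \<comment> \<open>Any single argument shows that the supremum is nonnegative, which
            settles the outer absolute value.\<close>
          moreover have "\<bar>F\<^sub>n n 0 - Y n 0 \<omega>\<bar> \<le> (SUP t. \<bar>F\<^sub>n n t - Y n t \<omega>\<bar>)"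
            using le by (intro cSUP_upper bdd_aboveI[of _ e]) auto
          ultimately show ?thesis by linarith
        qed
        then have "{\<omega>\<in>space M. e < \<bar>(SUP t. \<bar>F\<^sub>n n t - Y n t \<omega>\<bar>) - 0\<bar>} \<subseteq>
            (\<Union>s\<in>S. {\<omega>\<in>space M. e / 8 < \<bar>Y n s \<omega> - F s\<bar>})"
          by (force simp: not_less)
        then have "prob {\<omega>\<in>space M. e < \<bar>(SUP t. \<bar>F\<^sub>n n t - Y n t \<omega>\<bar>) - 0\<bar>} \<le>
            prob (\<Union>s\<in>S. {\<omega>\<in>space M. e / 8 < \<bar>Y n s \<omega> - F s\<bar>})"
          using meas S(1) by (intro finite_measure_mono sets.finite_UN) auto
        also have "\<dots> \<le> (\<Sum>s\<in>S. prob {\<omega>\<in>space M. e / 8 < \<bar>Y n s \<omega> - F s\<bar>})"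
          using meas S(1) by (intro finite_measure_subadditive_finite) auto
        finally show ?case .
      qed
    qed simp
  qed
  ultimately show ?thesis unfolding F_def F\<^sub>n_def Y_def by blast
qed

end
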